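(* Let $\Gamma=([n],E_\Gamma)$ be a connected simple graph, and let $g$ be its girth, i.e. the minimal length of a cycle in $\Gamma$ ($g=+\infty$ if $\Gamma$ is a tree). Then the following hold. (1) For any generic spectrum $\lambda$, the face poset of the natural torus action on $M_{\Gamma,\lambda}$ is isomorphic to the cluster-permutohedron $\mathrm{Cl}_\Gamma$. (2) $\mathrm{Cl}_\Gamma$ is a locally geometric poset. Its 1-skeleton $(\mathrm{Cl}_\Gamma)_1$ is isomorphic to the Cayley graph $\mathrm{Cayley}_\Gamma$. For any element $x\in \mathrm{Cl}_\Gamma$ of rank $0$, the upper order ideal $(\mathrm{Cl}_\Gamma)_{\geqslant x}=\{y\in\mathrm{Cl}_\Gamma\mid y\geqslant x\}$ is isomorphic to the geometric lattice $\mathrm{Flats}(\Gamma)$ of the graphical matroid of $\Gamma$. (3) There exists a Galois connection between $\mathrm{Cl}_\Gamma$ and $\mathrm{Gr}_\Gamma$ (given by monotone maps $\iota\colon \mathrm{Cl}_\Gamma\to \mathrm{Gr}_\Gamma$ and $\pi\colon \mathrm{Gr}_\Gamma\to \mathrm{Cl}_\Gamma$, with $\pi$ left adjoint to $\iota$) preserving skeleta. The skeleton $(\mathrm{Cl}_\Gamma)_j$ is the core of the skeleton $(\mathrm{Gr}_\Gamma)_j$ for $j<\operatorname{rk}\mathrm{Cl}_\Gamma$. (4) The skeleta $(\mathrm{Cl}_\Gamma)_{g-2}$ and $(\mathrm{Gr}_\Gamma)_{g-2}$ are isomorphic. In particular, when $\Gamma$ is a tree there exists a canonical isomorphism $\mathrm{Cl}_\Gamma\cong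 \mathrm{Gr}_\Gamma$. (5) For any generic spectrum $\lambda$, the torus action on $M_{\Gamma,\lambda}$ is $(g-1)$-independent.
   Context: All posets are finite. $[n]=\{1,\ldots,n\}$, $V_\Gamma=[n]$, and $\Sigma_n$ is the symmetric group. Poset notions. A poset is graded if there is $\operatorname{rk}\colon S\to\mathbb Z_{\geqslant0}$ vanishing on minimal elements with $\operatorname{rk}s=\operatorname{rk}t+1$ whenever $s$ covers $t$; the rank of $S$ is the maximal rank of its elements. A geometric lattice is a graded lattice in which every element is a join of atoms and $\operatorname{rk}s+\operatorname{rk}t\geqslant\operatorname{rk}(s\vee t)+\operatorname{rk}(s\wedge t)$. A poset $S$ is locally geometric if it has a top element and $S_{\geqslant s}$ is a geometric lattice for every $s\in S$. A pair of monotone maps $f\colon S\rightleftarrows T\colon g$ is a Galois connection ($f$ left adjoint to $g$) if $f(s)\leqslant t\Leftrightarrow s\leqslant g(t)$ for all $s\in S,t\in T$. An upbeat (downbeat) of $S$ is an element covered by exactly one element (covering exactly one element). A poset with no upbeats and no downbeats is a core; if $T$ is a core obtained from $S$ by consecutive removals of upbeats and downbeats, $T$ is called the core of $S$ (it is unique up to isomorphism). Cluster-permutohedron. A clustering is an unordered partition $\mathcal C=\{V_1,\ldots,V_k\}$ of $V_\Gamma$ such that each induced subgraph $\Gamma_{V_i}$ is connected. Clusterings are ordered by refinement ($\mathcal C'\le\mathcal C$ if every block of $\mathcal C'$ lies in a block of $\mathcal C$) and have rank $n-|\mathcal C|$; this poset is the lattice $\mathrm{Flats}(\Gamma)$ of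 flats of the graphical matroid of $\Gamma$ (flats of the vector configuration $\{e_i-e_j\mid\{i,j\}\in E_\Gamma\}$, ordered by inclusion). Put $\Sigma_{\mathcal C}=\Sigma_{V_1}\times\cdots\times\Sigma_{V_k}$. Two bijections $p_1,p_2\colon V_\Gamma\to[n]$ are $\mathcal C$-equivalent if $p_1^{-1}\circ p_2\in\Sigma_{\mathcal C}$; an equivalence class is an assignment for $\mathcal C$. For $\mathcal C'\le\mathcal C$ there is a natural surjection $\mathrm{pr}_{\mathcal C'\le\mathcal C}$ from assignments for $\mathcal C'$ to assignments for $\mathcal C$. $\mathrm{Cl}_\Gamma$ is the set of pairs $(\mathcal C,\mathcal A)$, $\mathcal A$ an assignment for the clustering $\mathcal C$, with $(\mathcal C',\mathcal A')\le(\mathcal C,\mathcal A)$ iff $\mathcal C'\le\mathcal C$ and $\mathrm{pr}_{\mathcal C'\le\mathcal C}(\mathcal A')=\mathcal A$; $\operatorname{rk}(\mathcal C,\mathcal A)=n-|\mathcal C|$. Graphicahedron. For $W\subseteq E_\Gamma$ let $\mathcal C(W)$ be the clustering given by vertex sets of connected components of $([n],W)$. $\mathrm{Gr}_\Gamma$ is the set of pairs $(W,\mathcal A)$ with $W\subseteq E_\Gamma$ and $\mathcal A$ an assignment for $\mathcal C(W)$, with $(W',\mathcal A')\le(W,\mathcal A)$ iff $W'\subseteq W$ and $\mathrm{pr}_{\mathcal C(W')\le\mathcal C(W)}(\mathcal A')=\mathcal A$. Put $\mathrm{conn}((W,\mathcal A))=n-|\mathcal C(W)|$. Skeleta: $(\mathrm{Cl}_\Gamma)_j=\{s\mid\operatorname{rk}s\leqslant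 j\}$, $(\mathrm{Gr}_\Gamma)_j=\{s\mid\mathrm{conn}(s)\leqslant j\}$. A Galois connection preserves skeleta if both maps send the $j$-skeleton into the $j$-skeleton for all $j$. $\mathrm{Cayley}_\Gamma$ is the Cayley graph of $\Sigma_n$ with generating set of transpositions $\{(i,j)\mid\{i,j\}\in E_\Gamma\}$; isomorphism of a rank-$1$ poset with a graph means isomorphism with the poset of vertices and edges of the graph ordered by incidence. Isospectral manifolds. $M_\Gamma$ is the space of $n\times n$ Hermitian matrices $A=(a_{ij})$ with $a_{ij}=0$ whenever $i\ne j$ and $\{i,j\}\notin E_\Gamma$. For $\lambda=\{\lambda_1,\ldots,\lambda_n\}\subset\mathbb R$, $M_{\Gamma,\lambda}\subset M_\Gamma$ is the subset of matrices with spectrum $\lambda$. "Generic" $\lambda$ means the $\lambda_i$ are pairwise distinct and $M_{\Gamma,\lambda}$ is a smooth closed submanifold of $M_\Gamma$ (of real dimension $2|E_\Gamma|$). The torus $T^n$ of diagonal unitary matrices acts on $M_{\Gamma,\lambda}$ by conjugation, $a_{ij}\mapsto t_it_j^{-1}a_{ij}$; the fixed points are the $n!$ diagonal matrices. Faces of torus actions. Let a compact torus $T$ act on a smooth closed manifold $X$ with finite nonempty fixed point set $X^T$. A face submanifold is a connected component of $X^H$, for some closed connected subgroup $H\subset T$, that contains a $T$-fixed point; its quotient by $T$ is a face. The face poset $S(X)$ is the set of faces (equivalently face submanifolds) ordered by inclusion, graded by $\operatorname{rk}F=\dim T/T_F$, where $T_F$ is the noneffective kernel of the $T$-action on the face submanifold.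 At $x\in X^T$ let $\alpha_{x,1},\ldots,\alpha_{x,m}\in\operatorname{Hom}(T,S^1)$ ($\dim_{\mathbb R}X=2m$) be the weights, defined up to sign, of the tangent representation $T_xX$. The action is $j$-independent if for each $x\in X^T$ any subset of $\{\alpha_{x,1},\ldots,\alpha_{x,m}\}$ of cardinality $\leqslant j$ is linearly independent over $\mathbb Q$. *)

theory Defs
  imports
    "HOL-Analysis.Analysis"
    "HOL-Algebra.Galois_Connection"
    "HOL-Combinatorics.Transposition"
begin

section \<open>Finite posets\<close>

definition poset :: "'a set \<Rightarrow> ('a \<Rightarrow> 'a \<Rightarrow> bool) \<Rightarrow> 'a gorder" where
  "poset A r = \<lparr>carrier = A, eq = (=), le = r\<rparr>"

definition subposet :: "'a gorder \<Rightarrow> ('a \<Rightarrow> bool) \<Rightarrow> 'a gorder" where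
  "subposet S P = S\<lparr>carrier := {s \<in> carrier S. P s}\<rparr>"

definition upper_ideal :: "'a gorder \<Rightarrow> 'a \<Rightarrow> 'a gorder" where
  "upper_ideal S x = subposet S (\<lambda>y. x \<sqsubseteq>\<^bsub>S\<^esub> y)"

definition poset_iso :: "'a gorder \<Rightarrow> 'b gorder \<Rightarrow> ('a \<Rightarrow> 'b) \<Rightarrow> bool" where
  "poset_iso S T f \<longleftrightarrow> order_emb S T f \<and> bij_betw f (carrier S) (carrier T)"

definition isomorphic_posets :: "'a gorder \<Rightarrow> 'b gorder \<Rightarrow> bool" where
  "isomorphic_posets S T \<longleftrightarrow> (\<exists>f. poset_iso S T f)"

definition covers :: "'a gorder \<Rightarrow> 'a \<Rightarrow> 'a \<Rightarrow> bool" where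
  "covers S s t \<longleftrightarrow> s \<in> carrier S \<and> t \<in> carrier S \<and> t \<sqsubset>\<^bsub>S\<^esub> s \<and>
     \<not> (\<exists>u\<in>carrier S. t \<sqsubset>\<^bsub>S\<^esub> u \<and> u \<sqsubset>\<^bsub>S\<^esub> s)"

definition rank_function :: "'a gorder \<Rightarrow> ('a \<Rightarrow> nat) \<Rightarrow> bool" where
  "rank_function S rk \<longleftrightarrow>
     (\<forall>s\<in>carrier S. \<not> (\<exists>t\<in>carrier S. t \<sqsubset>\<^bsub>S\<^esub> s) \<longrightarrow> rk s = 0) \<and>
     (\<forall>s t. covers S s t \<longrightarrow> rk s = rk t + 1)"

definition poset_rank :: "'a gorder \<Rightarrow> ('a \<Rightarrow> nat) \<Rightarrow> nat" where
  "poset_rank S rk = Max (rk ` carrier S)"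

definition atom :: "'a gorder \<Rightarrow> 'a \<Rightarrow> bool" where
  "atom S s \<longleftrightarrow> (\<exists>b. least S b (carrier S) \<and> covers S s b)"

text \<open>
  The join of a set \<open>A\<close> is its least upper bound; the least element is the join of the empty
  set of atoms.
\<close>

definition geometric_lattice :: "'a gorder \<Rightarrow> bool" where
  "geometric_lattice S \<longleftrightarrow> lattice S \<and> finite (carrier S) \<and> carrier S \<noteq> {} \<and>
     (\<forall>s\<in>carrier S. \<exists>A\<subseteq>{a. atom S a}. least S s (Upper S A)) \<and>
     (\<exists>rk. rank_function S rk \<and>
       (\<forall>s\<in>carrier S. \<forall>t\<in>carrier S.
          rk s + rk t \<ge> rk (s \<squnion>\<^bsub>S\<^esub> t) + rk (s \<sqinter>\<^bsub>S\<^esub> t)))"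

definition locally_geometric :: "'a gorder \<Rightarrow> bool" where
  "locally_geometric S \<longleftrightarrow> partial_order S \<and> finite (carrier S) \<and>
     (\<exists>s. greatest S s (carrier S)) \<and>
     (\<forall>s\<in>carrier S. geometric_lattice (upper_ideal S s))"

definition upbeat :: "'a gorder \<Rightarrow> 'a \<Rightarrow> bool" where
  "upbeat S s \<longleftrightarrow> (\<exists>!t. covers S t s)"

definition downbeat :: "'a gorder \<Rightarrow> 'a \<Rightarrow> bool" where
  "downbeat S s \<longleftrightarrow> (\<exists>!t. covers S s t)"

definition beat_removal :: "'a gorder \<Rightarrow> 'a gorder \<Rightarrow> bool" where
  "beat_removal S T \<longleftrightarrow>
     (\<exists>s\<in>carrier S. (upbeat S s \<or> downbeat S s) \<and> T = subposet S (\<lambda>t. t \<noteq> s))"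

definition is_core :: "'a gorder \<Rightarrow> bool" where
  "is_core S \<longleftrightarrow> \<not> (\<exists>s. upbeat S s \<or> downbeat S s)"

text \<open>The core of a poset is only determined up to isomorphism.\<close>

definition is_core_of :: "'a gorder \<Rightarrow> 'b gorder \<Rightarrow> bool" where
  "is_core_of T S \<longleftrightarrow> is_core T \<and> (\<exists>T'. beat_removal\<^sup>*\<^sup>* S T' \<and> isomorphic_posets T T')"

text \<open>
  Skeleta are indexed by \<^typ>\<open>enat\<close>, so that the skeleton of index \<open>\<infinity>\<close> is the whole poset.
\<close>

definition skeleton :: "'a gorder \<Rightarrow> ('a \<Rightarrow> nat) \<Rightarrow> enat \<Rightarrow> 'a gorder" where
  "skeleton S rk j = subposet S (\<lambda>s. enat (rk s) \<le> j)"


section \<open>Graphs\<close>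

text \<open>
  The vertex set \<open>[n]\<close> is the finite type \<^typ>\<open>'n\<close>, so \<open>n = CARD('n)\<close>, and \<open>\<Sigma>\<^sub>n\<close> is
  the set of bijections \<^typ>\<open>'n \<Rightarrow> 'n\<close>. A graph is given by its set of edges.
\<close>

definition simple_graph :: "'n set set \<Rightarrow> bool" where
  "simple_graph E \<longleftrightarrow> (\<forall>e\<in>E. card e = 2)"

definition adj_on :: "'n set set \<Rightarrow> 'n set \<Rightarrow> ('n \<times> 'n) set" where
  "adj_on E V = {(x, y). x \<in> V \<and> y \<in> V \<and> {x, y} \<in> E}"

definition connected_on :: "'n set set \<Rightarrow> 'n set \<Rightarrow> bool" where
  "connected_on E V \<longleftrightarrow> V \<noteq> {} \<and> (\<forall>x\<in>V. \<forall>y\<in>V. (x, y) \<in> (adj_on E V)\<^sup>*)"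

definition is_cycle :: "'n set set \<Rightarrow> 'n list \<Rightarrow> bool" where
  "is_cycle E vs \<longleftrightarrow> 3 \<le> length vs \<and> distinct vs \<and>
     (\<forall>i<length vs. {vs ! i, vs ! (Suc i mod length vs)} \<in> E)"

definition girth :: "'n set set \<Rightarrow> enat" where
  "girth E = (INF vs \<in> {vs. is_cycle E vs}. enat (length vs))"

definition is_tree :: "'n set set \<Rightarrow> bool" where
  "is_tree E \<longleftrightarrow> simple_graph E \<and> connected_on E UNIV \<and> \<not> (\<exists>vs. is_cycle E vs)"

text \<open>
  The flats of the vector configuration \<open>e\<^sub>i - e\<^sub>j\<close>, \<open>{i, j} \<in> E\<close>. Each edge contributes both
  \<open>e\<^sub>i - e\<^sub>j\<close> and its negative, which does not affect spans.
\<close>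

definition edge_vectors :: "'n::finite set set \<Rightarrow> (real ^ 'n) set" where
  "edge_vectors F = {axis i 1 - axis j 1 | i j. {i, j} \<in> F}"

definition flats :: "'n::finite set set \<Rightarrow> 'n set set gorder" where
  "flats E = poset
     {F. F \<subseteq> E \<and> (\<forall>i j. {i, j} \<in> E \<and> axis i 1 - axis j 1 \<in> span (edge_vectors F) \<longrightarrow> {i, j} \<in> F)}
     (\<subseteq>)"

text \<open>The poset of vertices and edges of a graph, ordered by incidence.\<close>

definition graph_poset :: "'v set \<Rightarrow> 'v set set \<Rightarrow> ('v + 'v set) gorder" where
  "graph_poset V D = poset (Inl ` V \<union> Inr ` D)
     (\<lambda>x y. x = y \<or> (\<exists>v e. x = Inl v \<and> y = Inr e \<and> v \<in> e))"

definition cayley :: "'n set set \<Rightarrow> (('n \<Rightarrow> 'n) + ('n \<Rightarrow> 'n) set) gorder" where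
  "cayley E = graph_poset {p. bij p}
     {{p, p \<circ> Transposition.transpose i j} | p i j. bij p \<and> {i, j} \<in> E}"


section \<open>Cluster-permutohedron and graphicahedron\<close>

definition clustering :: "'n set set \<Rightarrow> 'n set set \<Rightarrow> bool" where
  "clustering E C \<longleftrightarrow> partition_on UNIV C \<and> (\<forall>V\<in>C. connected_on E V)"

definition young_subgroup :: "'n set set \<Rightarrow> ('n \<Rightarrow> 'n) set" where
  "young_subgroup C = {s. bij s \<and> (\<forall>V\<in>C. s ` V = V)}"

definition assignment_rel :: "'n set set \<Rightarrow> (('n \<Rightarrow> 'n) \<times> ('n \<Rightarrow> 'n)) set" where
  "assignment_rel C = {(p1, p2). bij p1 \<and> bij p2 \<and> inv p1 \<circ> p2 \<in> young_subgroup C}"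

definition assignments :: "'n set set \<Rightarrow> ('n \<Rightarrow> 'n) set set" where
  "assignments C = {p. bij p} // assignment_rel C"

text \<open>
  For a refinement \<open>C'\<close> of \<open>C\<close> every \<open>C'\<close>-equivalence class \<open>A'\<close> lies in a unique
  \<open>C\<close>-equivalence class, namely the following one.
\<close>

definition assignment_proj :: "'n set set \<Rightarrow> ('n \<Rightarrow> 'n) set \<Rightarrow> ('n \<Rightarrow> 'n) set" where
  "assignment_proj C A' = assignment_rel C `` A'"

definition cluster_perm :: "'n set set \<Rightarrow> ('n set set \<times> ('n \<Rightarrow> 'n) set) gorder" where
  "cluster_perm E = poset
     {(C, A). clustering E C \<and> A \<in> assignments C}
     (\<lambda>(C', A') (C, A). refines UNIV C' C \<and> assignment_proj C A' = A)"

definition cl_rank :: "'n::finite set set \<times> ('n \<Rightarrow> 'n) set \<Rightarrow> nat" where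
  "cl_rank = (\<lambda>(C, A). CARD('n) - card C)"

definition edge_clustering :: "'n set set \<Rightarrow> 'n set set" where
  "edge_clustering W = UNIV // (adj_on W UNIV)\<^sup>*"

definition graphicahedron :: "'n set set \<Rightarrow> ('n set set \<times> ('n \<Rightarrow> 'n) set) gorder" where
  "graphicahedron E = poset
     {(W, A). W \<subseteq> E \<and> A \<in> assignments (edge_clustering W)}
     (\<lambda>(W', A') (W, A). W' \<subseteq> W \<and> assignment_proj (edge_clustering W) A' = A)"

definition gr_conn :: "'n::finite set set \<times> ('n \<Rightarrow> 'n) set \<Rightarrow> nat" where
  "gr_conn = (\<lambda>(W, A). CARD('n) - card (edge_clustering W))"

definition gr_to_cl ::
    "'n set set \<times> ('n \<Rightarrow> 'n) set \<Rightarrow> 'n set set \<times> ('n \<Rightarrow> 'n) set" where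
  "gr_to_cl = (\<lambda>(W, A). (edge_clustering W, A))"


section \<open>Smooth submanifolds of Euclidean spaces\<close>

text \<open>
  \<open>C\<^sup>k\<close> maps on open sets, by recursion on \<open>k\<close>: the map is differentiable and all its directional
  derivatives are \<open>C\<^sup>k\<^sup>-\<^sup>1\<close>.
\<close>

fun Ck_on :: "nat \<Rightarrow> ('a::real_normed_vector \<Rightarrow> 'b::real_normed_vector) \<Rightarrow> 'a set \<Rightarrow> bool" where
  "Ck_on 0 f U \<longleftrightarrow> continuous_on U f"
| "Ck_on (Suc k) f U \<longleftrightarrow> (\<forall>x\<in>U. f differentiable (at x)) \<and>
     (\<forall>v. Ck_on k (\<lambda>x. frechet_derivative f (at x) v) U)"

definition smooth_on :: "('a::real_normed_vector \<Rightarrow> 'b::real_normed_vector) \<Rightarrow> 'a set \<Rightarrow> bool" where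
  "smooth_on f U \<longleftrightarrow> (\<forall>k. Ck_on k f U)"

text \<open>
  Embedded submanifolds of dimension \<open>d\<close>, by slice charts. For a subset of a linear subspace,
  being a submanifold of the subspace and being one of the ambient space is the same.
\<close>

definition smooth_submanifold :: "nat \<Rightarrow> 'm::euclidean_space set \<Rightarrow> bool" where
  "smooth_submanifold d X \<longleftrightarrow>
     (\<forall>x\<in>X. \<exists>U U' f g. \<exists>L :: 'm set. open U \<and> x \<in> U \<and> open U' \<and>
        smooth_on f U \<and> smooth_on g U' \<and> homeomorphism U U' f g \<and>
        subspace L \<and> dim L = d \<and> f ` (X \<inter> U) = L \<inter> U')"

definition tangent_space :: "'m::euclidean_space set \<Rightarrow> 'm \<Rightarrow> 'm set" where
  "tangent_space X x = {v. \<exists>c e. e > (0::real) \<and> smooth_on c {-e<..<e} \<and> c ` {-e<..<e} \<subseteq> X \<and>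
     c 0 = x \<and> (c has_vector_derivative v) (at 0)}"


section \<open>Torus actions\<close>

definition torus :: "(complex ^ 'n) set" where
  "torus = {t. \<forall>i. norm (t $ i) = 1}"

definition closed_connected_subgroup :: "(complex ^ 'n::finite) set \<Rightarrow> bool" where
  "closed_connected_subgroup H \<longleftrightarrow> H \<subseteq> torus \<and> closed H \<and> connected H \<and>
     1 \<in> H \<and> (\<forall>s\<in>H. \<forall>t\<in>H. s * t \<in> H) \<and> (\<forall>t\<in>H. (\<chi> i. inverse (t $ i)) \<in> H)"

text \<open>The torus acts on a subset \<open>X\<close> of a Euclidean space, by maps of the ambient space.\<close>

type_synonym ('n, 'm) torus_action = "complex ^ 'n \<Rightarrow> 'm \<Rightarrow> 'm"

definition fixed_points ::
    "('n, 'm) torus_action \<Rightarrow> (complex ^ 'n) set \<Rightarrow> 'm set \<Rightarrow> 'm set" where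
  "fixed_points act H X = {x \<in> X. \<forall>t\<in>H. act t x = x}"

definition face_submanifold ::
    "('n::finite, 'm::topological_space) torus_action \<Rightarrow> 'm set \<Rightarrow> 'm set \<Rightarrow> bool" where
  "face_submanifold act X F \<longleftrightarrow>
     (\<exists>H. closed_connected_subgroup H \<and> F \<in> components (fixed_points act H X)) \<and>
     F \<inter> fixed_points act torus X \<noteq> {}"

definition face_poset ::
    "('n::finite, 'm::topological_space) torus_action \<Rightarrow> 'm set \<Rightarrow> 'm set gorder" where
  "face_poset act X = poset {F. face_submanifold act X F} (\<subseteq>)"

definition noneffective_kernel ::
    "('n::finite, 'm) torus_action \<Rightarrow> 'm set \<Rightarrow> (complex ^ 'n) set" where
  "noneffective_kernel act F = {t \<in> torus. \<forall>x\<in>F. act t x = x}"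

text \<open>The dimension of a closed subgroup of the torus is the dimension of its Lie algebra.\<close>

definition lie_algebra :: "(complex ^ 'n::finite) set \<Rightarrow> (real ^ 'n) set" where
  "lie_algebra H = {x. \<forall>s::real. (\<chi> i. cis (s * x $ i)) \<in> H}"

definition face_rank :: "('n::finite, 'm) torus_action \<Rightarrow> 'm set \<Rightarrow> nat" where
  "face_rank act F = CARD('n) - dim (lie_algebra (noneffective_kernel act F))"

text \<open>The character group of the torus is identified with the lattice of exponent vectors.\<close>

definition character :: "('n::finite \<Rightarrow> int) \<Rightarrow> complex ^ 'n \<Rightarrow> complex" where
  "character a t = (\<Prod>i\<in>UNIV. (t $ i) powi (a i))"

text \<open>
  \<open>\<alpha> 0, \<dots>, \<alpha> (m - 1)\<close> are the weights of the tangent representation at the fixed point \<open>x\<close>: the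
  tangent space has a basis \<open>u 0, w 0, \<dots>, u (m - 1), w (m - 1)\<close> such that every \<open>t\<close> acts on the
  plane spanned by \<open>u k, w k\<close> as a rotation, identified with multiplication by \<open>character (\<alpha> k) t\<close>
  on \<open>\<complex>\<close>. Exchanging \<open>u k\<close> and \<open>w k\<close> replaces \<open>\<alpha> k\<close> by its negative.
\<close>

definition tangent_weights ::
    "('n::finite, 'm::euclidean_space) torus_action \<Rightarrow> 'm set \<Rightarrow> nat \<Rightarrow> 'm \<Rightarrow>
     (nat \<Rightarrow> 'n \<Rightarrow> int) \<Rightarrow> bool" where
  "tangent_weights act X m x \<alpha> \<longleftrightarrow>
     (\<exists>u w. let B = u ` {..<m} \<union> w ` {..<m} in
        card B = 2 * m \<and> independent B \<and> span B = tangent_space X x \<and>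
        (\<forall>t\<in>torus. \<forall>k<m. let D = frechet_derivative (act t) (at x); z = character (\<alpha> k) t in
           D (u k) = Re z *\<^sub>R u k + Im z *\<^sub>R w k \<and>
           D (w k) = - Im z *\<^sub>R u k + Re z *\<^sub>R w k))"

definition rat_independent :: "(nat \<Rightarrow> 'n \<Rightarrow> int) \<Rightarrow> nat set \<Rightarrow> bool" where
  "rat_independent \<alpha> J \<longleftrightarrow>
     (\<forall>c :: nat \<Rightarrow> rat. (\<forall>i. (\<Sum>k\<in>J. c k * of_int (\<alpha> k i)) = 0) \<longrightarrow> (\<forall>k\<in>J. c k = 0))"

text \<open>
  Here \<open>X\<close> has dimension \<open>2 m\<close>. Weights exist and are unique up to order and signs; existence is
  included so that the condition cannot hold vacuously. Weights are counted with multiplicity, so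
  repeated weights are dependent.
\<close>

definition j_independent ::
    "('n::finite, 'm::euclidean_space) torus_action \<Rightarrow> 'm set \<Rightarrow> nat \<Rightarrow> enat \<Rightarrow> bool" where
  "j_independent act X m j \<longleftrightarrow>
     (\<forall>x\<in>fixed_points act torus X.
        (\<exists>\<alpha>. tangent_weights act X m x \<alpha>) \<and>
        (\<forall>\<alpha>. tangent_weights act X m x \<alpha> \<longrightarrow>
           (\<forall>J\<subseteq>{..<m}. enat (card J) \<le> j \<longrightarrow> rat_independent \<alpha> J)))"


section \<open>Isospectral manifolds\<close>

definition graph_matrices :: "'n::finite set set \<Rightarrow> (complex ^ 'n ^ 'n) set" where
  "graph_matrices E = {A. (\<forall>i j. A $ i $ j = cnj (A $ j $ i)) \<and>
     (\<forall>i j. i \<noteq> j \<and> {i, j} \<notin> E \<longrightarrow> A $ i $ j = 0)}"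

text \<open>The spectrum is the family of roots of the characteristic polynomial, with multiplicity.\<close>

definition isospectral :: "'n::finite set set \<Rightarrow> ('n \<Rightarrow> real) \<Rightarrow> (complex ^ 'n ^ 'n) set" where
  "isospectral E l = {A \<in> graph_matrices E.
     \<forall>z. det (mat z - A) = (\<Prod>i\<in>UNIV. z - of_real (l i))}"

definition generic :: "'n::finite set set \<Rightarrow> ('n \<Rightarrow> real) \<Rightarrow> bool" where
  "generic E l \<longleftrightarrow> inj l \<and> compact (isospectral E l) \<and>
     smooth_submanifold (2 * card E) (isospectral E l)"

definition conj_action :: "('n::finite, complex ^ 'n ^ 'n) torus_action" where
  "conj_action t A = (\<chi> i j. t $ i * inverse (t $ j) * A $ i $ j)"

end

theory Submission
  imports Defs
begin

text \<open>
  A matrix fixed by a subtorus is block diagonal with respect to a clustering. Simplicity of the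
  spectrum separates the connected components of such a fixed point set by the zero sets of the block
  determinants, and two diagonal matrices in the same component are joined by rotating along edges;
  so the faces correspond to pairs of a clustering and an assignment. The order on the
  cluster-permutohedron is inclusion of assignments, and the ideals above its minimal elements are
  lattices of flats, whose ranks are dimensions of spans of the vectors \<open>e\<^sub>i - e\<^sub>j\<close>. Closing a set of
  edges under the edges inside its components gives the Galois connection, and the elements of the
  graphicahedron that are not closed are removed as upbeats, from the maximal ones downwards. Below
  the girth every set of edges is closed. The tangent space at a diagonal matrix consists of the
  Hermitian matrices supported at the edges, its weights are the characters \<open>e\<^sub>i - e\<^sub>j\<close>, and dependent
  sets of these contain the edges of a cycle.
\<close>

section \<open>Finite posets\<close>

text \<open>Every numerical bound comes from one configuration: an edge whose ends are already
  joined by other edges of a set W. With a simple path in W it forms a cycle, so with g the girth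
  the path has at least g vertices. Then W has conn at least g - 1, which is why every W with conn
  at most g - 2 is closed; and path and chord together have at least g edges, which is why g - 1
  weights are independent. No face is parametrised as a whole. Faces are compared through the
  diagonal matrices in them, which form exactly the assignment; the rest of the order follows from
  monotonicity of components. \<open>tangent_space\<close> is only a set of velocities of curves. It
  becomes a vector space by a squeeze: a slice chart gives a subspace of dimension 2 |E| inside it,
  and the equations of the isospectral set confine it to a space of the same dimension. The weights
  are quantified over all admissible bases, so exhibiting the edge basis settles existence only; for
  independence an arbitrary basis has to be matched with the edges.\<close>

lemma poset_simps [simp]:
  "carrier (poset A r) = A" "le (poset A r) = r" "eq (poset A r) = (=)"
  by (simp_all add: poset_def)

lemma poset_lless [simp]: "x \<sqsubset>\<^bsub>poset A r\<^esub> y \<longleftrightarrow> r x y \<and> x \<noteq> y"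
  by (simp add: lless_def)

lemma subposet_poset [simp]: "subposet (poset A r) P = poset {x \<in> A. P x} r"
  by (simp add: subposet_def poset_def)

lemma upper_ideal_poset: "upper_ideal (poset A r) x = poset {y \<in> A. r x y} r"
  by (simp add: upper_ideal_def)

lemma skeleton_poset: "skeleton (poset A r) rk j = poset {y \<in> A. enat (rk y) \<le> j} r"
  by (simp add: skeleton_def)

lemma Upper_poset: "B \<subseteq> A \<Longrightarrow> Upper (poset A r) B = {y \<in> A. \<forall>x\<in>B. r x y}"
  by (auto simp: Upper_def)

lemma Lower_poset: "B \<subseteq> A \<Longrightarrow> Lower (poset A r) B = {y \<in> A. \<forall>x\<in>B. r y x}"
  by (auto simp: Lower_def)

lemma least_poset: "U \<subseteq> A \<Longrightarrow> least (poset A r) x U \<longleftrightarrow> x \<in> U \<and> (\<forall>y\<in>U. r x y)"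
  by (auto simp: least_def)

lemma greatest_poset: "U \<subseteq> A \<Longrightarrow> greatest (poset A r) x U \<longleftrightarrow> x \<in> U \<and> (\<forall>y\<in>U. r y x)"
  by (auto simp: greatest_def)

lemma covers_poset: "covers (poset A r) s t \<longleftrightarrow> s \<in> A \<and> t \<in> A \<and> r t s \<and> t \<noteq> s \<and>
    (\<forall>u\<in>A. r t u \<and> r u s \<longrightarrow> u = t \<or> u = s)"
  by (auto simp: covers_def)

lemma partial_order_poset:
  "partial_order (poset A r) \<longleftrightarrow> (\<forall>x\<in>A. r x x) \<and> (\<forall>x\<in>A. \<forall>y\<in>A. r x y \<and> r y x \<longrightarrow> x = y) \<and>
    (\<forall>x\<in>A. \<forall>y\<in>A. \<forall>z\<in>A. r x y \<and> r y z \<longrightarrow> r x z)" (is "?L \<longleftrightarrow> ?R")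
proof
  assume ?L
  then interpret partial_order "poset A r" .
  show ?R using le_refl weak_le_antisym le_trans unfolding poset_simps by metis
next
  assume R: ?R
  show ?L by (unfold_locales; unfold poset_simps; use R in metis)
qed

lemma partial_order_weak: "partial_order L \<Longrightarrow> weak_partial_order L"
  by (simp add: partial_order_def)

lemma poset_iso_poset:
  assumes "partial_order (poset A r)" "partial_order (poset B q)"
  shows "poset_iso (poset A r) (poset B q) f \<longleftrightarrow>
    bij_betw f A B \<and> (\<forall>x\<in>A. \<forall>y\<in>A. q (f x) (f y) \<longleftrightarrow> r x y)"
  using assms[THEN partial_order_weak] by (auto simp: poset_iso_def order_emb_def)

lemma poset_iso_inv:
  assumes "poset_iso (poset A r) (poset B q) f"
  shows "poset_iso (poset B q) (poset A r) (inv_into A f)"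
proof -
  have bij: "bij_betw f A B" and emb: "\<And>x y. x \<in> A \<Longrightarrow> y \<in> A \<Longrightarrow> q (f x) (f y) \<longleftrightarrow> r x y"
    and w: "weak_partial_order (poset A r)" "weak_partial_order (poset B q)"
    using assms by (auto simp: poset_iso_def order_emb_def)
  have "inv_into A f y \<in> A" "f (inv_into A f y) = y" if "y \<in> B" for y
    using bij that by (auto simp: bij_betw_def inv_into_into f_inv_into_f)
  then have "r (inv_into A f x) (inv_into A f y) \<longleftrightarrow> q x y" if "x \<in> B" "y \<in> B" for x y
    using emb that by metis
  then show ?thesis
    using bij_betw_inv_into[OF bij] w by (simp add: poset_iso_def order_emb_def)
qed

lemma least_poset_unique:
  assumes "partial_order (poset A r)" "least (poset A r) x U" "least (poset A r) y U"
  shows "x = y"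
  using assms partial_order.least_unique by fastforce

lemma greatest_poset_unique:
  assumes "partial_order (poset A r)" "greatest (poset A r) x U" "greatest (poset A r) y U"
  shows "x = y"
  using assms partial_order.greatest_unique by fastforce

text \<open>\<open>join\<close> is a Hilbert choice among least upper bounds; antisymmetry leaves
  only one candidate, so any explicit least upper bound computes it.\<close>

lemma join_poset_eq:
  assumes "partial_order (poset A r)" "least (poset A r) x (Upper (poset A r) {s, t})"
  shows "s \<squnion>\<^bsub>poset A r\<^esub> t = x"
  unfolding join_def sup_def using assms(2) by (rule someI2) (rule least_poset_unique[OF assms(1) _ assms(2)])

lemma meet_poset_eq:
  assumes "partial_order (poset A r)" "greatest (poset A r) x (Lower (poset A r) {s, t})"
  shows "s \<sqinter>\<^bsub>poset A r\<^esub> t = x"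
  unfolding meet_def inf_def using assms(2) by (rule someI2) (rule greatest_poset_unique[OF assms(1) _ assms(2)])

lemma lattice_poset:
  assumes "partial_order (poset A r)"
  shows "lattice (poset A r) \<longleftrightarrow> (\<forall>x\<in>A. \<forall>y\<in>A. (\<exists>s. least (poset A r) s (Upper (poset A r) {x, y})) \<and>
    (\<exists>s. greatest (poset A r) s (Lower (poset A r) {x, y})))"
  using assms
  by (auto simp: lattice_def upper_semilattice_def lower_semilattice_def
      upper_semilattice_axioms_def lower_semilattice_axioms_def)

text \<open>The geometric structure is easiest to see on sets of edges and has to be carried to
  ideals of pairs. Bounds, extrema and covers are transported by \<open>f\<close>, the rank function
  by its inverse.\<close>

lemma geometric_lattice_iso:
  assumes iso: "poset_iso (poset A r) (poset B q) f" and geo: "geometric_lattice (poset A r)"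
    and poB: "partial_order (poset B q)"
  shows "geometric_lattice (poset B q)"
proof -
  let ?S = "poset A r" and ?T = "poset B q"
  have poA: "partial_order ?S"
    using geo unfolding geometric_lattice_def
    by (elim conjE) (intro lattice.axioms(1) upper_semilattice.axioms(1))
  have bij: "bij_betw f A B" and emb: "\<And>x y. x \<in> A \<Longrightarrow> y \<in> A \<Longrightarrow> q (f x) (f y) \<longleftrightarrow> r x y"
    using iso poset_iso_poset[OF poA poB] by auto
  have B: "B = f ` A" and inj: "inj_on f A" using bij by (auto simp: bij_betw_def)
  have up: "Upper ?T (f ` X) = f ` Upper ?S X" if "X \<subseteq> A" for X
    using that emb by (subst (1 2) Upper_poset) (auto simp: B image_iff, blast)
  have lo: "Lower ?T (f ` X) = f ` Lower ?S X" if "X \<subseteq> A" for X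
    using that emb by (subst (1 2) Lower_poset) (auto simp: B image_iff, blast)
  have least: "least ?T (f x) (f ` U)" if "least ?S x U" "U \<subseteq> A" for x U
    using that emb by (subst least_poset) (auto simp: B least_poset subset_iff)
  have greatest: "greatest ?T (f x) (f ` U)" if "greatest ?S x U" "U \<subseteq> A" for x U
    using that emb by (subst greatest_poset) (auto simp: B greatest_poset subset_iff)
  have upA: "Upper ?S X \<subseteq> A" and loA: "Lower ?S X \<subseteq> A" for X by (auto simp: Upper_def Lower_def)
  have cov: "covers ?T (f s) (f t) \<longleftrightarrow> covers ?S s t" if "s \<in> A" "t \<in> A" for s t
    using that emb inj by (auto simp: covers_poset B inj_on_eq_iff)
  \<comment> \<open>The same \<open>u\<close> serves on both sides, so the chosen joins in the two
    posets correspond under \<open>f\<close>.\<close>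
  have joinex: "\<exists>u\<in>A. least ?S u (Upper ?S {x, y}) \<and> least ?T (f u) (Upper ?T {f x, f y})"
    and meetex: "\<exists>u\<in>A. greatest ?S u (Lower ?S {x, y}) \<and> greatest ?T (f u) (Lower ?T {f x, f y})"
    if xy: "x \<in> A" "y \<in> A" for x y
  proof -
    obtain u where u: "least ?S u (Upper ?S {x, y})"
      using geo xy unfolding geometric_lattice_def lattice_poset[OF poA] by blast
    then show "\<exists>u\<in>A. least ?S u (Upper ?S {x, y}) \<and> least ?T (f u) (Upper ?T {f x, f y})"
      using least[OF u upA] up[of "{x,y}"] xy upA[of "{x,y}"] by (auto simp: least_def)
    obtain u where u: "greatest ?S u (Lower ?S {x, y})"
      using geo xy unfolding geometric_lattice_def lattice_poset[OF poA] by blast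
    then show "\<exists>u\<in>A. greatest ?S u (Lower ?S {x, y}) \<and> greatest ?T (f u) (Lower ?T {f x, f y})"
      using greatest[OF u loA] lo[of "{x,y}"] xy loA[of "{x,y}"] by (auto simp: greatest_def)
  qed
  have lat: "lattice ?T"
    unfolding lattice_poset[OF poB] using joinex meetex by (fastforce simp: B)
  have atom: "atom ?T (f a)" if "atom ?S a" for a
    using that cov least[of _ A] unfolding atom_def
    by (metis (no_types, lifting) B covers_poset order_refl poset_simps(1))
  have atomA: "atom ?S a \<Longrightarrow> a \<in> A" for a by (auto simp: atom_def covers_poset)
  have join: "\<exists>X\<subseteq>{a. atom ?T a}. least ?T s (Upper ?T X)" if sB: "s \<in> B" for s
  proof -
    obtain x where x: "x \<in> A" "s = f x" using sB B by blast
    have "\<exists>X\<subseteq>{a. atom ?S a}. least ?S x (Upper ?S X)"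
      using geo x(1) unfolding geometric_lattice_def by (elim conjE) (drule bspec, auto)
    then obtain X where X: "X \<subseteq> {a. atom ?S a}" "least ?S x (Upper ?S X)" by blast
    then have "X \<subseteq> A" using atomA by blast
    then show ?thesis using X least[OF X(2) upA] up atom x by (intro exI[of _ "f ` X"]) auto
  qed
  obtain rk where rk: "rank_function ?S rk" and semi: "\<And>s t. s \<in> A \<Longrightarrow> t \<in> A \<Longrightarrow>
      rk s + rk t \<ge> rk (s \<squnion>\<^bsub>?S\<^esub> t) + rk (s \<sqinter>\<^bsub>?S\<^esub> t)"
    using geo unfolding geometric_lattice_def poset_simps by blast
  let ?g = "inv_into A f"
  have gf: "?g (f x) = x" if "x \<in> A" for x using inj that by simp
  have rk': "rank_function ?T (\<lambda>y. rk (?g y))"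
    unfolding rank_function_def
  proof (intro conjI allI impI ballI)
    fix s assume "s \<in> carrier ?T" and min: "\<not> (\<exists>t\<in>carrier ?T. t \<sqsubset>\<^bsub>?T\<^esub> s)"
    then obtain x where x: "x \<in> A" "s = f x" using B by auto
    have "\<not> (\<exists>t\<in>A. r t x \<and> t \<noteq> x)" using min x emb inj by (auto simp: B inj_on_eq_iff)
    then show "rk (?g s) = 0" using rk x gf by (auto simp: rank_function_def)
  next
    fix s t assume c: "covers ?T s t"
    then have "s \<in> B" "t \<in> B" by (auto simp: covers_poset)
    then obtain x y where x: "x \<in> A" "s = f x" "y \<in> A" "t = f y" using B by auto
    then have "covers ?S x y" using c cov by simp
    then show "rk (?g s) = rk (?g t) + 1" using rk x gf by (auto simp: rank_function_def)
  qed
  have semi': "rk (?g s) + rk (?g t) \<ge> rk (?g (s \<squnion>\<^bsub>?T\<^esub> t)) + rk (?g (s \<sqinter>\<^bsub>?T\<^esub> t))"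
    if st: "s \<in> B" "t \<in> B" for s t
  proof -
    obtain x y where x: "x \<in> A" "s = f x" "y \<in> A" "t = f y" using B st by auto
    obtain u where u: "u \<in> A" "least ?S u (Upper ?S {x, y})" "least ?T (f u) (Upper ?T {s, t})"
      using joinex x by blast
    obtain v where v: "v \<in> A" "greatest ?S v (Lower ?S {x, y})" "greatest ?T (f v) (Lower ?T {s, t})"
      using meetex x by blast
    show ?thesis
      using semi[OF x(1) x(3)] join_poset_eq[OF poA u(2)] join_poset_eq[OF poB u(3)]
        meet_poset_eq[OF poA v(2)] meet_poset_eq[OF poB v(3)] gf x u(1) v(1) by simp
  qed
  have "finite B" "B \<noteq> {}" using geo B by (auto simp: geometric_lattice_def)
  then show ?thesis
    unfolding geometric_lattice_def using lat join rk' semi' by auto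
qed

text \<open>A maximal element not fixed by the closure operator is covered only by its closure, hence is an
  upbeat.\<close>

lemma beat_removal_closure:
  assumes fin: "finite A" and po: "partial_order (poset A r)"
    and c: "\<And>x. x \<in> A \<Longrightarrow> c x \<in> A" "\<And>x. x \<in> A \<Longrightarrow> r x (c x)" "\<And>x. x \<in> A \<Longrightarrow> c (c x) = c x"
    and mono: "\<And>x y. x \<in> A \<Longrightarrow> y \<in> A \<Longrightarrow> r x y \<Longrightarrow> r (c x) (c y)"
  shows "beat_removal\<^sup>*\<^sup>* (poset A r) (poset {x \<in> A. c x = x} r)"
proof -
  have "beat_removal\<^sup>*\<^sup>* (poset B r) (poset {x \<in> A. c x = x} r)"
    if "B \<subseteq> A" "{x \<in> A. c x = x} \<subseteq> B" for B
    using that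
  \<comment> \<open>The intermediate posets live on sets \<open>B\<close> between the fixed elements
    and \<open>A\<close>; the induction counts the elements that still have to go.\<close>
  proof (induction "card (B - {x \<in> A. c x = x})" arbitrary: B)
    case 0
    then have "B = {x \<in> A. c x = x}" using finite_subset[OF _ fin] by auto
    then show ?case by simp
  next
    case (Suc k)
    have refl: "r x x" if "x \<in> A" for x using po that unfolding partial_order_poset by blast
    have anti: "x = y" if "x \<in> A" "y \<in> A" "r x y" "r y x" for x y
      using po that unfolding partial_order_poset by blast
    have trans: "r x z" if "x \<in> A" "y \<in> A" "z \<in> A" "r x y" "r y z" for x y z
      using po that unfolding partial_order_poset by blast
    let ?N = "B - {x \<in> A. c x = x}"
    have N: "finite ?N" "?N \<noteq> {}" using Suc finite_subset[OF _ fin] by (auto simp flip: card_gt_0_iff)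
    have "\<exists>x\<in>?N. \<forall>y\<in>?N. r x y \<longrightarrow> y = x"
    proof -
      \<comment> \<open>The strict order reversed: transitive and irreflexive on a finite set, it is
        well founded, and a minimal element for it is a maximal element of
        \<open>?N\<close>.\<close>
      define gt where "gt = {(y, x). y \<in> ?N \<and> x \<in> ?N \<and> r x y \<and> x \<noteq> y}"
      have "?N \<subseteq> A" using Suc.prems(1) by blast
      have "trans gt"
      proof (rule transI)
        fix x y z assume "(x, y) \<in> gt" "(y, z) \<in> gt"
        then have xyz: "x \<in> ?N" "z \<in> ?N" "r y x" "r z y" "y \<noteq> z" "x \<in> A" "y \<in> A" "z \<in> A"
          using \<open>?N \<subseteq> A\<close> by (auto simp: gt_def)
        then have "r z x" using trans by metis
        moreover have "z \<noteq> x" using xyz anti by metis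
        ultimately show "(x, z) \<in> gt" using xyz by (simp add: gt_def)
      qed
      then have "acyclic gt" by (auto simp: acyclic_def) (auto simp: gt_def)
      moreover have "finite gt" by (rule finite_subset[of _ "?N \<times> ?N"]) (use N in \<open>auto simp: gt_def\<close>)
      ultimately have "wf gt" by (rule finite_acyclic_wf[rotated])
      then obtain x where "x \<in> ?N" "\<And>y. (y, x) \<in> gt \<Longrightarrow> y \<notin> ?N" using N(2) by (meson ex_in_conv wfE_min)
      then show ?thesis by (auto simp: gt_def)
    qed
    then obtain x where x: "x \<in> ?N" and max: "\<And>y. y \<in> ?N \<Longrightarrow> r x y \<Longrightarrow> y = x" by blast
    have xA: "x \<in> A" "c x \<noteq> x" using x Suc.prems by auto
    have cB: "c x \<in> B" using c xA Suc.prems by auto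
    \<comment> \<open>By maximality everything in \<open>B\<close> strictly above \<open>x\<close>
      is fixed by \<open>c\<close>, so monotonicity puts \<open>c x\<close> below it.\<close>
    have above: "r (c x) y" if "y \<in> B" "r x y" "y \<noteq> x" for y
    proof -
      have "c y = y" "y \<in> A" using max[of y] that Suc.prems by auto
      then show ?thesis using mono[of x y] xA that by auto
    qed
    have "covers (poset B r) t x \<longleftrightarrow> t = c x" for t
    proof
      assume "covers (poset B r) t x"
      then show "t = c x" unfolding covers_poset using above[of t] cB c(2) xA by auto
    next
      assume "t = c x"
      then show "covers (poset B r) t x" unfolding covers_poset
        using above cB c(1,2) xA x anti Suc.prems(1) by (smt (verit) DiffD1 in_mono)
    qed
    then have "upbeat (poset B r) x" by (auto simp: upbeat_def)
    then have "beat_removal (poset B r) (poset (B - {x}) r)"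
      using x unfolding beat_removal_def by (auto intro!: bexI[of _ x] arg_cong[where f="\<lambda>X. poset X r"])
    moreover have "beat_removal\<^sup>*\<^sup>* (poset (B - {x}) r) (poset {x \<in> A. c x = x} r)"
    proof (rule Suc.hyps)
      have "B - {x} - {x \<in> A. c x = x} = ?N - {x}" by blast
      then show "k = card (B - {x} - {x \<in> A. c x = x})" using Suc.hyps(2) x N by simp
      show "B - {x} \<subseteq> A" "{x \<in> A. c x = x} \<subseteq> B - {x}" using Suc.prems xA by auto
    qed
    ultimately show ?case by (rule converse_rtranclp_into_rtranclp)
  qed
  then show ?thesis by simp
qed


section \<open>Flats of a vector configuration\<close>

text \<open>These are the flats of the contraction by \<open>F0\<close>, which is why
  \<open>F0\<close> is required to be a flat and the rank subtracts its dimension. Covers arise by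
  adding one vector and closing, which rests on the exchange property; semimodularity is the
  dimension formula for a sum of two subspaces.\<close>

lemma geometric_lattice_flats_above:
  fixes v :: "'e \<Rightarrow> 'v::euclidean_space"
  assumes fin: "finite E" and F0: "F0 \<subseteq> E" "\<And>e. e \<in> E \<Longrightarrow> v e \<in> span (v ` F0) \<Longrightarrow> e \<in> F0"
  shows "geometric_lattice
    (poset {F. F \<subseteq> E \<and> (\<forall>e\<in>E. v e \<in> span (v ` F) \<longrightarrow> e \<in> F) \<and> F0 \<subseteq> F} (\<subseteq>))"
proof -
  define A where "A = {F. F \<subseteq> E \<and> (\<forall>e\<in>E. v e \<in> span (v ` F) \<longrightarrow> e \<in> F) \<and> F0 \<subseteq> F}"
  define cl where "cl F = {e \<in> E. v e \<in> span (v ` F)}" for F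
  have cl_sup: "F \<subseteq> cl F" if "F \<subseteq> E" for F using that by (auto simp: cl_def intro: span_base)
  have span_cl: "span (v ` cl F) = span (v ` F)" if "F \<subseteq> E" for F
  proof
    show "span (v ` cl F) \<subseteq> span (v ` F)"
      by (rule span_minimal) (auto simp: cl_def)
    show "span (v ` F) \<subseteq> span (v ` cl F)" using cl_sup[OF that] by (intro span_mono image_mono)
  qed
  have cl_A: "cl F \<in> A" if "F \<subseteq> E" "F0 \<subseteq> F" for F
    using span_cl[OF that(1)] cl_sup[OF that(1)] that by (auto simp: A_def cl_def)
  have cl_min: "cl F \<subseteq> G" if "F \<subseteq> G" "G \<in> A" for F G
    using that span_mono[of "v ` F" "v ` G"] by (auto simp: A_def cl_def)
  have A_E: "F \<subseteq> E" and A_F0: "F0 \<subseteq> F" and A_cl: "\<And>e. e \<in> E \<Longrightarrow> v e \<in> span (v ` F) \<Longrightarrow> e \<in> F"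
    if "F \<in> A" for F using that by (auto simp: A_def)
  have F0A: "F0 \<in> A" using F0 by (auto simp: A_def)
  let ?S = "poset A (\<subseteq>)"
  have po: "partial_order ?S" by (auto simp: partial_order_poset)
  have joinl: "least ?S (cl (F \<union> G)) (Upper ?S {F, G})" if "F \<in> A" "G \<in> A" for F G
  proof -
    have "cl (F \<union> G) \<in> A" using cl_A A_E A_F0 that by (meson Un_least le_supI1)
    moreover have "F \<union> G \<subseteq> cl (F \<union> G)" using cl_sup A_E that by (meson Un_least)
    ultimately show ?thesis using that cl_min by (subst least_poset) (auto simp: Upper_poset)
  qed
  have meetl: "greatest ?S (F \<inter> G) (Lower ?S {F, G})" if "F \<in> A" "G \<in> A" for F G
  proof -
    have "F \<inter> G \<in> A" unfolding A_def
    proof (intro CollectI conjI ballI impI)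
      show "F \<inter> G \<subseteq> E" "F0 \<subseteq> F \<inter> G" using that A_E A_F0 by blast+
      fix e assume e: "e \<in> E" "v e \<in> span (v ` (F \<inter> G))"
      then have "v e \<in> span (v ` F)" "v e \<in> span (v ` G)"
        using span_mono[of "v ` (F \<inter> G)" "v ` F"] span_mono[of "v ` (F \<inter> G)" "v ` G"] by blast+
      then show "e \<in> F \<inter> G" using A_cl that e by blast
    qed
    then show ?thesis using that by (subst greatest_poset) (auto simp: Lower_poset)
  qed
  have insA: "cl (insert e F) \<in> A" if "F \<in> A" "e \<in> E" for e F
    using that A_E A_F0 by (intro cl_A) auto
  have cov: "covers ?S (cl (insert e F)) F" if F: "F \<in> A" and e: "e \<in> E" "e \<notin> F" for e F
  proof -
    have sub: "insert e F \<subseteq> cl (insert e F)" using cl_sup[of "insert e F"] F e A_E by blast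
    have "u = cl (insert e F)" if u: "u \<in> A" "F \<subseteq> u" "u \<noteq> F" "u \<subseteq> cl (insert e F)" for u
    proof -
      obtain d where d: "d \<in> u" "d \<notin> F" using u by blast
      then have "v d \<notin> span (v ` F)" using A_cl[OF F] A_E[OF u(1)] by blast
      moreover have "v d \<in> span (insert (v e) (v ` F))" using d u(4) by (auto simp: cl_def)
      \<comment> \<open>Exchange: a vector gained by adding \<open>v e\<close> yields
        \<open>v e\<close> back, so nothing lies strictly between \<open>F\<close> and the
        closure.\<close>
      ultimately have "v e \<in> span (insert (v d) (v ` F))" by (rule in_span_insert[rotated])
      then have "v e \<in> span (v ` u)"
        using span_mono[of "insert (v d) (v ` F)" "v ` u"] d u(2) by blast
      then have "e \<in> u" using A_cl u(1) e by blast
      then have "cl (insert e F) \<subseteq> u" using u(1,2) by (intro cl_min) auto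
      then show ?thesis using u(4) by blast
    qed
    then show ?thesis unfolding covers_poset using F insA[OF F e(1)] sub e by blast
  qed
  have atom: "atom ?S (cl (insert e F0))" if "e \<in> E - F0" for e
    unfolding atom_def using cov[OF F0A, of e] that A_F0 F0A by (auto simp: least_def)
  have atoms: "\<exists>X\<subseteq>{a. atom ?S a}. least ?S F (Upper ?S X)" if F: "F \<in> A" for F
  proof (intro exI conjI)
    \<comment> \<open>For \<open>F = F0\<close> this is empty, and the bottom flat is the join of no
      atoms.\<close>
    let ?X = "(\<lambda>e. cl (insert e F0)) ` (F - F0)"
    show "?X \<subseteq> {a. atom ?S a}" using atom A_E[OF F] by blast
    have XA: "?X \<subseteq> A" using insA[OF F0A] A_E[OF F] by blast
    have "F \<subseteq> G" if G: "G \<in> A" "\<forall>x\<in>?X. x \<subseteq> G" for G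
    proof
      fix e assume "e \<in> F"
      then show "e \<in> G"
        using G A_F0[OF G(1)] A_E[OF F] cl_sup[of "insert e F0"] F0(1)
        by (cases "e \<in> F0") (blast, fastforce)
    qed
    moreover have "x \<subseteq> F" if x: "x \<in> ?X" for x
    proof -
      obtain e where "e \<in> F" "x = cl (insert e F0)" using x by blast
      then show ?thesis using A_F0[OF F] by (simp add: cl_min[OF _ F])
    qed
    ultimately show "least ?S F (Upper ?S ?X)" using F XA
      by (simp add: least_def Upper_poset)
  qed
  \<comment> \<open>A natural subtraction; by \<open>dimF0\<close> below it never truncates on
    \<open>A\<close>.\<close>
  define rk where "rk F = dim (v ` F) - dim (v ` F0)" for F
  have dimF0: "dim (v ` F0) \<le> dim (v ` F)" if "F \<in> A" for F
    using A_F0[OF that] by (intro dim_subset image_mono)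
  have "rank_function ?S rk"
    unfolding rank_function_def
  proof (intro conjI allI impI ballI)
    fix s assume "s \<in> carrier ?S" "\<not> (\<exists>t\<in>carrier ?S. t \<sqsubset>\<^bsub>?S\<^esub> s)"
    then have "s = F0" using F0A A_F0 by auto
    then show "rk s = 0" by (simp add: rk_def)
  next
    fix F G assume c: "covers ?S F G"
    then have FG: "F \<in> A" "G \<in> A" "G \<subseteq> F" "G \<noteq> F" by (auto simp: covers_poset)
    then obtain e where e: "e \<in> F" "e \<notin> G" "e \<in> E" using A_E[of F] by blast
    have "G \<subseteq> cl (insert e G)" "e \<in> cl (insert e G)"
      using cl_sup[of "insert e G"] e A_E[OF FG(2)] by auto
    moreover have "cl (insert e G) \<subseteq> F" using FG e by (intro cl_min) auto
    ultimately have "F = cl (insert e G)" using c insA[OF FG(2) e(3)] e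
      unfolding covers_poset by blast
    then have "dim (v ` F) = dim (v ` insert e G)"
      using span_cl[of "insert e G"] e A_E[OF FG(2)] by (metis dim_span insert_subset)
    also have "\<dots> = dim (v ` G) + 1" using e A_cl[OF FG(2)] by (auto simp: dim_insert)
    finally show "rk F = rk G + 1" using dimF0[OF FG(2)] by (simp add: rk_def)
  qed
  moreover have "rk F + rk G \<ge> rk (F \<squnion>\<^bsub>?S\<^esub> G) + rk (F \<sqinter>\<^bsub>?S\<^esub> G)" if FG: "F \<in> A" "G \<in> A" for F G
  proof -
    have FGE: "F \<union> G \<subseteq> E" using A_E FG by blast
    have meetA: "F \<inter> G \<in> A" using meetl[OF FG] by (auto simp: greatest_def Lower_def)
    have "dim (v ` cl (F \<union> G)) = dim (span (v ` F \<union> v ` G))"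
      using span_cl[OF FGE] by (metis dim_span image_Un)
    also have "\<dots> = dim {x + y |x y. x \<in> span (v ` F) \<and> y \<in> span (v ` G)}"
      by (simp add: span_Un)
    finally have "dim (v ` cl (F \<union> G)) + dim (span (v ` F) \<inter> span (v ` G)) = dim (v ` F) + dim (v ` G)"
      using dim_sums_Int[of "span (v ` F)" "span (v ` G)"] by simp
    \<comment> \<open>The spans may meet in more than the span of the common edges; this is where an
      equality weakens to an inequality.\<close>
    moreover have "dim (v ` (F \<inter> G)) \<le> dim (span (v ` F) \<inter> span (v ` G))"
      by (intro dim_subset) (auto intro: span_base)
    ultimately have "dim (v ` cl (F \<union> G)) + dim (v ` (F \<inter> G)) \<le> dim (v ` F) + dim (v ` G)" by linarith
    moreover have "dim (v ` F0) \<le> dim (v ` cl (F \<union> G))"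
      using dimF0 cl_A[OF FGE] A_F0[OF FG(1)] by blast
    ultimately show ?thesis
      using dimF0[OF FG(1)] dimF0[OF FG(2)] dimF0[OF meetA]
      unfolding join_poset_eq[OF po joinl[OF FG]] meet_poset_eq[OF po meetl[OF FG]] rk_def by linarith
  qed
  moreover have "finite A" unfolding A_def using fin by simp
  moreover have "lattice ?S" unfolding lattice_poset[OF po] using joinl meetl by blast
  ultimately have "geometric_lattice ?S" unfolding geometric_lattice_def using atoms F0A by auto
  then show ?thesis by (simp add: A_def)
qed


section \<open>Clusterings and flats\<close>

lemma adj_on_sym: "sym (adj_on E V)"
  by (auto simp: sym_def adj_on_def insert_commute)

lemma adj_on_rtrancl_sym: "(x, y) \<in> (adj_on E V)\<^sup>* \<Longrightarrow> (y, x) \<in> (adj_on E V)\<^sup>*"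
  using sym_rtrancl[OF adj_on_sym] by (rule symD)

lemma adj_on_mono: "E \<subseteq> E' \<Longrightarrow> V \<subseteq> V' \<Longrightarrow> adj_on E V \<subseteq> adj_on E' V'"
  by (auto simp: adj_on_def)

lemma equiv_adj_on: "equiv UNIV ((adj_on W UNIV)\<^sup>*)"
  by (intro equivI refl_rtrancl sym_rtrancl adj_on_sym trans_rtrancl) simp

lemma partition_on_edge_clustering: "partition_on UNIV (edge_clustering W)"
  unfolding edge_clustering_def by (rule partition_on_quotient[OF equiv_adj_on])

lemma edge_clustering_iff:
  "(\<exists>V\<in>edge_clustering W. x \<in> V \<and> y \<in> V) \<longleftrightarrow> (x, y) \<in> (adj_on W UNIV)\<^sup>*"
proof
  assume "\<exists>V\<in>edge_clustering W. x \<in> V \<and> y \<in> V"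
  then obtain z where "(z, x) \<in> (adj_on W UNIV)\<^sup>*" "(z, y) \<in> (adj_on W UNIV)\<^sup>*"
    by (auto simp: edge_clustering_def quotient_def)
  then show "(x, y) \<in> (adj_on W UNIV)\<^sup>*" using adj_on_rtrancl_sym rtrancl_trans by metis
next
  assume "(x, y) \<in> (adj_on W UNIV)\<^sup>*"
  then show "\<exists>V\<in>edge_clustering W. x \<in> V \<and> y \<in> V"
    by (intro bexI[of _ "(adj_on W UNIV)\<^sup>* `` {x}"]) (auto simp: edge_clustering_def quotientI)
qed

text \<open>The equivalence relation of a partition. With it refinement turns into implication, and
  membership in a common component into reachability along edges.\<close>

definition same :: "'n set set \<Rightarrow> 'n \<Rightarrow> 'n \<Rightarrow> bool" where
  "same C x y \<longleftrightarrow> (\<exists>V\<in>C. x \<in> V \<and> y \<in> V)"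

lemma same_edge_clustering: "same (edge_clustering W) x y \<longleftrightarrow> (x, y) \<in> (adj_on W UNIV)\<^sup>*"
  unfolding same_def by (rule edge_clustering_iff)

lemma partition_on_block_unique:
  "partition_on A C \<Longrightarrow> V \<in> C \<Longrightarrow> V' \<in> C \<Longrightarrow> x \<in> V \<Longrightarrow> x \<in> V' \<Longrightarrow> V = V'"
  unfolding partition_on_def disjoint_def by blast

lemma partition_on_block_ex: "partition_on UNIV C \<Longrightarrow> \<exists>V\<in>C. x \<in> V"
  unfolding partition_on_def by (metis UNIV_I UnionE)

lemma same_refl: "partition_on UNIV C \<Longrightarrow> same C x x"
  unfolding same_def partition_on_def by blast

lemma same_sym: "same C x y \<Longrightarrow> same C y x"
  unfolding same_def by blast

lemma same_trans: "partition_on UNIV C \<Longrightarrow> same C x y \<Longrightarrow> same C y z \<Longrightarrow> same C x z"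
  unfolding same_def using partition_on_block_unique by metis

lemma same_mem: "partition_on UNIV C \<Longrightarrow> V \<in> C \<Longrightarrow> x \<in> V \<Longrightarrow> same C x y \<longleftrightarrow> y \<in> V"
  unfolding same_def using partition_on_block_unique by metis

lemma refines_iff_same:
  assumes "partition_on UNIV C'" "partition_on UNIV C"
  shows "refines UNIV C' C \<longleftrightarrow> (\<forall>x y. same C' x y \<longrightarrow> same C x y)"
proof
  assume "refines UNIV C' C"
  then show "\<forall>x y. same C' x y \<longrightarrow> same C x y" unfolding refines_def same_def by blast
next
  assume R: "\<forall>x y. same C' x y \<longrightarrow> same C x y"
  have "\<exists>Y\<in>C. X \<subseteq> Y" if X: "X \<in> C'" for X
  proof -
    obtain x where x: "x \<in> X" using X assms(1) unfolding partition_on_def by (metis ex_in_conv)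
    obtain Y where Y: "Y \<in> C" "x \<in> Y" using assms(2) unfolding partition_on_def by blast
    have "X \<subseteq> Y" using R same_mem[OF assms(1) X x] same_mem[OF assms(2) Y] by blast
    then show ?thesis using Y by blast
  qed
  then show "refines UNIV C' C" using assms by (simp add: refines_def)
qed

lemma partition_eq_same:
  assumes "partition_on UNIV C'" "partition_on UNIV C" "\<And>x y. same C' x y \<longleftrightarrow> same C x y"
  shows "C' = C"
  using assms by (intro refines_asym[of UNIV]) (simp_all add: refines_iff_same)

text \<open>Sending each block to the block containing it is onto. Were it injective as well, no
  block could grow, and the partitions would coincide. Hence ranks increase strictly along strict
  refinements.\<close>

lemma card_refines_less:
  assumes r: "refines UNIV C' (C :: 'n::finite set set)" and ne: "C' \<noteq> C"
  shows "card C < card C'"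
proof -
  have p: "partition_on UNIV C'" "partition_on UNIV C" using r by (auto simp: refines_def)
  define f where "f X = (SOME Y. Y \<in> C \<and> X \<subseteq> Y)" for X
  have f: "f X \<in> C" "X \<subseteq> f X" if "X \<in> C'" for X
    using someI_ex[of "\<lambda>Y. Y \<in> C \<and> X \<subseteq> Y"] that r unfolding f_def refines_def by blast+
  have surj: "f ` C' = C"
  proof
    show "C \<subseteq> f ` C'"
    proof
      fix Y assume Y: "Y \<in> C"
      then obtain y where y: "y \<in> Y" using p(2) unfolding partition_on_def by (metis ex_in_conv)
      obtain X where X: "X \<in> C'" "y \<in> X" using partition_on_block_ex[OF p(1)] by auto
      then have "f X = Y" using f[OF X(1)] Y y partition_on_block_unique[OF p(2)] by blast
      then show "Y \<in> f ` C'" using X by blast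
    qed
  qed (use f in blast)
  have "\<not> inj_on f C'"
  proof
    assume inj: "inj_on f C'"
    have "f X = X" if X: "X \<in> C'" for X
    proof
      show "f X \<subseteq> X"
      proof
        fix y assume y: "y \<in> f X"
        obtain X' where X': "X' \<in> C'" "y \<in> X'" using partition_on_block_ex[OF p(1)] by auto
        then have "f X' = f X" using f X y partition_on_block_unique[OF p(2)] by blast
        then have "X' = X" using inj X X' by (auto dest: inj_onD)
        then show "y \<in> X" using X' by simp
      qed
    qed (use f X in blast)
    then have "f ` C' = C'" by simp
    then show False using surj ne by simp
  qed
  then have "card (f ` C') \<noteq> card C'" by (simp add: inj_on_iff_eq_card)
  then show ?thesis using surj card_image_le[of C' f] by simp
qed

section \<open>Clusterings versus closed sets of edges\<close>

definition flat_of :: "'n set set \<Rightarrow> 'n set set \<Rightarrow> 'n set set" where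
  "flat_of E C = {e \<in> E. \<exists>V\<in>C. e \<subseteq> V}"

lemma pair_in_flat_of: "{x, y} \<in> flat_of E C \<longleftrightarrow> {x, y} \<in> E \<and> same C x y"
  by (auto simp: flat_of_def same_def)

lemma flat_of_subset: "flat_of E C \<subseteq> E"
  by (auto simp: flat_of_def)

lemma clustering_partition: "clustering E C \<Longrightarrow> partition_on UNIV C"
  by (simp add: clustering_def)

lemma simple_graph_edgeE:
  assumes "simple_graph E" "e \<in> E"
  obtains x y where "e = {x, y}" "x \<noteq> y"
  using assms unfolding simple_graph_def card_2_iff by blast

lemma same_if_connected:
  assumes C: "partition_on UNIV C" and W: "\<And>x y. {x, y} \<in> W \<Longrightarrow> same C x y"
    and xy: "(x, y) \<in> (adj_on W V)\<^sup>*"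
  shows "same C x y"
  using xy
proof (induction rule: rtrancl_induct)
  case base
  show ?case using C by (rule same_refl)
next
  case (step y z)
  have "same C y z" using step(2) W by (simp add: adj_on_def)
  then show ?case using same_trans[OF C step(3)] by simp
qed

text \<open>A path in \<open>W\<close> never leaves the component it starts in, so it is also a path
  of \<open>E\<close> inside that component, and \<open>connected_on\<close> asks for paths of the
  latter kind.\<close>

lemma clustering_edge_clustering:
  assumes "W \<subseteq> E"
  shows "clustering E (edge_clustering W)"
  unfolding clustering_def
proof (intro conjI ballI partition_on_edge_clustering)
  fix V assume V: "V \<in> edge_clustering W"
  note part = partition_on_edge_clustering[of W]
  have "(x, y) \<in> (adj_on E V)\<^sup>*" if "(x, y) \<in> (adj_on W UNIV)\<^sup>*" and x: "x \<in> V" for x y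
    using that(1)
  proof (induction rule: rtrancl_induct)
    case (step y z)
    have "(x, z) \<in> (adj_on W UNIV)\<^sup>*" using step(1,2) by (rule rtrancl_into_rtrancl)
    then have "y \<in> V" "z \<in> V"
      using step(1) same_mem[OF part V x] by (auto simp flip: same_edge_clustering)
    then have "(y, z) \<in> adj_on E V" using step(2) assms by (auto simp: adj_on_def)
    then show ?case using step by (meson rtrancl_into_rtrancl)
  qed simp
  moreover have "(x, y) \<in> (adj_on W UNIV)\<^sup>*" if "x \<in> V" "y \<in> V" for x y
    using that V by (auto simp: same_def simp flip: same_edge_clustering)
  moreover have "V \<noteq> {}" using V part by (auto simp: partition_on_def)
  ultimately show "connected_on E V" by (simp add: connected_on_def)
qed

lemma edge_clustering_refines:
  assumes C: "partition_on UNIV C" and W: "W \<subseteq> flat_of E C"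
  shows "refines UNIV (edge_clustering W) C"
proof -
  have "same C x y" if "(x, y) \<in> (adj_on W UNIV)\<^sup>*" for x y
  proof (rule same_if_connected[OF C _ that])
    fix x y assume "{x, y} \<in> W"
    then have "{x, y} \<in> flat_of E C" using W by (rule subsetD[rotated])
    then show "same C x y" by (simp add: pair_in_flat_of)
  qed
  then show ?thesis
    by (simp add: refines_iff_same partition_on_edge_clustering C same_edge_clustering)
qed

lemma subset_flat_of_edge_clustering:
  assumes "simple_graph E" "W \<subseteq> E"
  shows "W \<subseteq> flat_of E (edge_clustering W)"
proof
  fix e assume e: "e \<in> W"
  then obtain x y where xy: "e = {x, y}" using assms simple_graph_edgeE by (metis subsetD)
  then have "(x, y) \<in> (adj_on W UNIV)\<^sup>*" using e by (auto simp: adj_on_def)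
  then show "e \<in> flat_of E (edge_clustering W)"
    using e assms(2) by (auto simp: xy pair_in_flat_of same_edge_clustering)
qed

lemma flat_of_mono:
  assumes "refines UNIV C' C"
  shows "flat_of E C' \<subseteq> flat_of E C"
proof
  fix e assume "e \<in> flat_of E C'"
  then obtain X where X: "e \<in> E" "X \<in> C'" "e \<subseteq> X" by (auto simp: flat_of_def)
  then obtain Y where "Y \<in> C" "X \<subseteq> Y" using assms by (auto simp: refines_def)
  then show "e \<in> flat_of E C" using X unfolding flat_of_def by blast
qed

lemma edge_clustering_mono:
  assumes "W' \<subseteq> W"
  shows "refines UNIV (edge_clustering W') (edge_clustering W)"
proof -
  have "(adj_on W' UNIV)\<^sup>* \<subseteq> (adj_on W UNIV)\<^sup>*"
    using assms by (intro rtrancl_mono adj_on_mono) simp_all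
  then show ?thesis
    unfolding refines_iff_same[OF partition_on_edge_clustering partition_on_edge_clustering]
      same_edge_clustering by blast
qed

lemma clustering_same_connected:
  assumes "clustering E C" "same C x y"
  shows "(x, y) \<in> (adj_on (flat_of E C) UNIV)\<^sup>*"
proof -
  obtain V where V: "V \<in> C" "x \<in> V" "y \<in> V" using assms by (auto simp: same_def)
  then have "(x, y) \<in> (adj_on E V)\<^sup>*" using assms by (auto simp: clustering_def connected_on_def)
  moreover have "adj_on E V \<subseteq> adj_on (flat_of E C) UNIV"
    using V by (auto simp: adj_on_def pair_in_flat_of same_def)
  ultimately show ?thesis using rtrancl_mono by blast
qed

text \<open>Connectedness of the blocks enters here: each block is recovered as a component of the
  edges inside blocks. So no information is lost in passing from a clustering to its flat.\<close>

lemma edge_clustering_flat_of: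
  assumes C: "clustering E C"
  shows "edge_clustering (flat_of E C) = C"
proof (rule partition_eq_same[OF partition_on_edge_clustering clustering_partition[OF C]])
  fix x y
  have "refines UNIV (edge_clustering (flat_of E C)) C"
    by (rule edge_clustering_refines[OF clustering_partition[OF C] order_refl])
  then show "same (edge_clustering (flat_of E C)) x y \<longleftrightarrow> same C x y"
    using clustering_same_connected[OF C]
    unfolding refines_iff_same[OF partition_on_edge_clustering clustering_partition[OF C]]
      same_edge_clustering by blast
qed

lemma flat_of_subset_iff:
  assumes "clustering E C'" "clustering E C"
  shows "flat_of E C' \<subseteq> flat_of E C \<longleftrightarrow> refines UNIV C' C"
  using flat_of_mono edge_clustering_refines[OF clustering_partition[OF assms(2)]]
    edge_clustering_flat_of[OF assms(1)] by metis

lemma clustering_top: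
  assumes "connected_on E UNIV"
  shows "clustering E {UNIV}"
  using assms by (auto simp: clustering_def partition_on_def)

lemma clustering_bot: "clustering E (range (\<lambda>x. {x}))"
proof -
  have "connected_on E {x}" for x by (auto simp: connected_on_def)
  then show ?thesis by (auto simp: clustering_def partition_on_def disjoint_def)
qed

lemma same_bot: "same (range (\<lambda>x. {x})) x y \<longleftrightarrow> x = y"
  by (auto simp: same_def)

lemma refines_bot:
  fixes C :: "'n set set"
  assumes "partition_on UNIV C"
  shows "refines UNIV (range (\<lambda>x::'n. {x})) C"
proof -
  have "partition_on UNIV (range (\<lambda>x::'n. {x}))"
    by (rule clustering_partition[OF clustering_bot])
  then show ?thesis using assms by (auto simp: refines_iff_same same_bot same_refl)
qed

lemma card_bot: "card (range (\<lambda>x::'n::finite. {x})) = CARD('n)"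
  by (simp add: card_image)

lemma card_clustering_le:
  fixes C :: "'n::finite set set"
  assumes "partition_on UNIV C"
  shows "card C \<le> CARD('n)"
proof (cases "range (\<lambda>x. {x}) = C")
  case True
  then show ?thesis using card_bot[where 'n = 'n] by simp
next
  case False
  then have "card C < card (range (\<lambda>x::'n. {x}))" by (rule card_refines_less[OF refines_bot[OF assms]])
  then show ?thesis using card_bot[where 'n = 'n] by simp
qed

section \<open>Merging two blocks along an edge\<close>

definition merge :: "'n set set \<Rightarrow> 'n set \<Rightarrow> 'n set \<Rightarrow> 'n set set" where
  "merge C X Y = insert (X \<union> Y) (C - {X, Y})"

lemma connected_on_Un:
  assumes X: "connected_on E X" and Y: "connected_on E Y" and e: "x \<in> X" "y \<in> Y" "{x, y} \<in> E"
  shows "connected_on E (X \<union> Y)"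
proof -
  let ?R = "(adj_on E (X \<union> Y))\<^sup>*"
  have "(x, a) \<in> ?R" if "a \<in> X" for a
    using X that e(1) rtrancl_mono[OF adj_on_mono[of E E X "X \<union> Y"]] by (auto simp: connected_on_def)
  moreover have "(x, a) \<in> ?R" if "a \<in> Y" for a
  proof -
    have "(x, y) \<in> ?R" using e by (auto simp: adj_on_def)
    moreover have "(y, a) \<in> ?R"
      using Y that e(2) rtrancl_mono[OF adj_on_mono[of E E Y "X \<union> Y"]] by (auto simp: connected_on_def)
    ultimately show ?thesis by (rule rtrancl_trans)
  qed
  ultimately have "(x, a) \<in> ?R" if "a \<in> X \<union> Y" for a using that by blast
  then have "(a, b) \<in> ?R" if "a \<in> X \<union> Y" "b \<in> X \<union> Y" for a b
    using that adj_on_rtrancl_sym rtrancl_trans by metis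
  then show ?thesis using e by (auto simp: connected_on_def)
qed

text \<open>Produces upper neighbours: the number of blocks drops by exactly one, which leaves no
  room for a clustering strictly in between.\<close>

lemma merge_clustering:
  fixes C :: "'n::finite set set"
  assumes C: "clustering E C" and XY: "X \<in> C" "Y \<in> C" "X \<noteq> Y" and e: "x \<in> X" "y \<in> Y" "{x, y} \<in> E"
  shows "clustering E (merge C X Y)" "refines UNIV C (merge C X Y)" "card C = card (merge C X Y) + 1"
proof -
  have p: "partition_on UNIV C" using C by (rule clustering_partition)
  then have UC: "\<Union>C = UNIV" and dj: "\<And>A B. A \<in> C \<Longrightarrow> B \<in> C \<Longrightarrow> A \<noteq> B \<Longrightarrow> A \<inter> B = {}" and ne: "{} \<notin> C"
    by (auto simp: partition_on_def disjoint_def)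
  have "\<Union>(merge C X Y) = UNIV" using UC XY by (auto simp: merge_def)
  moreover have "disjoint (merge C X Y)"
    using dj XY unfolding disjoint_def merge_def by (auto; blast)
  moreover have "{} \<notin> merge C X Y" using ne XY e by (auto simp: merge_def)
  ultimately have p': "partition_on UNIV (merge C X Y)" by (simp add: partition_on_def)
  have "connected_on E (X \<union> Y)"
    using connected_on_Un[OF _ _ e] C XY by (auto simp: clustering_def)
  then show "clustering E (merge C X Y)" using C p' by (auto simp: clustering_def merge_def)
  show "refines UNIV C (merge C X Y)" using p p' by (auto simp: refines_def merge_def)
  have "X \<union> Y \<notin> C"
  proof
    assume "X \<union> Y \<in> C"
    then have "X \<union> Y = X" "X \<union> Y = Y" using partition_on_block_unique[OF p] XY e by blast+
    then show False using XY by simp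
  qed
  moreover have "card (C - {X, Y}) = card C - 2" using XY by (simp add: card_Diff_subset)
  moreover have "card C \<ge> card {X, Y}" using XY by (intro card_mono) auto
  ultimately show "card C = card (merge C X Y) + 1" using XY by (simp add: merge_def)
qed

text \<open>If every edge inside a block of \<open>C\<close> stayed inside a block of
  \<open>C'\<close>, paths would carry whole blocks of \<open>C\<close> into blocks of
  \<open>C'\<close>. A failure of refinement is thus witnessed by an edge, along which blocks can be
  merged or labels swapped.\<close>

lemma refines_separating_edge:
  assumes C: "clustering E C" and C': "clustering E C'" and r: "\<not> refines UNIV C C'"
  obtains x y where "{x, y} \<in> E" "same C x y" "\<not> same C' x y"
proof -
  note [simp] = clustering_partition[OF C'] clustering_partition[OF C]
  obtain x y where xy: "same C x y" "\<not> same C' x y"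
    using r by (auto simp: refines_iff_same)
  have "\<exists>x y. {x, y} \<in> flat_of E C \<and> \<not> same C' x y"
  proof (rule ccontr)
    assume "\<not> ?thesis"
    then have "same C' x y"
      by (intro same_if_connected[OF clustering_partition[OF C'] _ clustering_same_connected[OF C xy(1)]]) simp
    then show False using xy by simp
  qed
  then show ?thesis using that by (auto simp: pair_in_flat_of)
qed


section \<open>Assignments\<close>

text \<open>The class of \<open>p\<close> in an inverse-free form: \<open>inv p \<circ> q\<close>
  preserves a block exactly when \<open>p\<close> and \<open>q\<close> send it to the same set of
  labels.\<close>

definition acls :: "'n set set \<Rightarrow> ('n \<Rightarrow> 'n) \<Rightarrow> ('n \<Rightarrow> 'n) set" where
  "acls C p = {q. bij q \<and> (\<forall>V\<in>C. q ` V = p ` V)}"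

lemma acls_iff: "q \<in> acls C p \<longleftrightarrow> bij q \<and> (\<forall>V\<in>C. q ` V = p ` V)"
  by (simp add: acls_def)

lemma acls_self: "bij p \<Longrightarrow> p \<in> acls C p"
  by (simp add: acls_iff)

lemma acls_eq: "q \<in> acls C p \<Longrightarrow> acls C q = acls C p"
  by (auto simp: acls_def)

lemma assignment_rel_iff:
  "(p, q) \<in> assignment_rel C \<longleftrightarrow> bij p \<and> bij q \<and> (\<forall>V\<in>C. q ` V = p ` V)"
proof -
  have "(p, q) \<in> assignment_rel C \<longleftrightarrow>
      bij p \<and> bij q \<and> bij (inv p \<circ> q) \<and> (\<forall>V\<in>C. (inv p \<circ> q) ` V = V)"
    unfolding assignment_rel_def young_subgroup_def mem_Collect_eq prod.case by (rule refl)
  moreover have "(inv p \<circ> q) ` V = V \<longleftrightarrow> q ` V = p ` V" if "bij p" for V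
    using that by (metis bij_def image_comp image_inv_f_f image_f_inv_f)
  moreover have "bij (inv p \<circ> q)" if "bij p" "bij q"
    using that by (simp add: bij_comp bij_imp_bij_inv)
  ultimately show ?thesis by metis
qed

lemma assignment_rel_Image: "bij p \<Longrightarrow> assignment_rel C `` {p} = acls C p"
  by (rule Set.set_eqI) (simp add: assignment_rel_iff acls_iff)

lemma assignments_eq: "assignments C = acls C ` {p. bij p}"
proof -
  have "assignments C = (\<lambda>p. assignment_rel C `` {p}) ` {p. bij p}"
    by (auto simp: assignments_def quotient_def)
  also have "\<dots> = acls C ` {p. bij p}" by (rule image_cong) (simp_all add: assignment_rel_Image)
  finally show ?thesis .
qed

lemma refines_Union_blocks:
  assumes "refines UNIV C' C" "V \<in> C"
  obtains D where "D \<subseteq> C'" "V = \<Union>D"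
  using refines_obtains_subset[OF assms] that[of "{p \<in> C'. p \<subseteq> V}"] by (auto simp: partition_on_def)

lemma acls_mono:
  assumes "refines UNIV C' C"
  shows "acls C' p \<subseteq> acls C p"
proof
  fix q assume q: "q \<in> acls C' p"
  have "q ` V = p ` V" if V: "V \<in> C" for V
  proof -
    obtain D where "D \<subseteq> C'" "V = \<Union>D" using refines_Union_blocks[OF assms V] .
    moreover from this have "(\<Union>X\<in>D. q ` X) = (\<Union>X\<in>D. p ` X)"
      using q by (intro SUP_cong) (auto simp: acls_iff subset_iff)
    ultimately show ?thesis by (simp add: image_Union)
  qed
  then show "q \<in> acls C p" using q by (simp add: acls_iff)
qed

lemma assignment_proj_acls:
  assumes "refines UNIV C' C" "bij p"
  shows "assignment_proj C (acls C' p) = acls C p"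
proof -
  have "acls C p \<subseteq> assignment_rel C `` acls C' p"
    using assignment_rel_Image[OF assms(2)] acls_self[OF assms(2)] by blast
  moreover have "assignment_rel C `` acls C' p \<subseteq> acls C p"
  proof
    fix r assume "r \<in> assignment_rel C `` acls C' p"
    then obtain q where q: "q \<in> acls C' p" "(q, r) \<in> assignment_rel C" by blast
    have "q \<in> acls C p" using acls_mono[OF assms(1)] q by blast
    then show "r \<in> acls C p" using q by (auto simp: assignment_rel_iff acls_iff)
  qed
  ultimately show ?thesis unfolding assignment_proj_def by blast
qed

lemma swap_in_acls:
  assumes C: "partition_on UNIV C" and "bij p" "same C x y"
  shows "p \<circ> Transposition.transpose x y \<in> acls C p"
proof -
  have "Transposition.transpose x y ` V = V" if "V \<in> C" for V
  proof -
    have "x \<in> V \<longleftrightarrow> y \<in> V" using assms that same_mem[OF C that] same_sym by metis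
    then show ?thesis by simp
  qed
  then have "(p \<circ> Transposition.transpose x y) ` V = p ` V" if "V \<in> C" for V
    using that by (simp only: image_comp[symmetric])
  moreover have "bij (p \<circ> Transposition.transpose x y)" using assms(2) by (intro bij_comp bij_transpose)
  ultimately show ?thesis unfolding acls_iff by blast
qed

text \<open>Together with \<open>swap_in_acls\<close> this lets a class of bijections reveal its
  clustering: two points share a block exactly when swapping them stays in the class.\<close>

lemma swap_not_in_acls:
  assumes C: "partition_on UNIV C" and p: "bij p" and xy: "\<not> same C x y"
  shows "p \<circ> Transposition.transpose x y \<notin> acls C p"
proof
  assume q: "p \<circ> Transposition.transpose x y \<in> acls C p"
  obtain V where V: "V \<in> C" "x \<in> V" using partition_on_block_ex[OF C] by auto
  then have "(p \<circ> Transposition.transpose x y) ` V = p ` V" using q by (simp add: acls_iff)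
  moreover have "p y \<in> (p \<circ> Transposition.transpose x y) ` V" using V by force
  ultimately have "y \<in> V" using p by (auto simp: bij_def inj_image_mem_iff)
  then show False using xy V by (auto simp: same_def)
qed

text \<open>The clustering can be recovered from the assignment, so the order of the cluster-permutohedron
  is inclusion of assignments.\<close>

lemma acls_subset_iff:
  assumes C': "partition_on UNIV C'" and C: "partition_on UNIV C" and p: "bij p" "bij p'"
  shows "acls C' p' \<subseteq> acls C p \<longleftrightarrow> refines UNIV C' C \<and> p' \<in> acls C p"
proof
  assume sub: "acls C' p' \<subseteq> acls C p"
  then have p': "p' \<in> acls C p" using acls_self[OF p(2)] by blast
  have "same C x y" if "same C' x y" for x y
    using swap_in_acls[OF C' p(2) that] sub acls_eq[OF p'] swap_not_in_acls[OF C p(2), of x y] by blast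
  then show "refines UNIV C' C \<and> p' \<in> acls C p" using p' by (simp add: refines_iff_same C C')
next
  assume "refines UNIV C' C \<and> p' \<in> acls C p"
  then show "acls C' p' \<subseteq> acls C p" using acls_mono acls_eq by blast
qed


section \<open>The cluster-permutohedron and the graphicahedron\<close>

definition cl_elems :: "'n set set \<Rightarrow> ('n set set \<times> ('n \<Rightarrow> 'n) set) set" where
  "cl_elems E = {(C, acls C p) | C p. clustering E C \<and> bij p}"

definition gr_elems :: "'n set set \<Rightarrow> ('n set set \<times> ('n \<Rightarrow> 'n) set) set" where
  "gr_elems E = {(W, acls (edge_clustering W) p) | W p. W \<subseteq> E \<and> bij p}"

definition cl_le :: "'n set set \<times> ('n \<Rightarrow> 'n) set \<Rightarrow> 'n set set \<times> ('n \<Rightarrow> 'n) set \<Rightarrow> bool" where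
  "cl_le = (\<lambda>(C', A') (C, A). refines UNIV C' C \<and> assignment_proj C A' = A)"

definition gr_le :: "'n set set \<times> ('n \<Rightarrow> 'n) set \<Rightarrow> 'n set set \<times> ('n \<Rightarrow> 'n) set \<Rightarrow> bool" where
  "gr_le = (\<lambda>(W', A') (W, A). W' \<subseteq> W \<and> assignment_proj (edge_clustering W) A' = A)"

lemma cluster_perm_poset: "cluster_perm E = poset (cl_elems E) cl_le"
  unfolding cluster_perm_def cl_le_def
  by (rule arg_cong2[where f = poset]) (auto simp: cl_elems_def assignments_eq)

lemma graphicahedron_poset: "graphicahedron E = poset (gr_elems E) gr_le"
  unfolding graphicahedron_def gr_le_def
  by (rule arg_cong2[where f = poset]) (auto simp: gr_elems_def assignments_eq)

lemma cl_elemsE: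
  assumes "s \<in> cl_elems E"
  obtains C p where "s = (C, acls C p)" "clustering E C" "bij p"
  using assms by (auto simp: cl_elems_def)

lemma gr_elemsE:
  assumes "s \<in> gr_elems E"
  obtains W p where "s = (W, acls (edge_clustering W) p)" "W \<subseteq> E" "bij p"
  using assms by (auto simp: gr_elems_def)

lemma assignment_proj_acls_eq_iff:
  assumes "refines UNIV C' C" "bij p" "bij p'"
  shows "assignment_proj C (acls C' p') = acls C p \<longleftrightarrow> p' \<in> acls C p"
  using assms assignment_proj_acls[OF assms(1,3)] acls_self acls_eq by metis

lemma cl_le_acls:
  assumes "clustering E C'" "clustering E C" "bij p'" "bij p"
  shows "cl_le (C', acls C' p') (C, acls C p) \<longleftrightarrow> refines UNIV C' C \<and> p' \<in> acls C p"
  by (cases "refines UNIV C' C") (simp_all add: cl_le_def assignment_proj_acls_eq_iff assms)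

lemma cl_le_iff:
  assumes "s \<in> cl_elems E" "t \<in> cl_elems E"
  shows "cl_le s t \<longleftrightarrow> snd s \<subseteq> snd t"
proof -
  obtain C p where s: "s = (C, acls C p)" "clustering E C" "bij p" using assms(1) by (rule cl_elemsE)
  obtain D q where t: "t = (D, acls D q)" "clustering E D" "bij q" using assms(2) by (rule cl_elemsE)
  show ?thesis
    unfolding s(1) t(1) cl_le_acls[OF s(2) t(2) s(3) t(3)] snd_conv
    using acls_subset_iff[OF clustering_partition[OF s(2)] clustering_partition[OF t(2)] t(3) s(3)] by simp
qed

lemma gr_le_acls:
  assumes "bij p'" "bij p"
  shows "gr_le (W', acls (edge_clustering W') p') (W, acls (edge_clustering W) p) \<longleftrightarrow>
    W' \<subseteq> W \<and> p' \<in> acls (edge_clustering W) p"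
  by (cases "W' \<subseteq> W")
    (simp_all add: gr_le_def assignment_proj_acls_eq_iff[OF edge_clustering_mono] assms)

text \<open>A set of edges is not determined by its components, so in contrast to the
  cluster-permutohedron the first components have to be compared too.\<close>

lemma gr_le_iff:
  assumes "s \<in> gr_elems E" "t \<in> gr_elems E"
  shows "gr_le s t \<longleftrightarrow> fst s \<subseteq> fst t \<and> snd s \<subseteq> snd t"
proof -
  obtain V p where s: "s = (V, acls (edge_clustering V) p)" "bij p" using assms(1) by (rule gr_elemsE)
  obtain W q where t: "t = (W, acls (edge_clustering W) q)" "bij q" using assms(2) by (rule gr_elemsE)
  show ?thesis
    unfolding s(1) t(1) gr_le_acls[OF s(2) t(2)] snd_conv fst_conv
    using acls_subset_iff[OF partition_on_edge_clustering partition_on_edge_clustering t(2) s(2)]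
      edge_clustering_mono by blast
qed

lemma snd_eq_imp_eq:
  assumes "s \<in> cl_elems E" "t \<in> cl_elems E" "snd s = snd t"
  shows "s = t"
proof -
  obtain C p where s: "s = (C, acls C p)" "clustering E C" "bij p" using assms(1) by (rule cl_elemsE)
  obtain D q where t: "t = (D, acls D q)" "clustering E D" "bij q" using assms(2) by (rule cl_elemsE)
  have eq: "acls C p = acls D q" using assms(3) s t by simp
  have "refines UNIV C D" "refines UNIV D C"
    using acls_subset_iff[of C D q p] acls_subset_iff[of D C p q] s(2,3) t(2,3) eq
    by (simp_all add: clustering_partition)
  then show ?thesis using s t eq refines_asym[of UNIV C D] by simp
qed

lemma partial_order_cl: "A \<subseteq> cl_elems E \<Longrightarrow> partial_order (poset A cl_le)"
  unfolding partial_order_poset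
proof (intro conjI ballI impI; (elim conjE)?)
  fix s t u assume A: "A \<subseteq> cl_elems E"
  show "cl_le s s" if "s \<in> A" using that A cl_le_iff[of s E s] by auto
  show "s = t" if "s \<in> A" "t \<in> A" "cl_le s t" "cl_le t s"
    using that A cl_le_iff[of s E t] cl_le_iff[of t E s] snd_eq_imp_eq[of s E t] by auto
  show "cl_le s u" if "s \<in> A" "t \<in> A" "u \<in> A" "cl_le s t" "cl_le t u"
    using that A cl_le_iff[of s E t] cl_le_iff[of t E u] cl_le_iff[of s E u] by auto
qed

lemma partial_order_gr: "A \<subseteq> gr_elems E \<Longrightarrow> partial_order (poset A gr_le)"
  unfolding partial_order_poset
proof (intro conjI ballI impI; (elim conjE)?)
  fix s t u assume A: "A \<subseteq> gr_elems E"
  show "gr_le s s" if "s \<in> A" using that A gr_le_iff[of s E s] by auto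
  show "s = t" if st: "s \<in> A" "t \<in> A" "gr_le s t" "gr_le t s"
  proof -
    have "s \<in> gr_elems E" "t \<in> gr_elems E" using st A by auto
    then have "fst s = fst t" "snd s = snd t"
      using st gr_le_iff[of s E t] gr_le_iff[of t E s] by auto
    then show ?thesis by (simp add: prod_eq_iff)
  qed
  show "gr_le s u" if st: "s \<in> A" "t \<in> A" "u \<in> A" "gr_le s t" "gr_le t u"
  proof -
    have m: "s \<in> gr_elems E" "t \<in> gr_elems E" "u \<in> gr_elems E" using st A by auto
    have "fst s \<subseteq> fst t" "fst t \<subseteq> fst u" "snd s \<subseteq> snd t" "snd t \<subseteq> snd u"
      using gr_le_iff[OF m(1,2)] gr_le_iff[OF m(2,3)] st(4,5) by simp_all
    then show ?thesis unfolding gr_le_iff[OF m(1,3)] by (meson order_trans)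
  qed
qed

lemma cl_rank_pair: "cl_rank (C, A) = CARD('n) - card C" for C :: "'n::finite set set"
  by (simp add: cl_rank_def)

lemma gr_conn_pair: "gr_conn (W, A) = CARD('n) - card (edge_clustering W)" for W :: "'n::finite set set"
  by (simp add: gr_conn_def)

definition cl_to_gr :: "'n set set \<Rightarrow> 'n set set \<times> ('n \<Rightarrow> 'n) set \<Rightarrow> 'n set set \<times> ('n \<Rightarrow> 'n) set" where
  "cl_to_gr E = (\<lambda>(C, A). (flat_of E C, A))"

lemma cl_to_gr_simps [simp]: "fst (cl_to_gr E s) = flat_of E (fst s)" "snd (cl_to_gr E s) = snd s"
  by (simp_all add: cl_to_gr_def split: prod.split)

lemma gr_to_cl_simps [simp]: "fst (gr_to_cl s) = edge_clustering (fst s)" "snd (gr_to_cl s) = snd s"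
  by (simp_all add: gr_to_cl_def split: prod.split)

lemma cl_to_gr_elems: "s \<in> cl_elems E \<Longrightarrow> cl_to_gr E s \<in> gr_elems E"
  by (elim cl_elemsE, unfold gr_elems_def cl_to_gr_def)
    (use flat_of_subset edge_clustering_flat_of in \<open>force\<close>)

lemma gr_to_cl_elems: "s \<in> gr_elems E \<Longrightarrow> gr_to_cl s \<in> cl_elems E"
  by (elim gr_elemsE) (auto simp: cl_elems_def gr_to_cl_def clustering_edge_clustering)

lemma gr_to_cl_cl_to_gr: "s \<in> cl_elems E \<Longrightarrow> gr_to_cl (cl_to_gr E s) = s"
  by (elim cl_elemsE) (simp add: gr_to_cl_def cl_to_gr_def edge_clustering_flat_of)

lemma cl_rank_gr_to_cl: "cl_rank (gr_to_cl s) = gr_conn s"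
  by (simp add: cl_rank_def gr_to_cl_def gr_conn_def split: prod.split)

lemma gr_conn_cl_to_gr: "s \<in> cl_elems E \<Longrightarrow> gr_conn (cl_to_gr E s) = cl_rank s"
  using gr_to_cl_cl_to_gr[of s E] cl_rank_gr_to_cl[of "cl_to_gr E s"] by simp

lemma gr_to_cl_mono:
  assumes "s \<in> gr_elems E" "t \<in> gr_elems E" "gr_le s t"
  shows "cl_le (gr_to_cl s) (gr_to_cl t)"
  using assms by (simp add: cl_le_iff[OF gr_to_cl_elems gr_to_cl_elems] gr_le_iff)

lemma cl_to_gr_le_iff:
  assumes "s \<in> cl_elems E" "t \<in> cl_elems E"
  shows "gr_le (cl_to_gr E s) (cl_to_gr E t) \<longleftrightarrow> cl_le s t"
proof
  assume "gr_le (cl_to_gr E s) (cl_to_gr E t)"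
  then show "cl_le s t"
    using gr_to_cl_mono[OF assms[THEN cl_to_gr_elems]] assms[THEN gr_to_cl_cl_to_gr] by simp
next
  assume st: "cl_le s t"
  then have "refines UNIV (fst s) (fst t)" by (simp add: cl_le_def split: prod.splits)
  then show "gr_le (cl_to_gr E s) (cl_to_gr E t)"
    using st assms by (simp add: gr_le_iff[OF cl_to_gr_elems cl_to_gr_elems] cl_le_iff flat_of_mono)
qed

lemma gr_le_closure:
  assumes "simple_graph E" "s \<in> gr_elems E"
  shows "gr_le s (cl_to_gr E (gr_to_cl s))"
proof -
  have "fst s \<subseteq> E" using assms(2) by (elim gr_elemsE) simp
  then show ?thesis
    by (simp add: gr_le_iff[OF assms(2) cl_to_gr_elems[OF gr_to_cl_elems[OF assms(2)]]]
        subset_flat_of_edge_clustering[OF assms(1)])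
qed

text \<open>\<open>gr_to_cl\<close> is a monotone left inverse of the order embedding
  \<open>cl_to_gr\<close>, and the composite in the other order only enlarges elements; these facts
  are the counit and the unit of the adjunction.\<close>

lemma gr_cl_adjoint:
  assumes "simple_graph E" "s \<in> gr_elems E" "t \<in> cl_elems E"
  shows "cl_le (gr_to_cl s) t \<longleftrightarrow> gr_le s (cl_to_gr E t)"
proof
  assume "cl_le (gr_to_cl s) t"
  then have "gr_le (cl_to_gr E (gr_to_cl s)) (cl_to_gr E t)"
    using cl_to_gr_le_iff[OF gr_to_cl_elems[OF assms(2)] assms(3)] by simp
  then show "gr_le s (cl_to_gr E t)"
    using gr_le_closure[OF assms(1,2)] assms(2,3)
    by (simp add: gr_le_iff[of _ E] cl_to_gr_elems gr_to_cl_elems) (meson order_trans)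
next
  assume "gr_le s (cl_to_gr E t)"
  then show "cl_le (gr_to_cl s) t"
    using gr_to_cl_mono[OF assms(2) cl_to_gr_elems[OF assms(3)]] gr_to_cl_cl_to_gr[OF assms(3)] by simp
qed


section \<open>Galois connection, skeleta and cores\<close>

lemma galois_cl_gr:
  assumes "simple_graph E"
  shows "\<exists>\<iota> \<pi>. isotone (cluster_perm E) (graphicahedron E) \<iota> \<and>
         isotone (graphicahedron E) (cluster_perm E) \<pi> \<and>
         galois_connection \<lparr>orderA = graphicahedron E, orderB = cluster_perm E,
                            lower = \<pi>, upper = \<iota>\<rparr> \<and>
         (\<forall>j. \<iota> ` carrier (skeleton (cluster_perm E) cl_rank j)
                \<subseteq> carrier (skeleton (graphicahedron E) gr_conn j) \<and>
              \<pi> ` carrier (skeleton (graphicahedron E) gr_conn j)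
                \<subseteq> carrier (skeleton (cluster_perm E) cl_rank j))"
proof (intro exI conjI allI)
  note po = partial_order_cl[OF order_refl, of E] partial_order_gr[OF order_refl, of E]
  show "isotone (cluster_perm E) (graphicahedron E) (cl_to_gr E)"
    unfolding isotone_def cluster_perm_poset graphicahedron_poset
    using po[THEN partial_order_weak] by (simp add: cl_to_gr_le_iff)
  show "isotone (graphicahedron E) (cluster_perm E) gr_to_cl"
    unfolding isotone_def cluster_perm_poset graphicahedron_poset
    using po[THEN partial_order_weak] by (simp add: gr_to_cl_mono)
  show "galois_connection \<lparr>orderA = graphicahedron E, orderB = cluster_perm E,
      lower = gr_to_cl, upper = cl_to_gr E\<rparr>"
    unfolding cluster_perm_poset graphicahedron_poset
    using po unfolding galois_connection_def galois_connection_axioms_def connection_def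
    by (simp add: gr_to_cl_elems cl_to_gr_elems gr_cl_adjoint[OF assms])
  fix j
  show "cl_to_gr E ` carrier (skeleton (cluster_perm E) cl_rank j)
      \<subseteq> carrier (skeleton (graphicahedron E) gr_conn j)"
    unfolding cluster_perm_poset graphicahedron_poset skeleton_poset
    by (auto simp: cl_to_gr_elems gr_conn_cl_to_gr)
  show "gr_to_cl ` carrier (skeleton (graphicahedron E) gr_conn j)
      \<subseteq> carrier (skeleton (cluster_perm E) cl_rank j)"
    unfolding cluster_perm_poset graphicahedron_poset skeleton_poset
    by (auto simp: gr_to_cl_elems cl_rank_gr_to_cl)
qed

text \<open>The index is arbitrary so that the map serves twice: for the core the closed elements
  are what is left after the removal of upbeats, and below the girth they are all elements of the
  skeleton.\<close>

lemma skeleton_iso_closed: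
  "poset_iso (poset {s \<in> cl_elems E. enat (cl_rank s) \<le> j} cl_le)
    (poset {s \<in> {s \<in> gr_elems E. enat (gr_conn s) \<le> j}. cl_to_gr E (gr_to_cl s) = s} gr_le)
    (cl_to_gr E)"
proof (subst poset_iso_poset)
  show "partial_order (poset {s \<in> cl_elems E. enat (cl_rank s) \<le> j} cl_le)"
    by (rule partial_order_cl) blast
  show "partial_order (poset {s \<in> {s \<in> gr_elems E. enat (gr_conn s) \<le> j}. cl_to_gr E (gr_to_cl s) = s} gr_le)"
    by (rule partial_order_gr[of _ E]) blast
  have "bij_betw (cl_to_gr E) {s \<in> cl_elems E. enat (cl_rank s) \<le> j}
     {s \<in> {s \<in> gr_elems E. enat (gr_conn s) \<le> j}. cl_to_gr E (gr_to_cl s) = s}"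
    by (rule bij_betw_byWitness[of _ gr_to_cl])
      (auto simp: gr_to_cl_cl_to_gr cl_to_gr_elems gr_to_cl_elems gr_conn_cl_to_gr cl_rank_gr_to_cl)
  then show "bij_betw (cl_to_gr E) {s \<in> cl_elems E. enat (cl_rank s) \<le> j}
     {s \<in> {s \<in> gr_elems E. enat (gr_conn s) \<le> j}. cl_to_gr E (gr_to_cl s) = s} \<and>
     (\<forall>x\<in>{s \<in> cl_elems E. enat (cl_rank s) \<le> j}. \<forall>y\<in>{s \<in> cl_elems E. enat (cl_rank s) \<le> j}.
        gr_le (cl_to_gr E x) (cl_to_gr E y) \<longleftrightarrow> cl_le x y)"
    by (simp add: cl_to_gr_le_iff)
qed

text \<open>The top of the cluster-permutohedron has rank n - 1, so a clustering of rank at most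
  \<open>j\<close> still has at least two blocks.\<close>

lemma cl_rank_less_top:
  fixes E :: "'n::finite set set"
  assumes "connected_on E UNIV" "j < poset_rank (cluster_perm E) cl_rank"
  shows "j + 1 < CARD('n)"
proof -
  have "cl_rank ` cl_elems E \<noteq> {}" using clustering_top[OF assms(1)] bij_id by (auto simp: cl_elems_def)
  moreover have "cl_rank s \<le> CARD('n) - 1" if sE: "s \<in> cl_elems E" for s
  proof -
    obtain C p where s: "s = (C, acls C p)" "clustering E C" using sE by (rule cl_elemsE)
    then have "C \<noteq> {}" by (auto simp: clustering_def partition_on_def)
    then have "card C \<ge> 1" by (simp add: Suc_le_eq card_gt_0_iff)
    then show ?thesis by (simp add: s cl_rank_pair)
  qed
  ultimately have "poset_rank (cluster_perm E) cl_rank \<le> CARD('n) - 1"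
    unfolding poset_rank_def cluster_perm_poset by (auto simp: Max_le_iff)
  then show ?thesis using assms(2) by simp
qed

text \<open>Were \<open>t\<close> the only cover of \<open>s\<close>, an edge leaving a block of
  \<open>t\<close> would join two blocks of \<open>s\<close>; merging those gives a cover of
  \<open>s\<close> that differs from \<open>t\<close> because it does not separate the ends of the
  edge.\<close>

lemma cl_not_upbeat:
  fixes E :: "'n::finite set set"
  assumes E: "simple_graph E" "connected_on E UNIV" and j: "j + 1 < CARD('n)"
  shows "\<not> upbeat (poset {s \<in> cl_elems E. cl_rank s \<le> j} cl_le) s"
proof
  let ?S = "{s \<in> cl_elems E. cl_rank s \<le> j}"
  assume "upbeat (poset ?S cl_le) s"
  then obtain t where cov: "covers (poset ?S cl_le) t s"
    and uniq: "\<And>u. covers (poset ?S cl_le) u s \<Longrightarrow> u = t" by (auto simp: upbeat_def)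
  have st: "s \<in> cl_elems E" "t \<in> cl_elems E" "cl_rank t \<le> j" "cl_le s t" "s \<noteq> t"
    using cov by (auto simp: covers_poset)
  obtain C p where s: "s = (C, acls C p)" "clustering E C" "bij p" using st(1) by (rule cl_elemsE)
  obtain D q where t: "t = (D, acls D q)" "clustering E D" "bij q" using st(2) by (rule cl_elemsE)
  have CD: "refines UNIV C D" "p \<in> acls D q"
    using st(4) cl_le_acls[OF s(2) t(2) s(3) t(3)] unfolding s(1) t(1) by simp_all
  have pC: "partition_on UNIV C" and pD: "partition_on UNIV D"
    using s t by (simp_all add: clustering_partition)
  have "D \<noteq> {UNIV}" using st(3) j by (auto simp: t cl_rank_pair)
  then have "\<not> refines UNIV {UNIV} D"
    using refines_asym[of UNIV D "{UNIV}"] pD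
    by (auto simp: refines_iff_same clustering_partition[OF clustering_top[OF E(2)]] same_def[of "{UNIV}"])
  then obtain x y where xy: "{x, y} \<in> E" "same {UNIV} x y" "\<not> same D x y"
    by (rule refines_separating_edge[OF clustering_top[OF E(2)] t(2)])
  have nC: "\<not> same C x y" using xy(3) CD(1) by (auto simp: refines_iff_same pC pD)
  obtain X where X: "X \<in> C" "x \<in> X" using partition_on_block_ex[OF pC] by auto
  obtain Y where Y: "Y \<in> C" "y \<in> Y" using partition_on_block_ex[OF pC] by auto
  have XY: "X \<noteq> Y" using nC X Y by (auto simp: same_def)
  let ?M = "merge C X Y"
  note M = merge_clustering[OF s(2) X(1) Y(1) XY X(2) Y(2) xy(1)]
  define u where "u = (?M, acls ?M p)"
  have u: "u \<in> cl_elems E" using M(1) s(3) by (auto simp: u_def cl_elems_def)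
  have su: "cl_le s u" unfolding s(1) u_def
    using cl_le_acls[OF s(2) M(1) s(3) s(3)] M(2) acls_self[OF s(3)] by simp
  have "C \<noteq> D" using s t st(5) CD(2) acls_eq by metis
  \<comment> \<open>One merge costs one block, and \<open>t\<close> has lost at least one, so the
    new cover stays within the skeleton.\<close>
  then have "card D < card C" by (rule card_refines_less[OF CD(1)])
  then have "cl_rank u \<le> cl_rank t" using M(3) by (simp add: u_def t cl_rank_pair)
  then have uS: "u \<in> ?S" using u st(3) by simp
  have "v = s \<or> v = u" if v: "v \<in> ?S" "cl_le s v" "cl_le v u" for v
  proof -
    obtain G r where G: "v = (G, acls G r)" "clustering E G" "bij r" using v(1) by (auto elim: cl_elemsE)
    have CG: "refines UNIV C G" "p \<in> acls G r" and GM: "refines UNIV G ?M" "r \<in> acls ?M p"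
      using v(2,3) cl_le_acls[OF s(2) G(2) s(3) G(3)] cl_le_acls[OF G(2) M(1) G(3) s(3)]
      unfolding u_def s(1) G(1) by simp_all
    show ?thesis
    proof (cases "G = C \<or> G = ?M")
      case True
      then show ?thesis using CG(2) GM(2) acls_eq by (auto simp: s(1) G(1) u_def)
    next
      case False
      then have "card G < card C" "card ?M < card G"
        using card_refines_less[OF CG(1)] card_refines_less[OF GM(1)] by auto
      then show ?thesis using M(3) by simp
    qed
  qed
  moreover have "u \<noteq> s" using M(3) by (auto simp: u_def s)
  ultimately have "covers (poset ?S cl_le) u s"
    using uS su cov by (auto simp: covers_poset)
  then have "u = t" by (rule uniq)
  then have "X \<union> Y \<in> D" by (auto simp: u_def t merge_def)
  then show False using xy(3) X Y by (auto simp: same_def)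
qed

text \<open>A lower cover can be relabelled: its clustering separates the ends of some edge lying
  inside a block of \<open>s\<close>, and swapping the labels at these ends gives a second lower
  cover with the same clustering.\<close>

lemma cl_not_downbeat:
  fixes E :: "'n::finite set set"
  shows "\<not> downbeat (poset {s \<in> cl_elems E. cl_rank s \<le> j} cl_le) s"
proof
  let ?S = "{s \<in> cl_elems E. cl_rank s \<le> j}"
  assume "downbeat (poset ?S cl_le) s"
  then obtain t where cov: "covers (poset ?S cl_le) s t"
    and uniq: "\<And>u. covers (poset ?S cl_le) s u \<Longrightarrow> u = t" by (auto simp: downbeat_def)
  have st: "s \<in> cl_elems E" "t \<in> cl_elems E" "cl_rank t \<le> j" "cl_rank s \<le> j" "cl_le t s" "s \<noteq> t"
    and mid: "\<And>v. v \<in> ?S \<Longrightarrow> cl_le t v \<Longrightarrow> cl_le v s \<Longrightarrow> v = t \<or> v = s"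
    using cov by (auto simp: covers_poset)
  obtain C p where s: "s = (C, acls C p)" "clustering E C" "bij p" using st(1) by (rule cl_elemsE)
  obtain D q where t: "t = (D, acls D q)" "clustering E D" "bij q" using st(2) by (rule cl_elemsE)
  have DC: "refines UNIV D C" "q \<in> acls C p"
    using st(5) cl_le_acls[OF t(2) s(2) t(3) s(3)] unfolding s(1) t(1) by simp_all
  have ne: "D \<noteq> C" using s t st(6) DC(2) acls_eq by metis
  then have "\<not> refines UNIV C D" using refines_asym[OF DC(1)] by auto
  then obtain x y where xy: "{x, y} \<in> E" "same C x y" "\<not> same D x y"
    by (rule refines_separating_edge[OF s(2) t(2)])
  define q' where "q' = q \<circ> Transposition.transpose x y"
  have q': "bij q'" using t(3) by (simp add: q'_def bij_comp)
  have "q' \<in> acls C q" unfolding q'_def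
    using swap_in_acls[OF clustering_partition[OF s(2)] t(3) xy(2)] .
  then have q'C: "q' \<in> acls C p" using acls_eq[OF DC(2)] by simp
  have q'D: "q' \<notin> acls D q" unfolding q'_def
    using swap_not_in_acls[OF clustering_partition[OF t(2)] t(3) xy(3)] .
  define u where "u = (D, acls D q')"
  have u: "u \<in> ?S" using t(2) q' st(3) by (auto simp: u_def t cl_elems_def cl_rank_pair)
  have us: "cl_le u s" unfolding u_def s(1) using cl_le_acls[OF t(2) s(2) q' s(3)] DC(1) q'C by simp
  have "v = u \<or> v = s" if v: "v \<in> ?S" "cl_le u v" "cl_le v s" for v
  proof -
    obtain G r where G: "v = (G, acls G r)" "clustering E G" "bij r" using v(1) by (auto elim: cl_elemsE)
    have DG: "refines UNIV D G" "q' \<in> acls G r" and GC: "refines UNIV G C" "r \<in> acls C p"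
      using v(2,3) cl_le_acls[OF t(2) G(2) q' G(3)] cl_le_acls[OF G(2) s(2) G(3) s(3)]
      unfolding u_def s(1) G(1) by simp_all
    \<comment> \<open>An element between \<open>u\<close> and \<open>s\<close> has a clustering
      between \<open>D\<close> and \<open>C\<close>; with the labels of \<open>q\<close> it lies
      between \<open>t\<close> and \<open>s\<close>, where the cover relation leaves only the two
      ends.\<close>
    define w where "w = (G, acls G q)"
    have "w \<in> ?S" using G v(1) t(3) by (auto simp: w_def cl_elems_def cl_rank_pair)
    moreover have "cl_le t w" unfolding t(1) w_def
      using cl_le_acls[OF t(2) G(2) t(3) t(3)] DG(1) acls_self[OF t(3)] by simp
    moreover have "cl_le w s" unfolding s(1) w_def
      using cl_le_acls[OF G(2) s(2) t(3) s(3)] GC(1) DC(2) by simp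
    ultimately have "w = t \<or> w = s" by (rule mid)
    then have "G = D \<or> G = C" by (auto simp: w_def s t)
    then show ?thesis using DG(2) GC(2) acls_eq by (auto simp: G(1) u_def s(1))
  qed
  moreover have "u \<noteq> s" using ne by (auto simp: u_def s)
  ultimately have "covers (poset ?S cl_le) s u" using u us cov by (auto simp: covers_poset)
  then have "u = t" by (rule uniq)
  then show False using q'D acls_self[OF q'] by (auto simp: u_def t)
qed

lemma cl_core_of_gr:
  fixes E :: "'n::finite set set" and j :: nat
  assumes E: "simple_graph E" "connected_on E UNIV" and j: "j < poset_rank (cluster_perm E) cl_rank"
  shows "is_core_of (skeleton (cluster_perm E) cl_rank j) (skeleton (graphicahedron E) gr_conn j)"
  unfolding is_core_of_def
proof (intro conjI exI)
  let ?G = "{s \<in> gr_elems E. enat (gr_conn s) \<le> j}"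
  let ?c = "\<lambda>s. cl_to_gr E (gr_to_cl s)"
  show "is_core (skeleton (cluster_perm E) cl_rank j)"
    unfolding is_core_def cluster_perm_poset skeleton_poset
    by (simp add: cl_not_upbeat[OF E cl_rank_less_top[OF E(2) j]] cl_not_downbeat)
  show "beat_removal\<^sup>*\<^sup>* (skeleton (graphicahedron E) gr_conn j) (poset {s \<in> ?G. ?c s = s} gr_le)"
    unfolding graphicahedron_poset skeleton_poset
  proof (rule beat_removal_closure)
    show "partial_order (poset ?G gr_le)" by (rule partial_order_gr[of _ E]) simp
  qed (auto simp: gr_to_cl_elems cl_to_gr_elems gr_conn_cl_to_gr cl_rank_gr_to_cl
      gr_to_cl_cl_to_gr gr_le_closure[OF E(1)] cl_to_gr_le_iff gr_to_cl_mono)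
  show "isomorphic_posets (skeleton (cluster_perm E) cl_rank j) (poset {s \<in> ?G. ?c s = s} gr_le)"
    unfolding cluster_perm_poset skeleton_poset isomorphic_posets_def
    by (rule exI, rule skeleton_iso_closed)
qed


section \<open>Girth\<close>

text \<open>A shortest path joining the ends of an edge outside \<open>W\<close> closes up to a cycle.\<close>

lemma distinct_path:
  assumes "(x, y) \<in> (adj_on W UNIV)\<^sup>*"
  shows "\<exists>vs. vs \<noteq> [] \<and> distinct vs \<and> hd vs = x \<and> last vs = y \<and>
      (\<forall>i. Suc i < length vs \<longrightarrow> {vs ! i, vs ! Suc i} \<in> W)"
  using assms
proof (induction rule: rtrancl_induct)
    case base
    show ?case by (rule exI[of _ "[x]"]) simp
  next
    case (step y z)
    then obtain vs where vs: "vs \<noteq> []" "distinct vs" "hd vs = x" "last vs = y"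
      "\<forall>i. Suc i < length vs \<longrightarrow> {vs ! i, vs ! Suc i} \<in> W" by blast
    have yz: "{y, z} \<in> W" using step(2) by (simp add: adj_on_def)
    show ?case
    proof (cases "z \<in> set vs")
      case True
      then obtain k where k: "k < length vs" "vs ! k = z" by (auto simp: in_set_conv_nth)
      \<comment> \<open>The path would revisit \<open>z\<close>, so it is cut at the earlier visit,
        which keeps the vertices distinct.\<close>
      have "last (take (Suc k) vs) = z" using k by (simp add: take_Suc_conv_app_nth)
      moreover have "hd (take (Suc k) vs) = x" using vs(3) by (simp add: hd_take)
      moreover have "\<forall>i. Suc i < length (take (Suc k) vs) \<longrightarrow> {take (Suc k) vs ! i, take (Suc k) vs ! Suc i} \<in> W"
        using vs(5) by simp
      ultimately show ?thesis using vs(1,2) by (intro exI[of _ "take (Suc k) vs"]) simp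
    next
      case False
      have "{(vs @ [z]) ! i, (vs @ [z]) ! Suc i} \<in> W" if i: "Suc i < length (vs @ [z])" for i
      proof (cases "Suc i < length vs")
        case True
        then show ?thesis using vs(5) by (simp add: nth_append)
      next
        case False
        then have "length vs = Suc i" using i by simp
        then have "(vs @ [z]) ! i = y" "(vs @ [z]) ! Suc i = z"
          using vs(1,4) by (simp_all add: nth_append last_conv_nth)
        then show ?thesis using yz by simp
      qed
      then show ?thesis using vs False by (intro exI[of _ "vs @ [z]"]) auto
    qed
qed

lemma girth_le: "is_cycle E vs \<Longrightarrow> girth E \<le> enat (length vs)"
  unfolding girth_def by (auto intro: INF_lower)

lemma girth_ge_3: "girth E \<ge> 3"
  unfolding girth_def by (auto intro!: INF_greatest simp: is_cycle_def numeral_eq_enat)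

text \<open>A simple path in \<open>W\<close> between the ends of an edge outside \<open>W\<close>
  has at least three vertices: one is excluded by the absence of loops, two because the edge is not
  in \<open>W\<close>. The edge then closes it to a cycle, and the girth bounds its length from
  below.\<close>

lemma chord_path:
  assumes E: "simple_graph E" "W \<subseteq> E" and xy: "{x, y} \<in> E" "{x, y} \<notin> W" "(x, y) \<in> (adj_on W UNIV)\<^sup>*"
  shows "\<exists>vs. distinct vs \<and> girth E \<le> enat (length vs) \<and> is_cycle E vs \<and>
    (\<forall>i. Suc i < length vs \<longrightarrow> {vs ! i, vs ! Suc i} \<in> W)"
proof -
  obtain vs where vs: "vs \<noteq> []" "distinct vs" "hd vs = x" "last vs = y"
    "\<forall>i. Suc i < length vs \<longrightarrow> {vs ! i, vs ! Suc i} \<in> W"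
    using distinct_path[OF xy(3)] by auto
  have "card {x, y} = 2" using E(1) xy(1) unfolding simple_graph_def by (rule bspec)
  then have ne: "x \<noteq> y" by auto
  have l1: "length vs \<noteq> 1"
  proof
    assume "length vs = 1"
    then obtain a where "vs = [a]" by (auto simp: length_Suc_conv)
    then show False using vs(3,4) ne by simp
  qed
  have l2: "length vs \<noteq> 2"
  proof
    assume "length vs = 2"
    then obtain a b where "vs = [a, b]" by (auto simp: numeral_2_eq_2 length_Suc_conv)
    then show False using vs(3,4) vs(5)[rule_format, of 0] xy(2) by simp
  qed
  have "length vs \<noteq> 0" using vs(1) by simp
  then have len: "3 \<le> length vs" using l1 l2 by linarith
  have "{vs ! i, vs ! (Suc i mod length vs)} \<in> E" if i: "i < length vs" for i
  proof (cases "Suc i < length vs")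
    case True
    then show ?thesis using vs(5) E(2) by auto
  next
    case False
    then have "Suc i = length vs" using i by simp
    then have "i = length vs - 1" "Suc i mod length vs = 0" by auto
    then have "vs ! i = y" "vs ! (Suc i mod length vs) = x"
      using vs(1,3,4) by (simp_all add: last_conv_nth hd_conv_nth)
    then show ?thesis using xy(1) by (simp add: insert_commute)
  qed
  then have "is_cycle E vs" using len vs(2) by (simp add: is_cycle_def)
  then show ?thesis using vs girth_le by auto
qed

lemma card_path_edges:
  assumes "finite W" "distinct vs" "\<And>i. Suc i < length vs \<Longrightarrow> {vs ! i, vs ! Suc i} \<in> W"
  shows "length vs \<le> card W + 1"
proof -
  let ?f = "\<lambda>i. {vs ! i, vs ! Suc i}"
  have "inj_on ?f {..<length vs - 1}"
  proof (rule inj_onI)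
    fix i j assume ij: "i \<in> {..<length vs - 1}" "j \<in> {..<length vs - 1}" "?f i = ?f j"
    then have "vs ! i = vs ! j \<and> vs ! Suc i = vs ! Suc j \<or> vs ! i = vs ! Suc j \<and> vs ! Suc i = vs ! j"
      by (simp add: doubleton_eq_iff)
    then show "i = j" using ij(1,2) assms(2) by (auto simp: nth_eq_iff_index_eq)
  qed
  moreover have "?f ` {..<length vs - 1} \<subseteq> W" using assms(3) by auto
  ultimately have "length vs - 1 \<le> card W" using card_inj_on_le[OF _ _ assms(1)] by fastforce
  then show ?thesis by simp
qed

text \<open>All vertices of the path share a component, so the components number at most one plus
  the vertices off the path. In terms of conn, a path on k vertices forces conn at least k -
  1.\<close>

lemma card_path_conn:
  fixes W :: "'n::finite set set"
  assumes "distinct vs" "\<And>i. Suc i < length vs \<Longrightarrow> {vs ! i, vs ! Suc i} \<in> W"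
  shows "length vs + card (edge_clustering W) \<le> CARD('n) + 1"
proof (cases "vs = []")
  case True
  then show ?thesis using card_clustering_le[OF partition_on_edge_clustering, of W] by simp
next
  case False
  let ?R = "(adj_on W UNIV)\<^sup>*"
  have path: "(vs ! 0, vs ! i) \<in> ?R" if "i < length vs" for i
    using that
  proof (induction i)
    case (Suc i)
    then have "(vs ! i, vs ! Suc i) \<in> ?R" using assms(2)[of i] by (auto simp: adj_on_def)
    then show ?case using Suc by (meson Suc_lessD rtrancl_trans)
  qed simp
  let ?c = "\<lambda>x. ?R `` {x}"
  have "edge_clustering W = range ?c" by (auto simp: edge_clustering_def quotient_def)
  also have "\<dots> \<subseteq> insert (?c (vs ! 0)) (?c ` (UNIV - set vs))"
  proof
    fix X assume "X \<in> range ?c"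
    then obtain x where x: "X = ?c x" by blast
    show "X \<in> insert (?c (vs ! 0)) (?c ` (UNIV - set vs))"
    proof (cases "x \<in> set vs")
      case True
      then have "?c (vs ! 0) = ?c x"
        using path equiv_class_eq[OF equiv_adj_on] by (metis in_set_conv_nth)
      then show ?thesis using x by simp
    qed (use x in blast)
  qed
  finally have "card (edge_clustering W) \<le> card (insert (?c (vs ! 0)) (?c ` (UNIV - set vs)))"
    by (intro card_mono) auto
  also have "\<dots> \<le> card (?c ` (UNIV - set vs)) + 1" by (simp add: card_insert_if)
  also have "\<dots> \<le> card (UNIV - set vs) + 1" by (simp add: card_image_le)
  also have "card (UNIV - set vs) = CARD('n) - length vs"
    using assms(1) by (simp add: card_Diff_subset distinct_card)
  finally show ?thesis
    using distinct_card[OF assms(1)] card_mono[of "UNIV :: 'n set" "set vs"] by simp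
qed

text \<open>An edge missing from \<open>W\<close> but joining points of one component would close a
  path of at least g vertices in \<open>W\<close>, whence conn at least g - 1.\<close>

lemma small_conn_closed:
  fixes E :: "'n::finite set set"
  assumes E: "simple_graph E" and s: "s \<in> gr_elems E" "enat (gr_conn s) \<le> girth E - 2"
  shows "cl_to_gr E (gr_to_cl s) = s"
proof -
  obtain W p where W: "s = (W, acls (edge_clustering W) p)" "W \<subseteq> E" using s(1) by (rule gr_elemsE)
  have "flat_of E (edge_clustering W) \<subseteq> W"
  proof
    fix e assume e: "e \<in> flat_of E (edge_clustering W)"
    then obtain x y where xy: "e = {x, y}" using simple_graph_edgeE[OF E] flat_of_subset by blast
    show "e \<in> W"
    proof (rule ccontr)
      assume "e \<notin> W"
      then obtain vs where vs: "distinct vs" "girth E \<le> enat (length vs)" "is_cycle E vs"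
        "\<forall>i. Suc i < length vs \<longrightarrow> {vs ! i, vs ! Suc i} \<in> W"
        using chord_path[OF E W(2), of x y] e by (auto simp: xy pair_in_flat_of same_edge_clustering)
      then obtain g where g: "girth E = enat g" "g \<le> length vs" by (cases "girth E") auto
      have "length vs + card (edge_clustering W) \<le> CARD('n) + 1"
        using card_path_conn[OF vs(1)] vs(4) by simp
      \<comment> \<open>Excludes truncation in \<open>g - 2\<close>.\<close>
      moreover have "3 \<le> g" using girth_ge_3[of E] g by (simp add: numeral_eq_enat)
      moreover have "gr_conn s \<le> g - 2" using s(2) g by (simp add: numeral_eq_enat)
      moreover have "card (edge_clustering W) \<le> CARD('n)"
        by (rule card_clustering_le[OF partition_on_edge_clustering])
      ultimately show False using g(2) by (simp add: W(1) gr_conn_pair)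
    qed
  qed
  then have "flat_of E (edge_clustering W) = W" using subset_flat_of_edge_clustering[OF E W(2)] by blast
  then show ?thesis by (simp add: W(1) gr_to_cl_def cl_to_gr_def)
qed

lemma skeleton_iso_girth:
  fixes E :: "'n::finite set set"
  assumes "simple_graph E"
  shows "isomorphic_posets (skeleton (cluster_perm E) cl_rank (girth E - 2))
    (skeleton (graphicahedron E) gr_conn (girth E - 2))"
proof -
  have eq: "{s \<in> {s \<in> gr_elems E. enat (gr_conn s) \<le> girth E - 2}. cl_to_gr E (gr_to_cl s) = s} =
      {s \<in> gr_elems E. enat (gr_conn s) \<le> girth E - 2}"
    using small_conn_closed[OF assms] by blast
  show ?thesis
    unfolding isomorphic_posets_def cluster_perm_poset graphicahedron_poset skeleton_poset
    by (rule exI, rule skeleton_iso_closed[of E "girth E - 2", unfolded eq])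
qed

lemma tree_iso:
  fixes E :: "'n::finite set set"
  assumes "is_tree E"
  shows "poset_iso (graphicahedron E) (cluster_perm E) gr_to_cl"
proof -
  \<comment> \<open>Without cycles the infimum is \<infinity>, and \<infinity> - 2 = \<infinity>, so
    the bound on conn holds for every element.\<close>
  have E: "simple_graph E" and "girth E = \<infinity>" using assms by (auto simp: is_tree_def girth_def top_enat_def)
  then have closed: "cl_to_gr E (gr_to_cl s) = s" if "s \<in> gr_elems E" for s
    using small_conn_closed[OF E that] by simp
  have "bij_betw gr_to_cl (gr_elems E) (cl_elems E)"
    by (rule bij_betw_byWitness[of _ "cl_to_gr E"])
      (auto simp: closed gr_to_cl_cl_to_gr gr_to_cl_elems cl_to_gr_elems)
  moreover have "cl_le (gr_to_cl s) (gr_to_cl t) \<longleftrightarrow> gr_le s t" if "s \<in> gr_elems E" "t \<in> gr_elems E" for s t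
    using cl_to_gr_le_iff[OF gr_to_cl_elems gr_to_cl_elems, OF that] closed that by simp
  ultimately show ?thesis
    unfolding graphicahedron_poset cluster_perm_poset
    by (simp add: poset_iso_poset partial_order_cl[of _ E] partial_order_gr[of _ E])
qed


section \<open>Upper ideals and the lattice of flats\<close>

text \<open>Forwards, the functional summing the coordinates over the component of \<open>i\<close>
  vanishes on all edge vectors and is 1 on the unit vector of \<open>i\<close>, so it is 1 on that
  of \<open>j\<close> as well. Backwards, the edge vectors along a path telescope.\<close>

lemma span_edge_vectors_iff:
  "axis i 1 - axis j 1 \<in> span (edge_vectors F) \<longleftrightarrow> (i, j) \<in> (adj_on F UNIV)\<^sup>*" for i j :: "'n::finite"
proof
  let ?R = "(adj_on F UNIV)\<^sup>*"
  let ?K = "?R `` {i}"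
  let ?\<phi> = "\<lambda>x :: real ^ 'n. \<Sum>k\<in>?K. x $ k"
  have ax: "?\<phi> (axis a 1) = (if a \<in> ?K then 1 else 0)" for a
    by (simp add: axis_def)
  have sub: "subspace {x. ?\<phi> x = 0}"
    by (auto simp: subspace_def sum.distrib simp flip: sum_distrib_left)
  have "edge_vectors F \<subseteq> {x. ?\<phi> x = 0}"
  proof
    fix x assume "x \<in> edge_vectors F"
    then obtain a b where x: "x = axis a 1 - axis b 1" and ab: "{a, b} \<in> F"
      by (auto simp: edge_vectors_def)
    have "(a, b) \<in> adj_on F UNIV" "(b, a) \<in> adj_on F UNIV"
      using ab by (simp_all add: adj_on_def insert_commute)
    then have "a \<in> ?K \<longleftrightarrow> b \<in> ?K" by (auto intro: rtrancl_into_rtrancl)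
    then have "?\<phi> (axis a 1) - ?\<phi> (axis b 1) = 0" unfolding ax by simp
    then show "x \<in> {x. ?\<phi> x = 0}" by (simp add: x sum_subtractf)
  qed
  then have span: "span (edge_vectors F) \<subseteq> {x. ?\<phi> x = 0}" using sub by (rule span_minimal)
  assume "axis i 1 - axis j 1 \<in> span (edge_vectors F)"
  then have "axis i 1 - axis j 1 \<in> {x. ?\<phi> x = 0}" using span by (rule subsetD[rotated])
  then have "?\<phi> (axis i 1) - ?\<phi> (axis j 1) = 0" by (simp add: sum_subtractf)
  then show "(i, j) \<in> ?R" unfolding ax by (simp split: if_splits)
next
  assume "(i, j) \<in> (adj_on F UNIV)\<^sup>*"
  then show "axis i 1 - axis j 1 \<in> span (edge_vectors F)"
  proof (induction rule: rtrancl_induct)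
    case base
    then show ?case by (simp add: span_zero)
  next
    case (step y z)
    have "axis y 1 - axis z 1 \<in> edge_vectors F"
      using step(2) by (auto simp: edge_vectors_def adj_on_def)
    then have "(axis i 1 - axis y 1) + (axis y 1 - axis z 1) \<in> span (edge_vectors F)"
      by (intro span_add step(3) span_base)
    then show ?case by simp
  qed
qed

definition flat_sets :: "'n set set \<Rightarrow> 'n set set set" where
  "flat_sets E = {F. F \<subseteq> E \<and> flat_of E (edge_clustering F) = F}"

lemma flat_sets_iff:
  assumes "simple_graph E" "F \<subseteq> E"
  shows "flat_of E (edge_clustering F) = F \<longleftrightarrow>
    (\<forall>i j. {i, j} \<in> E \<and> (i, j) \<in> (adj_on F UNIV)\<^sup>* \<longrightarrow> {i, j} \<in> F)"
proof
  assume eq: "flat_of E (edge_clustering F) = F"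
  show "\<forall>i j. {i, j} \<in> E \<and> (i, j) \<in> (adj_on F UNIV)\<^sup>* \<longrightarrow> {i, j} \<in> F"
  proof (intro allI impI)
    fix i j assume "{i, j} \<in> E \<and> (i, j) \<in> (adj_on F UNIV)\<^sup>*"
    then have "{i, j} \<in> flat_of E (edge_clustering F)"
      by (simp add: pair_in_flat_of same_edge_clustering)
    then show "{i, j} \<in> F" by (simp add: eq)
  qed
next
  assume R: "\<forall>i j. {i, j} \<in> E \<and> (i, j) \<in> (adj_on F UNIV)\<^sup>* \<longrightarrow> {i, j} \<in> F"
  have "flat_of E (edge_clustering F) \<subseteq> F"
  proof
    fix e assume e: "e \<in> flat_of E (edge_clustering F)"
    then have "e \<in> E" using flat_of_subset by (rule subsetD[rotated])
    then obtain i j where ij: "e = {i, j}" by (rule simple_graph_edgeE[OF assms(1)])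
    then show "e \<in> F" using e R by (simp add: pair_in_flat_of same_edge_clustering)
  qed
  then show "flat_of E (edge_clustering F) = F"
    using subset_flat_of_edge_clustering[OF assms] by (rule subset_antisym)
qed

lemma flats_poset: "simple_graph E \<Longrightarrow> flats E = poset (flat_sets E) (\<subseteq>)"
  unfolding flats_def span_edge_vectors_iff flat_sets_def
  by (rule arg_cong2[where f = poset], rule Collect_cong, rule conj_cong) (simp_all add: flat_sets_iff)

lemma partial_order_subset: "partial_order (poset A (\<subseteq>))"
  by (auto simp: partial_order_poset)

text \<open>\<open>edge_vectors\<close> holds both signs of each edge, while the general result on
  flats takes one vector per edge. Choosing an orientation of every edge changes no span.\<close>

lemma geometric_lattice_flat_sets:
  fixes E :: "'n::finite set set"
  assumes E: "simple_graph E" and F0: "F0 \<in> flat_sets E"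
  shows "geometric_lattice (poset {F \<in> flat_sets E. F0 \<subseteq> F} (\<subseteq>))"
proof -
  have "\<forall>e\<in>E. \<exists>v :: real ^ 'n. \<exists>i j. e = {i, j} \<and> v = axis i 1 - axis j 1"
    using simple_graph_edgeE[OF E] by metis
  then obtain v :: "'n set \<Rightarrow> real ^ 'n"
    where v: "\<forall>e\<in>E. \<exists>i j. e = {i, j} \<and> v e = axis i 1 - axis j 1" by (rule bchoice[THEN exE])
  have span: "span (v ` F) = span (edge_vectors F)" if F: "F \<subseteq> E" for F
  proof
    have "v e \<in> edge_vectors F" if e: "e \<in> F" for e
    proof -
      obtain i j where "e = {i, j}" "v e = axis i 1 - axis j 1" using v F e by blast
      then show ?thesis using e by (auto simp: edge_vectors_def)
    qed
    then show "span (v ` F) \<subseteq> span (edge_vectors F)" by (intro span_mono) auto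
    have "x \<in> span (v ` F)" if "x \<in> edge_vectors F" for x
    proof -
      obtain a b where x: "x = axis a 1 - axis b 1" and ab: "{a, b} \<in> F"
        using \<open>x \<in> edge_vectors F\<close> by (auto simp: edge_vectors_def)
      then obtain i j where ij: "{a, b} = {i, j}" "v {a, b} = axis i 1 - axis j 1" using v F by blast
      have "v {a, b} \<in> span (v ` F)" using ab by (intro span_base) simp
      moreover have "x = v {a, b} \<or> x = - v {a, b}" using ij by (auto simp: x doubleton_eq_iff)
      ultimately show ?thesis using span_neg by auto
    qed
    then show "span (edge_vectors F) \<subseteq> span (v ` F)" by (intro span_minimal subspace_span) auto
  qed
  have flat: "(\<forall>e\<in>E. v e \<in> span (v ` F) \<longrightarrow> e \<in> F) \<longleftrightarrow> flat_of E (edge_clustering F) = F" if F: "F \<subseteq> E" for F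
  proof -
    have ve: "v {i, j} \<in> span (v ` F) \<longleftrightarrow> (i, j) \<in> (adj_on F UNIV)\<^sup>*" if "{i, j} \<in> E" for i j
    proof -
      obtain a b where ab: "{i, j} = {a, b}" "v {i, j} = axis a 1 - axis b 1" using v \<open>{i, j} \<in> E\<close> by blast
      have "v {i, j} \<in> span (v ` F) \<longleftrightarrow> (a, b) \<in> (adj_on F UNIV)\<^sup>*"
        by (simp add: span[OF F] ab(2) span_edge_vectors_iff)
      moreover have "(a, b) = (i, j) \<or> (a, b) = (j, i)" using ab(1) by (auto simp: doubleton_eq_iff)
      ultimately show ?thesis using adj_on_rtrancl_sym by fast
    qed
    have "(\<forall>e\<in>E. v e \<in> span (v ` F) \<longrightarrow> e \<in> F) \<longleftrightarrow>
        (\<forall>i j. {i, j} \<in> E \<and> (i, j) \<in> (adj_on F UNIV)\<^sup>* \<longrightarrow> {i, j} \<in> F)" (is "?L \<longleftrightarrow> ?R")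
    proof
      assume ?L then show ?R using ve by simp
    next
      assume R: ?R
      show ?L
      proof (intro ballI impI)
        fix e assume e: "e \<in> E" "v e \<in> span (v ` F)"
        obtain i j where "e = {i, j}" using e(1) by (rule simple_graph_edgeE[OF E])
        then show "e \<in> F" using R ve e by simp
      qed
    qed
    then show ?thesis by (simp add: flat_sets_iff[OF E F])
  qed
  have F0E: "F0 \<subseteq> E" and F0f: "\<forall>e\<in>E. v e \<in> span (v ` F0) \<longrightarrow> e \<in> F0"
    using F0 flat by (auto simp: flat_sets_def)
  have "{F. F \<subseteq> E \<and> (\<forall>e\<in>E. v e \<in> span (v ` F) \<longrightarrow> e \<in> F) \<and> F0 \<subseteq> F} = {F \<in> flat_sets E. F0 \<subseteq> F}"
    unfolding flat_sets_def using flat by blast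
  then show ?thesis using geometric_lattice_flats_above[of E F0 v] F0E F0f by simp
qed

lemma flat_of_flat_set: "clustering E C \<Longrightarrow> flat_of E C \<in> flat_sets E"
  by (simp add: flat_sets_def flat_of_subset edge_clustering_flat_of)

text \<open>Everything above \<open>s\<close> carries the class of one and the same bijection, so
  its clustering determines it, and the clusterings coarser than that of \<open>s\<close> correspond
  to the flats containing its flat.\<close>

lemma upper_ideal_iso_flats:
  assumes s: "s \<in> cl_elems E"
  shows "poset_iso (poset {t \<in> cl_elems E. cl_le s t} cl_le)
    (poset {F \<in> flat_sets E. flat_of E (fst s) \<subseteq> F} (\<subseteq>)) (\<lambda>t. flat_of E (fst t))"
proof (subst poset_iso_poset)
  let ?U = "{t \<in> cl_elems E. cl_le s t}" and ?V = "{F \<in> flat_sets E. flat_of E (fst s) \<subseteq> F}"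
  show "partial_order (poset ?U cl_le)" by (rule partial_order_cl[of _ E]) blast
  show "partial_order (poset ?V (\<subseteq>))" by (rule partial_order_subset)
  obtain C p where C: "s = (C, acls C p)" "clustering E C" "bij p" using s by (rule cl_elemsE)
  have U: "\<exists>D. t = (D, acls D p) \<and> clustering E D \<and> refines UNIV C D" if t: "t \<in> ?U" for t
  proof -
    obtain D q where D: "t = (D, acls D q)" "clustering E D" "bij q" using t by (auto elim: cl_elemsE)
    have "refines UNIV C D" "p \<in> acls D q"
      using t cl_le_acls[OF C(2) D(2) C(3) D(3)] by (simp_all add: C(1) D(1))
    then show ?thesis using D acls_eq by auto
  qed
  have mem: "(D, acls D p) \<in> ?U" if "clustering E D" "refines UNIV C D" for D
    using that C(3) cl_le_acls[OF C(2) that(1) C(3) C(3)] acls_self[OF C(3)]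
    by (auto simp: C(1) cl_elems_def)
  have "bij_betw (\<lambda>t. flat_of E (fst t)) ?U ?V"
  proof (rule bij_betw_byWitness[of _ "\<lambda>F. (edge_clustering F, acls (edge_clustering F) p)"])
    show "\<forall>t\<in>?U. (edge_clustering (flat_of E (fst t)), acls (edge_clustering (flat_of E (fst t))) p) = t"
      using U by (fastforce simp: edge_clustering_flat_of)
    show "\<forall>F\<in>?V. flat_of E (fst (edge_clustering F, acls (edge_clustering F) p)) = F"
      by (auto simp: flat_sets_def)
    show "(\<lambda>t. flat_of E (fst t)) ` ?U \<subseteq> ?V"
    proof (rule image_subsetI)
      fix t assume "t \<in> ?U"
      then obtain D where "t = (D, acls D p)" "clustering E D" "refines UNIV C D" using U by blast
      then show "flat_of E (fst t) \<in> ?V" by (simp add: C(1) flat_of_flat_set flat_of_mono)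
    qed
    show "(\<lambda>F. (edge_clustering F, acls (edge_clustering F) p)) ` ?V \<subseteq> ?U"
    proof (rule image_subsetI)
      fix F assume F: "F \<in> ?V"
      then have cl: "clustering E (edge_clustering F)" "flat_of E (edge_clustering F) = F"
        by (auto simp: flat_sets_def clustering_edge_clustering)
      then have "refines UNIV C (edge_clustering F)"
        using F flat_of_subset_iff[OF C(2) cl(1)] by (simp add: C(1))
      then show "(edge_clustering F, acls (edge_clustering F) p) \<in> ?U" by (rule mem[OF cl(1)])
    qed
  qed
  moreover have "flat_of E (fst t) \<subseteq> flat_of E (fst u) \<longleftrightarrow> cl_le t u" if tu: "t \<in> ?U" "u \<in> ?U" for t u
  proof -
    obtain D where D: "t = (D, acls D p)" "clustering E D" using U[OF tu(1)] by blast
    obtain G where G: "u = (G, acls G p)" "clustering E G" using U[OF tu(2)] by blast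
    show ?thesis
      using cl_le_acls[OF D(2) G(2) C(3) C(3)] acls_self[OF C(3)] flat_of_subset_iff[OF D(2) G(2)]
      by (simp add: D(1) G(1))
  qed
  ultimately show "bij_betw (\<lambda>t. flat_of E (fst t)) ?U ?V \<and>
      (\<forall>t\<in>?U. \<forall>u\<in>?U. flat_of E (fst t) \<subseteq> flat_of E (fst u) \<longleftrightarrow> cl_le t u)" by simp
qed

lemma flat_of_bot:
  assumes "simple_graph E"
  shows "flat_of E (range (\<lambda>x. {x})) = {}"
proof (rule ccontr)
  assume "flat_of E (range (\<lambda>x. {x})) \<noteq> {}"
  then obtain e where e: "e \<in> flat_of E (range (\<lambda>x. {x}))" by auto
  then have "e \<in> E" using flat_of_subset by (rule subsetD[rotated])
  then obtain i j where "e = {i, j}" "i \<noteq> j" by (rule simple_graph_edgeE[OF assms])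
  then show False using e by (simp add: pair_in_flat_of same_bot)
qed

lemma cl_rank_0_bot:
  fixes C :: "'n::finite set set"
  assumes "clustering E C" "cl_rank (C, A) = 0"
  shows "C = range (\<lambda>x. {x})"
proof (rule ccontr)
  assume "C \<noteq> range (\<lambda>x. {x})"
  then have "range (\<lambda>x::'n. {x}) \<noteq> C" by simp
  then have "card C < card (range (\<lambda>x::'n. {x}))"
    by (rule card_refines_less[OF refines_bot[OF clustering_partition[OF assms(1)]]])
  then show False using assms(2) by (simp add: card_bot cl_rank_pair)
qed

lemma rank_0_upper_ideal:
  fixes E :: "'n::finite set set"
  assumes E: "simple_graph E" and x: "x \<in> carrier (cluster_perm E)" "cl_rank x = 0"
  shows "isomorphic_posets (upper_ideal (cluster_perm E) x) (flats E)"
proof -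
  have xE: "x \<in> cl_elems E" using x by (simp add: cluster_perm_poset)
  obtain C p where C: "x = (C, acls C p)" "clustering E C" using xE by (rule cl_elemsE)
  have "flat_of E (fst x) = {}"
    using cl_rank_0_bot[OF C(2)] x(2) flat_of_bot[OF E] by (simp add: C(1))
  then show ?thesis using upper_ideal_iso_flats[OF xE]
    unfolding isomorphic_posets_def cluster_perm_poset upper_ideal_poset flats_poset[OF E] by auto
qed

lemma geometric_lattice_flats:
  fixes E :: "'n::finite set set"
  assumes E: "simple_graph E"
  shows "geometric_lattice (flats E)"
proof -
  have "{} \<in> flat_sets E"
    using flat_of_flat_set[OF clustering_bot, of E] flat_of_bot[OF E] by simp
  then show ?thesis using geometric_lattice_flat_sets[OF E, of "{}"] by (simp add: flats_poset[OF E])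
qed

lemma locally_geometric_cl:
  fixes E :: "'n::finite set set"
  assumes E: "simple_graph E" "connected_on E UNIV"
  shows "locally_geometric (cluster_perm E)"
  unfolding locally_geometric_def cluster_perm_poset
proof (intro conjI ballI)
  show "partial_order (poset (cl_elems E) cl_le)" by (rule partial_order_cl[OF order_refl])
  show "finite (carrier (poset (cl_elems E) cl_le))" by simp
  show "\<exists>s. greatest (poset (cl_elems E) cl_le) s (carrier (poset (cl_elems E) cl_le))"
  proof
    have top: "({UNIV}, acls {UNIV} id) \<in> cl_elems E"
      using clustering_top[OF E(2)] bij_id unfolding cl_elems_def by blast
    \<comment> \<open>With a single block every bijection belongs to the class of \<open>id\<close>,
      so inclusion is immediate.\<close>
    have "cl_le s ({UNIV}, acls {UNIV} id)" if s: "s \<in> cl_elems E" for s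
      unfolding cl_le_iff[OF s top] using s by (auto elim!: cl_elemsE simp: acls_iff bij_def)
    then show "greatest (poset (cl_elems E) cl_le) ({UNIV}, acls {UNIV} id)
        (carrier (poset (cl_elems E) cl_le))"
      using top by (simp add: greatest_poset)
  qed
  fix s assume "s \<in> carrier (poset (cl_elems E) cl_le)"
  then have s: "s \<in> cl_elems E" by simp
  have "clustering E (fst s)" using s by (auto elim: cl_elemsE)
  then have geo: "geometric_lattice (poset {F \<in> flat_sets E. flat_of E (fst s) \<subseteq> F} (\<subseteq>))"
    by (intro geometric_lattice_flat_sets[OF E(1)] flat_of_flat_set)
  have "partial_order (poset {t \<in> cl_elems E. cl_le s t} cl_le)"
    by (rule partial_order_cl[of _ E]) blast
  then show "geometric_lattice (upper_ideal (poset (cl_elems E) cl_le) s)"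
    unfolding upper_ideal_poset
    by (rule geometric_lattice_iso[OF poset_iso_inv[OF upper_ideal_iso_flats[OF s]] geo])
qed


section \<open>The Cayley graph\<close>

lemma acls_bot: "bij p \<Longrightarrow> acls (range (\<lambda>x. {x})) p = {p}"
  by (auto simp: acls_iff)

lemma acls_edge:
  fixes p :: "'n::finite \<Rightarrow> 'n"
  assumes p: "bij p" and xy: "x \<noteq> y"
  shows "acls (merge (range (\<lambda>x. {x})) {x} {y}) p = {p, p \<circ> Transposition.transpose x y}"
proof (intro subset_antisym subsetI)
  let ?M = "merge (range (\<lambda>x. {x})) {x} {y}"
  fix q assume "q \<in> acls ?M p"
  then have q: "bij q" "\<forall>V\<in>?M. q ` V = p ` V" by (simp_all add: acls_iff)
  have other: "q z = p z" if "z \<noteq> x" "z \<noteq> y" for z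
  proof -
    have "{z} \<in> ?M" using that by (simp add: merge_def)
    then have "q ` {z} = p ` {z}" using q(2) by (rule bspec[rotated])
    then show ?thesis by simp
  qed
  have "{x, y} \<in> ?M" by (auto simp: merge_def)
  then have "q ` {x, y} = p ` {x, y}" using q(2) by (rule bspec[rotated])
  then have "q x = p x \<and> q y = p y \<or> q x = p y \<and> q y = p x" by (auto simp: doubleton_eq_iff)
  then show "q \<in> {p, p \<circ> Transposition.transpose x y}"
  proof
    assume "q x = p x \<and> q y = p y"
    then have "q = p" using other by (intro ext) metis
    then show ?thesis by simp
  next
    assume "q x = p y \<and> q y = p x"
    then have "q = p \<circ> Transposition.transpose x y"
      using other by (intro ext) (simp add: Transposition.transpose_def)
    then show ?thesis by simp
  qed
next
  let ?M = "merge (range (\<lambda>x. {x})) {x} {y}"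
  fix q assume q: "q \<in> {p, p \<circ> Transposition.transpose x y}"
  have "Transposition.transpose x y ` V = V" if "V \<in> ?M" for V
    using that by (auto simp: merge_def Transposition.transpose_def image_iff)
  then have "(p \<circ> Transposition.transpose x y) ` V = p ` V" if "V \<in> ?M" for V
    using that by (simp only: image_comp[symmetric])
  then have "p \<circ> Transposition.transpose x y \<in> acls ?M p"
    unfolding acls_iff by (intro conjI ballI bij_comp bij_transpose p)
  then show "q \<in> acls ?M p" using q acls_self[OF p] by auto
qed

lemma transpose_comp_neq: "bij p \<Longrightarrow> x \<noteq> y \<Longrightarrow> p \<circ> Transposition.transpose x y \<noteq> p"
  by (metis bij_def comp_apply injD transpose_apply_first)

text \<open>Positive rank puts some edge inside a block. Merging its ends in the finest clustering
  gives a refinement of \<open>C\<close> with as many blocks as \<open>C\<close>, hence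
  \<open>C\<close> itself.\<close>

lemma cl_rank_1_edge:
  fixes C :: "'n::finite set set"
  assumes E: "simple_graph E" and C: "clustering E C" and r: "cl_rank (C, A) = 1"
  obtains x y where "{x, y} \<in> E" "x \<noteq> y" "C = merge (range (\<lambda>x. {x})) {x} {y}"
proof -
  let ?B = "range (\<lambda>x::'n. {x})"
  have "C \<noteq> ?B" using r by (auto simp: cl_rank_pair card_bot)
  have pC: "partition_on UNIV C" using C by (rule clustering_partition)
  have "\<not> refines UNIV C ?B"
    using refines_asym[OF refines_bot[OF pC]] \<open>C \<noteq> ?B\<close> by auto
  then obtain x y where xy: "{x, y} \<in> E" "same C x y" "\<not> same ?B x y"
    by (rule refines_separating_edge[OF C clustering_bot])
  then have ne: "x \<noteq> y" by (simp add: same_bot)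
  have M: "clustering E (merge ?B {x} {y})" "card ?B = card (merge ?B {x} {y}) + 1"
    using merge_clustering[OF clustering_bot, of "{x}" "{y}" x y] xy(1) ne by simp_all
  have "card C + 1 = CARD('n)"
    using r card_clustering_le[OF pC] by (simp add: cl_rank_pair)
  then have card: "card C = card (merge ?B {x} {y})" using M(2) by (simp add: card_bot)
  have "refines UNIV (merge ?B {x} {y}) C"
    unfolding refines_iff_same[OF clustering_partition[OF M(1)] pC]
  proof (intro allI impI)
    fix a b assume "same (merge ?B {x} {y}) a b"
    then have "a = b \<or> a = x \<and> b = y \<or> a = y \<and> b = x" unfolding same_def merge_def by auto
    then show "same C a b" using same_refl[OF pC] xy(2) same_sym[OF xy(2)] by auto
  qed
  then have "merge ?B {x} {y} = C" using card_refines_less[of "merge ?B {x} {y}" C] card by auto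
  then show ?thesis using that[OF xy(1) ne] by simp
qed

text \<open>Elements of rank 0 and 1 are, through their second component, the singletons and the
  pairs of bijections differing by an edge transposition. Both orders then become inclusion of these
  sets; the rank decides between \<open>Inl\<close> and \<open>Inr\<close>.\<close>

lemma skeleton_1_cayley:
  fixes E :: "'n::finite set set"
  assumes E: "simple_graph E"
  shows "isomorphic_posets (skeleton (cluster_perm E) cl_rank 1) (cayley E)"
proof -
  let ?B = "range (\<lambda>x::'n. {x})"
  let ?S = "{s \<in> cl_elems E. enat (cl_rank s) \<le> 1}"
  let ?V = "{p :: 'n \<Rightarrow> 'n. bij p}"
  let ?D = "{{p, p \<circ> Transposition.transpose i j} | (p :: 'n \<Rightarrow> 'n) i j. bij p \<and> {i, j} \<in> E}"
  let ?T = "Inl ` ?V \<union> Inr ` ?D"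
  let ?r = "\<lambda>x y :: ('n \<Rightarrow> 'n) + ('n \<Rightarrow> 'n) set. x = y \<or> (\<exists>v e. x = Inl v \<and> y = Inr e \<and> v \<in> e)"
  define f where "f s = (if cl_rank s = 0 then Inl (the_elem (snd s)) else Inr (snd s))"
    for s :: "'n set set \<times> ('n \<Rightarrow> 'n) set"
  have bot: "(?B, {p}) \<in> ?S" "cl_rank (?B, {p}) = 0" if "bij p" for p
    using clustering_bot[of E] acls_bot[OF that] that
    by (auto simp: cl_elems_def cl_rank_pair card_bot zero_enat_def[symmetric])
  have edge: "(merge ?B {i} {j}, {p, p \<circ> Transposition.transpose i j}) \<in> ?S"
    "cl_rank (merge ?B {i} {j}, {p, p \<circ> Transposition.transpose i j}) = 1" if "bij p" "{i, j} \<in> E" for p i j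
  proof -
    have "card {i, j} = 2" using E that(2) unfolding simple_graph_def by (rule bspec)
    then have ne: "i \<noteq> j" by auto
    have M: "clustering E (merge ?B {i} {j})" "card ?B = card (merge ?B {i} {j}) + 1"
      using merge_clustering[OF clustering_bot, of "{i}" "{j}" i j] that(2) ne by simp_all
    show rk: "cl_rank (merge ?B {i} {j}, {p, p \<circ> Transposition.transpose i j}) = 1"
      using M(2) by (simp add: cl_rank_pair card_bot)
    have "(merge ?B {i} {j}, {p, p \<circ> Transposition.transpose i j}) \<in> cl_elems E"
      using M(1) acls_edge[OF that(1) ne] that(1) unfolding cl_elems_def by blast
    then show "(merge ?B {i} {j}, {p, p \<circ> Transposition.transpose i j}) \<in> ?S"
      using rk by (simp add: one_enat_def)
  qed
  have cases: "(\<exists>p. bij p \<and> cl_rank s = 0 \<and> snd s = {p}) \<or>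
      (\<exists>p i j. bij p \<and> {i, j} \<in> E \<and> i \<noteq> j \<and> cl_rank s = 1 \<and> snd s = {p, p \<circ> Transposition.transpose i j})"
    if s: "s \<in> ?S" for s
  proof -
    obtain C p where C: "s = (C, acls C p)" "clustering E C" "bij p" using s by (auto elim: cl_elemsE)
    have "cl_rank s = 0 \<or> cl_rank s = 1" using s by (auto simp: one_enat_def)
    then show ?thesis
    proof
      assume "cl_rank s = 0"
      then have "C = ?B" using cl_rank_0_bot[OF C(2)] by (simp add: C(1))
      then show ?thesis using acls_bot[OF C(3)] C \<open>cl_rank s = 0\<close> by auto
    next
      assume "cl_rank s = 1"
      then have "cl_rank (C, acls C p) = 1" by (simp add: C(1))
      then obtain i j where ij: "{i, j} \<in> E" "i \<noteq> j" "C = merge ?B {i} {j}"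
        by (rule cl_rank_1_edge[OF E C(2)])
      then have "snd s = {p, p \<circ> Transposition.transpose i j}"
        using acls_edge[OF C(3) ij(2)] by (simp add: C(1))
      then show ?thesis using C(3) ij \<open>cl_rank s = 1\<close> by blast
    qed
  qed
  have card2: "card {p, p \<circ> Transposition.transpose i j} = 2" if "bij p" "i \<noteq> j" for p and i j :: 'n
    by (rule card_2_iff[THEN iffD2]) (use transpose_comp_neq[OF that] in metis)
  have kinds: "cl_rank s = 0 \<and> (\<exists>p. snd s = {p}) \<or> cl_rank s = 1 \<and> card (snd s) = 2" if "s \<in> ?S" for s
    using cases[OF that]
  proof (elim disjE exE conjE)
    fix p assume "cl_rank s = 0" "snd s = {p}"
    then show ?thesis by simp
  next
    fix p i j assume *: "bij p" "i \<noteq> j" "cl_rank s = 1" "snd s = {p, p \<circ> Transposition.transpose i j}"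
    have "card (snd s) = 2" unfolding *(4) by (rule card2[OF *(1,2)])
    then show ?thesis using *(3) by simp
  qed
  have ord: "?r (f s) (f t) \<longleftrightarrow> snd s \<subseteq> snd t" if st: "s \<in> ?S" "t \<in> ?S" for s t
  proof -
    show ?thesis using kinds[OF st(1)] kinds[OF st(2)]
    proof (elim disjE conjE exE)
      fix p assume "cl_rank s = 1" "card (snd s) = 2" "cl_rank t = 0" "snd t = {p}"
      moreover from this have "\<not> snd s \<subseteq> snd t" using card_mono[of "snd t" "snd s"] by auto
      ultimately show ?thesis by (simp add: f_def)
    next
      assume *: "cl_rank s = 1" "card (snd s) = 2" "cl_rank t = 1" "card (snd t) = 2"
      then have "snd s \<subseteq> snd t \<longleftrightarrow> snd s = snd t"
        using card_subset_eq[of "snd t" "snd s"] by auto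
      then show ?thesis using * by (simp add: f_def)
    qed (simp_all add: f_def)
  qed
  have snd_f: "snd s = snd t" if "s \<in> ?S" "t \<in> ?S" "f s = f t" for s t
    using ord[OF that(1,2)] ord[OF that(2,1)] that(3) by auto
  have bij: "bij_betw f ?S ?T"
  proof (rule bij_betw_imageI)
    show "inj_on f ?S"
    proof (rule inj_onI)
      fix s t assume st: "s \<in> ?S" "t \<in> ?S" "f s = f t"
      then show "s = t" using snd_eq_imp_eq[of s E t] snd_f[OF st] by simp
    qed
    show "f ` ?S = ?T"
    proof (intro subset_antisym subsetI)
      fix z assume "z \<in> f ` ?S"
      then obtain s where s: "s \<in> ?S" "z = f s" by blast
      show "z \<in> ?T" using cases[OF s(1)]
      proof (elim disjE exE conjE)
        fix p assume "bij p" "cl_rank s = 0" "snd s = {p}"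
        then show ?thesis by (simp add: s(2) f_def)
      next
        fix p i j
        assume *: "bij p" "{i, j} \<in> E" "cl_rank s = 1" "snd s = {p, p \<circ> Transposition.transpose i j}"
        have "snd s \<in> ?D" using *(1,2,4) by blast
        then show ?thesis using *(3) by (simp add: s(2) f_def)
      qed
    next
      fix z assume "z \<in> ?T"
      then show "z \<in> f ` ?S"
      proof (elim UnE imageE CollectE exE conjE)
        fix p assume p: "z = Inl p" "bij p"
        have "f (?B, {p}) = z" using bot(2)[OF p(2)] by (simp add: f_def p(1))
        then show ?thesis using bot(1)[OF p(2)] by blast
      next
        fix e p i j assume e: "z = Inr e" "e = {p, p \<circ> Transposition.transpose i j}" "bij p" "{i, j} \<in> E"
        have "f (merge ?B {i} {j}, e) = z" using edge(2)[OF e(3,4)] by (simp add: f_def e(1,2))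
        then show ?thesis using edge(1)[OF e(3,4)] e(2) by blast
      qed
    qed
  qed
  have po: "partial_order (poset ?T ?r)" by (auto simp: partial_order_poset)
  have iso: "poset_iso (poset ?S cl_le) (poset ?T ?r) f"
    unfolding poset_iso_poset[OF partial_order_cl[of ?S E, OF Collect_restrict] po]
    using bij ord cl_le_iff[of _ E] by simp
  show ?thesis
    unfolding isomorphic_posets_def cluster_perm_poset skeleton_poset cayley_def graph_poset_def
    by (rule exI[where x = f], rule iso)
qed


section \<open>Isospectral matrices and their torus-fixed subsets\<close>

definition diagm :: "('n::finite \<Rightarrow> real) \<Rightarrow> ('n \<Rightarrow> 'n) \<Rightarrow> complex ^ 'n ^ 'n" where
  "diagm l p = (\<chi> i j. if i = j then of_real (l (p i)) else 0)"

lemma diagm_nth: "diagm l p $ i $ j = (if i = j then of_real (l (p i)) else 0)"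
  by (simp add: diagm_def)

lemma mat_nth: "mat z $ i $ j = (if i = j then z else 0)"
  by (simp add: mat_def)

lemma matrix_mult_nth: "(A ** B) $ i $ j = (\<Sum>k\<in>UNIV. A $ i $ k * B $ k $ j)"
  by (simp add: matrix_matrix_mult_def)

lemma det_diagm:
  assumes "bij p"
  shows "det (mat z - diagm l p) = (\<Prod>i\<in>UNIV. z - of_real (l i))"
proof -
  have "det (mat z - diagm l p) = (\<Prod>i\<in>UNIV. (mat z - diagm l p) $ i $ i)"
    by (rule det_diagonal) (simp add: mat_nth diagm_nth)
  also have "\<dots> = (\<Prod>i\<in>UNIV. z - of_real (l (p i)))" by (simp add: mat_nth diagm_nth)
  also have "\<dots> = (\<Prod>i\<in>UNIV. z - of_real (l i))"
    by (rule prod.reindex_bij_betw[of p UNIV UNIV "\<lambda>i. z - of_real (l i)"]) (use assms in simp)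
  finally show ?thesis .
qed

lemma isospectral_edge: "A \<in> isospectral E l \<Longrightarrow> A $ i $ j \<noteq> 0 \<Longrightarrow> i \<noteq> j \<Longrightarrow> {i, j} \<in> E"
  unfolding isospectral_def graph_matrices_def by blast

lemma diagm_isospectral: "bij p \<Longrightarrow> diagm l p \<in> isospectral E l"
  by (simp add: isospectral_def graph_matrices_def det_diagm diagm_nth)

text \<open>Comparing the two factorisations of the characteristic polynomial at a diagonal entry
  shows that it is an eigenvalue; comparing them at an eigenvalue shows that it occurs on the
  diagonal. The resulting map is onto, and bijective by finiteness.\<close>

lemma isospectral_diagonal:
  fixes A :: "complex ^ 'n::finite ^ 'n"
  assumes A: "A \<in> isospectral E l" and l: "inj l" and diag: "\<And>i j. i \<noteq> j \<Longrightarrow> A $ i $ j = 0"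
  shows "\<exists>p. bij p \<and> A = diagm l p"
proof -
  have "det (mat z - A) = (\<Prod>i\<in>UNIV. (mat z - A) $ i $ i)" for z
    by (rule det_diagonal) (simp add: mat_nth diag)
  then have eq: "(\<Prod>i\<in>UNIV. z - A $ i $ i) = (\<Prod>i\<in>UNIV. z - of_real (l i))" for z
    using A by (simp add: isospectral_def mat_nth)
  have "\<exists>k. A $ i $ i = of_real (l k)" for i
  proof -
    have "(\<Prod>k\<in>UNIV. A $ i $ i - A $ k $ k) = 0" by (rule prod_zero) auto
    then show ?thesis unfolding eq by simp
  qed
  then have "\<forall>i. \<exists>k. A $ i $ i = of_real (l k)" by simp
  from choice[OF this] obtain p where p: "\<forall>i. A $ i $ i = of_real (l (p i))" by (rule exE)
  have "\<exists>i. p i = k" for k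
  proof -
    have "(\<Prod>i\<in>UNIV. complex_of_real (l k) - of_real (l i)) = 0" by (rule prod_zero) auto
    then have "(\<Prod>i\<in>UNIV. of_real (l k) - A $ i $ i) = 0" unfolding eq .
    then obtain i where "l k = l (p i)" using p by auto
    then have "k = p i" by (rule injD[OF l])
    then show ?thesis by auto
  qed
  then have "surj p" unfolding surj_def by metis
  then have "bij p" by (simp add: bij_def finite_UNIV_surj_inj)
  moreover have "A = diagm l p" using diag p by (simp add: vec_eq_iff diagm_nth)
  ultimately show ?thesis by blast
qed

lemma conj_action_nth: "conj_action t A $ i $ j = t $ i * inverse (t $ j) * A $ i $ j"
  by (simp add: conj_action_def)

lemma torus_nonzero: "t \<in> torus \<Longrightarrow> t $ i \<noteq> 0"
  by (auto simp: torus_def dest: spec[of _ i])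

lemma conj_fixed_iff:
  assumes t: "t \<in> torus"
  shows "conj_action t A = A \<longleftrightarrow> (\<forall>i j. A $ i $ j \<noteq> 0 \<longrightarrow> t $ i = t $ j)"
proof -
  have "t $ i * inverse (t $ j) * a = a \<longleftrightarrow> (a \<noteq> 0 \<longrightarrow> t $ i = t $ j)" for i j and a :: complex
    using torus_nonzero[OF t, of j] by (auto simp: field_simps)
  then show ?thesis by (simp add: vec_eq_iff conj_action_nth)
qed

section \<open>Fixed points of subtori, and face submanifolds\<close>

definition torus_of :: "'n::finite set set \<Rightarrow> (complex ^ 'n) set" where
  "torus_of C = {t \<in> torus. \<forall>i j. same C i j \<longrightarrow> t $ i = t $ j}"

definition block_part :: "'n::finite set set \<Rightarrow> ('n \<Rightarrow> real) \<Rightarrow> 'n set set \<Rightarrow> (complex ^ 'n ^ 'n) set" where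
  "block_part E l C = {A \<in> isospectral E l. \<forall>i j. A $ i $ j \<noteq> 0 \<longrightarrow> same C i j}"

lemma fixed_points_torus_of:
  assumes C: "partition_on UNIV C"
  shows "fixed_points conj_action (torus_of C) (isospectral E l) = block_part E l C"
proof (intro subset_antisym subsetI)
  fix A assume A: "A \<in> fixed_points conj_action (torus_of C) (isospectral E l)"
  have "same C i j" if ij: "A $ i $ j \<noteq> 0" for i j
  proof (rule ccontr)
    assume n: "\<not> same C i j"
    \<comment> \<open>Constant on blocks, hence in \<open>torus_of C\<close>, but it negates every
      entry between the block of \<open>i\<close> and the rest.\<close>
    define t :: "complex ^ 'a" where "t = (\<chi> k. if same C i k then - 1 else 1)"
    have t: "t \<in> torus" by (simp add: t_def torus_def)
    have "same C i a \<longleftrightarrow> same C i b" if "same C a b" for a b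
      using same_trans[OF C] same_sym that by metis
    then have "t \<in> torus_of C" using t by (simp add: torus_of_def t_def)
    then have "conj_action t A = A" using A by (simp add: fixed_points_def)
    then have "t $ i = t $ j" using ij by (simp add: conj_fixed_iff[OF t])
    then show False using n same_refl[OF C, of i] by (simp add: t_def)
  qed
  then show "A \<in> block_part E l C" using A by (simp add: block_part_def fixed_points_def)
next
  fix A assume "A \<in> block_part E l C"
  then show "A \<in> fixed_points conj_action (torus_of C) (isospectral E l)"
    by (simp add: block_part_def fixed_points_def torus_of_def conj_fixed_iff)
qed

text \<open>Off the diagonal an isospectral matrix has entries at edges only, so \<open>H\<close>
  imposes conditions on edges only. The edges at whose ends every element of \<open>H\<close> has
  equal coordinates form \<open>W\<close>, and equality spreads along paths to the components of
  \<open>W\<close>.\<close>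

lemma fixed_points_subgroup:
  assumes H: "H \<subseteq> torus" and E: "simple_graph E"
  shows "\<exists>C. clustering E C \<and> fixed_points conj_action H (isospectral E l) = block_part E l C"
proof -
  define W where "W = {e \<in> E. \<forall>x\<in>e. \<forall>y\<in>e. \<forall>t\<in>H. t $ x = t $ y}"
  have W: "W \<subseteq> E" by (auto simp: W_def)
  have W_eq: "t $ x = t $ y" if "{x, y} \<in> W" "t \<in> H" for x y t
    using that unfolding W_def by blast
  have "fixed_points conj_action H (isospectral E l) = block_part E l (edge_clustering W)"
  proof (intro subset_antisym subsetI)
    fix A assume A: "A \<in> fixed_points conj_action H (isospectral E l)"
    have "same (edge_clustering W) i j" if ij: "A $ i $ j \<noteq> 0" for i j
    proof (cases "i = j")
      case True
      then show ?thesis by (simp add: same_edge_clustering)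
    next
      case False
      then have "{i, j} \<in> E"
        using isospectral_edge[of A E l i j] A ij by (simp add: fixed_points_def)
      moreover have "t $ i = t $ j" if t: "t \<in> H" for t
      proof -
        have "conj_action t A = A" using A t by (simp add: fixed_points_def)
        then show ?thesis using ij conj_fixed_iff[OF subsetD[OF H t]] by simp
      qed
      ultimately have "{i, j} \<in> W" by (auto simp: W_def)
      then show ?thesis by (auto simp: same_edge_clustering adj_on_def)
    qed
    then show "A \<in> block_part E l (edge_clustering W)"
      using A by (simp add: block_part_def fixed_points_def)
  next
    fix A assume A: "A \<in> block_part E l (edge_clustering W)"
    have eq: "t $ i = t $ j" if t: "t \<in> H" and ij: "(i, j) \<in> (adj_on W UNIV)\<^sup>*" for t i j
      using ij
    proof (induction rule: rtrancl_induct)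
      case (step y z)
      then have "t $ y = t $ z" using t W_eq by (simp add: adj_on_def)
      then show ?case using step.IH by simp
    qed simp
    have "conj_action t A = A" if t: "t \<in> H" for t
      unfolding conj_fixed_iff[OF subsetD[OF H t]]
    proof (intro allI impI)
      fix i j assume "A $ i $ j \<noteq> 0"
      then have "same (edge_clustering W) i j" using A by (simp add: block_part_def)
      then show "t $ i = t $ j" using eq[OF t] by (simp add: same_edge_clustering)
    qed
    then show "A \<in> fixed_points conj_action H (isospectral E l)"
      using A by (simp add: fixed_points_def block_part_def)
  qed
  then show ?thesis using clustering_edge_clustering[OF W] by blast
qed

text \<open>Connected because the arguments of the coordinates can be scaled down to 0: equal
  coordinates have equal arguments, so the path from 1 to \<open>t\<close> stays constant on
  blocks.\<close>

lemma torus_of_subgroup: "closed_connected_subgroup (torus_of C)"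
proof -
  have "torus_of C = {t. \<forall>i. norm (t $ i) = 1} \<inter> {t. \<forall>i j. same C i j \<longrightarrow> t $ i = t $ j}"
    by (auto simp: torus_of_def torus_def)
  moreover have "closed {t :: complex ^ 'a. \<forall>i. norm (t $ i) = 1}"
    by (intro closed_Collect_all closed_Collect_eq continuous_intros)
  moreover have "closed {t :: complex ^ 'a. \<forall>i j. same C i j \<longrightarrow> t $ i = t $ j}"
    by (intro closed_Collect_all closed_Collect_imp closed_Collect_eq open_Collect_const continuous_intros)
  ultimately have cl: "closed (torus_of C)" by (simp add: closed_Int)
  have one: "connected_component (torus_of C) 1 t" if t: "t \<in> torus_of C" for t
    unfolding connected_component_def
  proof (intro exI conjI)
    let ?g = "\<lambda>s::real. (\<chi> i. cis (s * Arg (t $ i))) :: complex ^ 'a"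
    have nt: "norm (t $ i) = 1" for i using t by (simp add: torus_of_def torus_def)
    have "continuous_on {0..1} ?g" by (intro continuous_intros)
    then show "connected (?g ` {0..1})" by (rule connected_continuous_image) simp
    show "?g ` {0..1} \<subseteq> torus_of C"
      using t by (auto simp: torus_of_def torus_def)
    have "?g 0 = 1" by (simp add: vec_eq_iff)
    then show "1 \<in> ?g ` {0..1}" by force
    have "cis (Arg (t $ i)) = t $ i" for i
    proof -
      have "t $ i \<noteq> 0" using nt[of i] by auto
      then show ?thesis using nt[of i] by (simp add: cis_Arg sgn_div_norm)
    qed
    then have "?g 1 = t" by (simp add: vec_eq_iff)
    then show "t \<in> ?g ` {0..1}" by (intro image_eqI[of t ?g 1]) simp_all
  qed
  have "connected (torus_of C)"
    unfolding connected_iff_connected_component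
  proof (intro ballI)
    fix s t assume "s \<in> torus_of C" "t \<in> torus_of C"
    then show "connected_component (torus_of C) s t"
      using connected_component_trans[OF connected_component_sym[OF one] one] by simp
  qed
  then show ?thesis
    using cl unfolding closed_connected_subgroup_def
    by (auto simp: torus_of_def torus_def norm_mult norm_inverse)
qed

lemma same_bot_block: "block_part E l (range (\<lambda>x. {x})) = {A \<in> isospectral E l. \<forall>i j. i \<noteq> j \<longrightarrow> A $ i $ j = 0}"
  by (auto simp: block_part_def same_bot)

lemma torus_fixed_points:
  assumes "inj l"
  shows "fixed_points conj_action torus (isospectral E l) = diagm l ` {p. bij p}"
proof -
  have "torus = torus_of (range (\<lambda>x. {x}))" by (simp add: torus_of_def same_bot)
  then have "fixed_points conj_action torus (isospectral E l) =
      fixed_points conj_action (torus_of (range (\<lambda>x. {x}))) (isospectral E l)" by (rule arg_cong)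
  also have "\<dots> = block_part E l (range (\<lambda>x. {x}))"
    by (rule fixed_points_torus_of[OF clustering_partition[OF clustering_bot]])
  also have "\<dots> = {A \<in> isospectral E l. \<forall>i j. i \<noteq> j \<longrightarrow> A $ i $ j = 0}"
    by (rule same_bot_block)
  also have "\<dots> = diagm l ` {p. bij p}"
  proof (intro subset_antisym subsetI)
    fix A assume "A \<in> {A \<in> isospectral E l. \<forall>i j. i \<noteq> j \<longrightarrow> A $ i $ j = 0}"
    then show "A \<in> diagm l ` {p. bij p}" using isospectral_diagonal[OF _ assms, of A E] by auto
  next
    fix A assume "A \<in> diagm l ` {p. bij p}"
    then show "A \<in> {A \<in> isospectral E l. \<forall>i j. i \<noteq> j \<longrightarrow> A $ i $ j = 0}"
      by (auto simp: diagm_isospectral diagm_nth)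
  qed
  finally show ?thesis .
qed

lemma diagm_block_part: "partition_on UNIV C \<Longrightarrow> bij p \<Longrightarrow> diagm l p \<in> block_part E l C"
  by (auto simp: block_part_def diagm_isospectral diagm_nth same_refl split: if_splits)

definition face :: "'n::finite set set \<Rightarrow> ('n \<Rightarrow> real) \<Rightarrow> 'n set set \<Rightarrow> ('n \<Rightarrow> 'n) \<Rightarrow> (complex ^ 'n ^ 'n) set" where
  "face E l C p = connected_component_set (block_part E l C) (diagm l p)"

lemma diagm_in_face: "partition_on UNIV C \<Longrightarrow> bij p \<Longrightarrow> diagm l p \<in> face E l C p"
  by (simp add: face_def diagm_block_part)

lemma face_submanifold_iff:
  assumes E: "simple_graph E" and l: "inj l"
  shows "face_submanifold conj_action (isospectral E l) F \<longleftrightarrow>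
    (\<exists>C p. clustering E C \<and> bij p \<and> F = face E l C p)"
proof
  assume "face_submanifold conj_action (isospectral E l) F"
  then obtain H where H: "closed_connected_subgroup H"
    "F \<in> components (fixed_points conj_action H (isospectral E l))"
    "F \<inter> fixed_points conj_action torus (isospectral E l) \<noteq> {}"
    by (auto simp: face_submanifold_def)
  have "H \<subseteq> torus" using H(1) by (simp add: closed_connected_subgroup_def)
  then obtain C where C: "clustering E C" "fixed_points conj_action H (isospectral E l) = block_part E l C"
    using fixed_points_subgroup[OF _ E] by blast
  obtain x where x: "F = connected_component_set (block_part E l C) x"
    using H(2) unfolding C(2) components_iff by blast
  obtain p where p: "bij p" "diagm l p \<in> F" using H(3) unfolding torus_fixed_points[OF l] by auto
  have "F = face E l C p" using connected_component_eq p(2) unfolding x face_def by metis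
  then show "\<exists>C p. clustering E C \<and> bij p \<and> F = face E l C p" using C(1) p(1) by blast
next
  assume "\<exists>C p. clustering E C \<and> bij p \<and> F = face E l C p"
  then obtain C p where C: "clustering E C" "bij p" "F = face E l C p" by blast
  note part = clustering_partition[OF C(1)]
  have "F \<in> components (fixed_points conj_action (torus_of C) (isospectral E l))"
    unfolding fixed_points_torus_of[OF part] components_iff C(3) face_def
    using diagm_block_part[OF part C(2)] by blast
  moreover have "diagm l p \<in> F \<inter> fixed_points conj_action torus (isospectral E l)"
    unfolding torus_fixed_points[OF l] C(3) using diagm_in_face[OF part C(2)] C(2) by auto
  ultimately show "face_submanifold conj_action (isospectral E l) F"
    unfolding face_submanifold_def using torus_of_subgroup by blast
qed


subsection \<open>Separating the fixed points\<close>

text \<open>The characteristic determinant of the principal block on \<open>V\<close>, padded with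
  rows of the identity so that it stays a determinant over the full index type.\<close>

definition block_det :: "'n::finite set \<Rightarrow> complex \<Rightarrow> complex ^ 'n ^ 'n \<Rightarrow> complex" where
  "block_det V z A = det (\<chi> i j. if i \<in> V then (mat z - A) $ i $ j else mat 1 $ i $ j)"

text \<open>When the rows in \<open>V\<close> have no entries in columns outside \<open>V\<close>,
  the two padded matrices multiply to \<open>mat z - A\<close> itself, and \<open>det\<close> is
  multiplicative.\<close>

lemma block_det_mult:
  fixes A :: "complex ^ 'n::finite ^ 'n"
  assumes A: "\<And>i j. i \<in> V \<Longrightarrow> j \<notin> V \<Longrightarrow> A $ i $ j = 0"
  shows "block_det V z A * block_det (- V) z A = det (mat z - A)"
proof -
  let ?M = "\<lambda>V. (\<chi> i j. if i \<in> V then (mat z - A) $ i $ j else mat 1 $ i $ j) :: complex ^ 'n ^ 'n"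
  have "(\<Sum>k\<in>UNIV. ?M V $ i $ k * ?M (- V) $ k $ j) = (mat z - A) $ i $ j" for i j
  proof (cases "i \<in> V")
    case True
    have "?M V $ i $ k * ?M (- V) $ k $ j = (if k = j then (mat z - A) $ i $ j else 0)" for k
      using True A[of i k] by (auto simp: mat_nth mat_def)
    then show ?thesis by simp
  next
    case False
    have "?M V $ i $ k * ?M (- V) $ k $ j = (if k = i then (mat z - A) $ i $ j else 0)" for k
      using False by (auto simp: mat_def)
    then show ?thesis by simp
  qed
  then have M: "?M V ** ?M (- V) = mat z - A"
    unfolding vec_eq_iff matrix_mult_nth by (intro allI)
  have "det (?M V ** ?M (- V)) = det (?M V) * det (?M (- V))" by (rule det_mul)
  then show ?thesis unfolding block_det_def M by (rule sym)
qed

lemma block_det_holomorphic: "(\<lambda>z. block_det V z A) holomorphic_on UNIV"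
proof -
  have "(\<lambda>z. (if i \<in> V then (mat z - A) $ i $ j else mat 1 $ i $ j)) holomorphic_on UNIV" for i j
    by (cases "i \<in> V"; cases "i = j") (auto simp: mat_nth mat_def intro!: holomorphic_intros)
  then show ?thesis unfolding block_det_def det_def
    by (auto intro!: holomorphic_on_sum holomorphic_on_prod holomorphic_on_mult holomorphic_on_const)
qed

lemma block_det_continuous: "continuous_on UNIV (block_det V z)"
proof -
  have "continuous_on UNIV (\<lambda>A. (if i \<in> V then (mat z - A) $ i $ j else mat 1 $ i $ j))" for i j
    by (cases "i \<in> V"; cases "i = j") (auto simp: mat_nth mat_def intro!: continuous_intros)
  then have "continuous_on UNIV (\<lambda>A. block_det V z A)" unfolding block_det_def det_def
    by (auto intro!: continuous_on_sum continuous_on_prod continuous_on_mult continuous_on_const)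
  then show ?thesis by simp
qed

text \<open>Each eigenvalue is simple, so it is an eigenvalue of only one of two complementary blocks.\<close>

lemma block_det_not_both_zero:
  fixes A :: "complex ^ 'n::finite ^ 'n"
  assumes l: "inj l" and A: "A \<in> isospectral E l" and V: "\<And>i j. i \<in> V \<Longrightarrow> j \<notin> V \<Longrightarrow> A $ i $ j = 0"
  shows "block_det V (of_real (l k)) A \<noteq> 0 \<or> block_det (- V) (of_real (l k)) A \<noteq> 0"
proof (rule ccontr)
  assume "\<not> ?thesis"
  then have z: "block_det V (of_real (l k)) A = 0" "block_det (- V) (of_real (l k)) A = 0" by auto
  let ?a = "complex_of_real (l k)"
  let ?Q = "\<lambda>z. \<Prod>i\<in>UNIV - {k}. z - complex_of_real (l i)"
  have prod: "block_det V z A * block_det (- V) z A = (z - ?a) * ?Q z" for z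
  proof -
    have "block_det V z A * block_det (- V) z A = (\<Prod>i\<in>UNIV. z - complex_of_real (l i))"
      using block_det_mult[OF V] A by (simp add: isospectral_def)
    also have "\<dots> = (z - ?a) * ?Q z" by (rule prod.remove) auto
    finally show ?thesis .
  qed
  obtain f where f: "((\<lambda>z. block_det V z A) has_field_derivative f) (at ?a)"
    using block_det_holomorphic[of V A] by (auto simp: holomorphic_on_def field_differentiable_def)
  obtain g where g: "((\<lambda>z. block_det (- V) z A) has_field_derivative g) (at ?a)"
    using block_det_holomorphic[of "- V" A] by (auto simp: holomorphic_on_def field_differentiable_def)
  \<comment> \<open>Two factors vanishing at \<open>?a\<close> give a product with derivative 0,
    whereas the factorisation with \<open>?Q\<close> has derivative \<open>?Q ?a\<close> there; so
    \<open>?Q ?a = 0\<close> and the eigenvalue would repeat.\<close>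
  have "((\<lambda>z. block_det V z A * block_det (- V) z A) has_field_derivative 0) (at ?a)"
    using DERIV_mult[OF f g] z by simp
  then have 1: "((\<lambda>z. (z - ?a) * ?Q z) has_field_derivative 0) (at ?a)" by (simp only: prod)
  have "?Q holomorphic_on UNIV" by (intro holomorphic_intros)
  then obtain h where h: "(?Q has_field_derivative h) (at ?a)"
    by (auto simp: holomorphic_on_def field_differentiable_def)
  have "((\<lambda>z. z - ?a) has_field_derivative 1) (at ?a)" by (auto intro!: derivative_eq_intros)
  from DERIV_mult[OF this h] have "((\<lambda>z. (z - ?a) * ?Q z) has_field_derivative ?Q ?a) (at ?a)" by simp
  then have "?Q ?a = 0" using DERIV_unique[OF 1] by simp
  then obtain i where "i \<noteq> k" "l k = l i" by auto
  then show False using l by (metis injD)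
qed

lemma block_det_diagm: "block_det V (of_real (l k)) (diagm l p) = 0 \<longleftrightarrow> (\<exists>i\<in>V. l k = l (p i))"
proof -
  have "block_det V (of_real (l k)) (diagm l p) =
      (\<Prod>i\<in>UNIV. if i \<in> V then of_real (l k) - of_real (l (p i)) else 1)"
    unfolding block_det_def
    by (subst det_diagonal) (auto simp: mat_nth diagm_nth mat_def intro!: prod.cong)
  then show ?thesis by auto
qed

lemma det_isospectral_eigenvalue:
  assumes "A \<in> isospectral E l"
  shows "det (mat (of_real (l k)) - A) = 0"
proof -
  have "det (mat (of_real (l k)) - A) = (\<Prod>i\<in>UNIV. complex_of_real (l k) - of_real (l i))"
    using assms by (simp add: isospectral_def)
  also have "\<dots> = 0" by (rule prod_zero) auto
  finally show ?thesis .
qed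

lemma connected_disjoint_closed:
  assumes "connected S" "closed A" "closed B" "S \<subseteq> A \<union> B" "A \<inter> B \<inter> S = {}" "A \<inter> S \<noteq> {}"
  shows "B \<inter> S = {}"
  using assms unfolding connected_closed by blast


text \<open>One block \<open>V\<close> and one label in the image of \<open>V\<close> under
  \<open>p\<close> are treated at a time: the zero sets of the two determinants cover the face by
  disjoint closed sets, so the label cannot leave \<open>V\<close> along the face. This gives an
  inclusion of the images of \<open>V\<close>, and equality by counting.\<close>

lemma face_separation:
  fixes l :: "'n::finite \<Rightarrow> real"
  assumes C: "partition_on UNIV C" and l: "inj l" and p: "bij p" and q: "bij q"
    and F: "diagm l q \<in> face E l C p"
  shows "q \<in> acls C p"
proof -
  have sub: "p ` V \<subseteq> q ` V" if V: "V \<in> C" for V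
  proof
    fix k assume k: "k \<in> p ` V"
    let ?S = "face E l C p"
    let ?A = "{A. block_det V (of_real (l k)) A = 0}" and ?B = "{A. block_det (- V) (of_real (l k)) A = 0}"
    have iso: "A \<in> isospectral E l" and off: "\<And>i j. i \<in> V \<Longrightarrow> j \<notin> V \<Longrightarrow> A $ i $ j = 0"
      if AS: "A \<in> ?S" for A
    proof -
      have A: "A \<in> block_part E l C"
        using AS connected_component_subset unfolding face_def by (rule subsetD[rotated])
      then show "A \<in> isospectral E l" by (simp add: block_part_def)
      fix i j assume "i \<in> V" "j \<notin> V"
      then show "A $ i $ j = 0" using A same_mem[OF C V, of i j] by (auto simp: block_part_def)
    qed
    have "?B \<inter> ?S = {}"
    proof (rule connected_disjoint_closed)
      show "connected ?S" by (simp add: face_def)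
      show "closed ?A" "closed ?B"
        by (intro closed_Collect_eq block_det_continuous continuous_on_const)+
      show "?S \<subseteq> ?A \<union> ?B"
      proof
        fix A assume A: "A \<in> ?S"
        have "block_det V (of_real (l k)) A * block_det (- V) (of_real (l k)) A =
            det (mat (of_real (l k)) - A)"
          by (rule block_det_mult) (rule off[OF A])
        also have "\<dots> = 0" by (rule det_isospectral_eigenvalue[OF iso[OF A]])
        finally show "A \<in> ?A \<union> ?B" by simp
      qed
      have "\<not> (A \<in> ?A \<and> A \<in> ?B)" if A: "A \<in> ?S" for A
      proof -
        have "block_det V (of_real (l k)) A \<noteq> 0 \<or> block_det (- V) (of_real (l k)) A \<noteq> 0"
          by (rule block_det_not_both_zero[OF l iso[OF A]]) (rule off[OF A])
        then show ?thesis by simp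
      qed
      then show "?A \<inter> ?B \<inter> ?S = {}" by auto
      have "diagm l p \<in> ?A" using k by (auto simp: block_det_diagm)
      then show "?A \<inter> ?S \<noteq> {}" using diagm_in_face[OF C p, of l E] by auto
    qed
    then have "block_det (- V) (of_real (l k)) (diagm l q) \<noteq> 0" using F by auto
    then have "k \<notin> q ` (- V)" by (auto simp: block_det_diagm)
    moreover have "k \<in> range q" using q by (simp add: bij_def)
    ultimately show "k \<in> q ` V" by auto
  qed
  have "q ` V = p ` V" if V: "V \<in> C" for V
  proof -
    have "card (p ` V) = card (q ` V)"
      using p q by (simp add: card_image bij_def inj_on_subset[OF _ subset_UNIV])
    then show ?thesis using sub[OF V] card_subset_eq[of "q ` V" "p ` V"] by simp
  qed
  then show ?thesis using q by (simp add: acls_iff)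
qed


subsection \<open>Joining the fixed points by rotations\<close>

text \<open>Such matrices are closed under products and under subtraction from a scalar matrix, so
  conjugation by a plane rotation reduces to algebra with 2 by 2 blocks.\<close>

definition two_block :: "'n::finite \<Rightarrow> 'n \<Rightarrow> complex \<Rightarrow> complex \<Rightarrow> complex \<Rightarrow> complex \<Rightarrow> ('n \<Rightarrow> complex) \<Rightarrow>
    complex ^ 'n ^ 'n" where
  "two_block i j a b c d f = (\<chi> k m. if k = i \<and> m = i then a else if k = i \<and> m = j then b
     else if k = j \<and> m = i then c else if k = j \<and> m = j then d else if k = m then f k else 0)"

lemma two_block_nth: "two_block i j a b c d f $ k $ m = (if k = i \<and> m = i then a else if k = i \<and> m = j then b
     else if k = j \<and> m = i then c else if k = j \<and> m = j then d else if k = m then f k else 0)"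
  by (simp add: two_block_def)

lemma two_block_other:
  assumes "k \<noteq> m" "{k, m} \<noteq> {i, j}"
  shows "two_block i j a b c d f $ k $ m = 0"
proof -
  have *: "\<not> (k = i \<and> m = i)" "\<not> (k = i \<and> m = j)" "\<not> (k = j \<and> m = i)" "\<not> (k = j \<and> m = j)"
    using assms by auto
  show ?thesis unfolding two_block_nth by (simp only: * assms(1) if_False)
qed

lemma two_block_eqI:
  assumes "i \<noteq> j" "A $ i $ i = a" "A $ i $ j = b" "A $ j $ i = c" "A $ j $ j = d"
    and "\<And>k. k \<noteq> i \<Longrightarrow> k \<noteq> j \<Longrightarrow> A $ k $ k = f k"
    and "\<And>k m. k \<noteq> m \<Longrightarrow> {k, m} \<noteq> {i, j} \<Longrightarrow> A $ k $ m = 0"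
  shows "A = two_block i j a b c d f"
proof -
  have "A $ k $ m = two_block i j a b c d f $ k $ m" for k m
    unfolding two_block_nth using assms(1-5) assms(6)[of k] assms(7)[of k m]
    by (cases "k = i"; cases "k = j"; cases "m = i"; cases "m = j"; cases "k = m")
      (simp_all add: doubleton_eq_iff)
  then show ?thesis by (simp add: vec_eq_iff)
qed

lemma two_block_mult:
  assumes ij: "i \<noteq> j"
  shows "two_block i j a b c d f ** two_block i j a' b' c' d' f' =
    two_block i j (a * a' + b * c') (a * b' + b * d') (c * a' + d * c') (c * b' + d * d') (\<lambda>k. f k * f' k)"
proof -
  let ?M = "two_block i j a b c d f" and ?N = "two_block i j a' b' c' d' f'"
  have two: "(\<Sum>x\<in>UNIV. g x) = g i + g j" if "\<And>x. x \<noteq> i \<Longrightarrow> x \<noteq> j \<Longrightarrow> g x = 0" for g :: "'a \<Rightarrow> complex"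
  proof -
    have "(\<Sum>x\<in>UNIV. g x) = (\<Sum>x\<in>{i, j}. g x)" by (rule sum.mono_neutral_right) (use that in auto)
    then show ?thesis using ij by simp
  qed
  have "(\<Sum>x\<in>UNIV. ?M $ k $ x * ?N $ x $ m) = two_block i j (a * a' + b * c') (a * b' + b * d')
      (c * a' + d * c') (c * b' + d * d') (\<lambda>k. f k * f' k) $ k $ m" for k m
  proof (cases "k = i \<or> k = j")
    case True
    then have "(\<Sum>x\<in>UNIV. ?M $ k $ x * ?N $ x $ m) = ?M $ k $ i * ?N $ i $ m + ?M $ k $ j * ?N $ j $ m"
      by (intro two) (auto simp: two_block_nth)
    then show ?thesis using True ij by (auto simp: two_block_nth)
  next
    case False
    have "(\<Sum>x\<in>UNIV. ?M $ k $ x * ?N $ x $ m) = (\<Sum>x\<in>{k}. ?M $ k $ x * ?N $ x $ m)"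
      by (rule sum.mono_neutral_right) (use False in \<open>auto simp: two_block_nth\<close>)
    then show ?thesis using False by (simp add: two_block_nth)
  qed
  then show ?thesis unfolding vec_eq_iff matrix_mult_nth by (intro allI)
qed

lemma two_block_id: "i \<noteq> j \<Longrightarrow> two_block i j 1 0 0 1 (\<lambda>_. 1) = mat 1"
  by (rule two_block_eqI[symmetric]) (simp_all add: mat_nth)

lemma mat_minus_two_block:
  "i \<noteq> j \<Longrightarrow> mat z - two_block i j a b c d f = two_block i j (z - a) (- b) (- c) (z - d) (\<lambda>k. z - f k)"
  by (rule two_block_eqI) (simp_all add: mat_nth two_block_other, simp_all add: two_block_nth)

lemma diagm_two_block:
  assumes "i \<noteq> j"
  shows "diagm l p = two_block i j (of_real (l (p i))) 0 0 (of_real (l (p j))) (\<lambda>k. of_real (l (p k)))"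
  using assms by (intro two_block_eqI) (simp_all add: diagm_nth)

lemma diagm_swap_two_block:
  assumes "i \<noteq> j"
  shows "diagm l (p \<circ> Transposition.transpose i j) =
    two_block i j (of_real (l (p j))) 0 0 (of_real (l (p i))) (\<lambda>k. of_real (l (p k)))"
  using assms by (intro two_block_eqI) (simp_all add: diagm_nth)

lemma continuous_on_two_block:
  assumes "continuous_on S a" "continuous_on S b" "continuous_on S c" "continuous_on S d"
  shows "continuous_on S (\<lambda>x. two_block i j (a x) (b x) (c x) (d x) f)"
proof -
  have "continuous_on S (\<lambda>x. if k = i \<and> m = i then a x else if k = i \<and> m = j then b x
     else if k = j \<and> m = i then c x else if k = j \<and> m = j then d x else if k = m then f k else 0)" for k m
    by (cases "k = i"; cases "k = j"; cases "m = i"; cases "m = j") (simp_all add: assms)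
  then show ?thesis unfolding two_block_def by (intro continuous_on_vec_lambda)
qed

text \<open>The conjugate of \<open>diagm l p\<close> by the rotation through \<theta> in the plane
  of the coordinates \<open>i\<close> and \<open>j\<close>, multiplied out. It joins
  \<open>diagm l p\<close> at angle 0 to the matrix with the two eigenvalues swapped at angle
  \<open>pi / 2\<close>.\<close>

definition rot_matrix :: "('n::finite \<Rightarrow> real) \<Rightarrow> ('n \<Rightarrow> 'n) \<Rightarrow> 'n \<Rightarrow> 'n \<Rightarrow> real \<Rightarrow> complex ^ 'n ^ 'n" where
  "rot_matrix l p i j \<theta> = two_block i j
     (of_real (l (p i)) * of_real (cos \<theta>) * of_real (cos \<theta>) + of_real (l (p j)) * of_real (sin \<theta>) * of_real (sin \<theta>))
     ((of_real (l (p i)) - of_real (l (p j))) * of_real (cos \<theta>) * of_real (sin \<theta>))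
     ((of_real (l (p i)) - of_real (l (p j))) * of_real (cos \<theta>) * of_real (sin \<theta>))
     (of_real (l (p i)) * of_real (sin \<theta>) * of_real (sin \<theta>) + of_real (l (p j)) * of_real (cos \<theta>) * of_real (cos \<theta>))
     (\<lambda>k. of_real (l (p k)))"

text \<open>Similarity in the inverse-free form \<open>(z - A) R = R (z - D)\<close>, with
  \<open>R\<close> a rotation; taking determinants and cancelling \<open>det R\<close> gives the
  claim.\<close>

lemma det_rot_matrix:
  assumes ij: "i \<noteq> j"
  shows "det (mat z - rot_matrix l p i j \<theta>) = det (mat z - diagm l p)"
proof -
  let ?a = "complex_of_real (l (p i))" and ?b = "complex_of_real (l (p j))"
  define c where "c = complex_of_real (cos \<theta>)"
  define s where "s = complex_of_real (sin \<theta>)"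
  have cs: "c * c + s * s = 1"
    unfolding c_def s_def by (metis of_real_1 of_real_add of_real_mult power2_eq_square sin_cos_squared_add2)
  let ?D = "two_block i j ?a 0 0 ?b (\<lambda>k. complex_of_real (l (p k)))"
  let ?A = "rot_matrix l p i j \<theta>"
  let ?R = "two_block i j c (- s) s c (\<lambda>_. 1)" and ?R' = "two_block i j c s (- s) c (\<lambda>_. 1)"
  have A: "?A = two_block i j (?a * c * c + ?b * s * s) ((?a - ?b) * c * s) ((?a - ?b) * c * s)
      (?a * s * s + ?b * c * c) (\<lambda>k. of_real (l (p k)))"
    unfolding rot_matrix_def c_def s_def ..
  have D: "diagm l p = ?D" by (rule diagm_two_block[OF ij])
  have RR': "?R ** ?R' = mat 1"
    unfolding two_block_mult[OF ij] using cs by (simp add: two_block_id[OF ij] add.commute)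
  have "det ?R * det ?R' = 1" unfolding det_mul[symmetric] RR' by (rule det_I)
  then have R: "det ?R \<noteq> 0" by auto
  \<comment> \<open>The four entries of \<open>(z - A) R = R (z - D)\<close>, in the shape that
    \<open>two_block_mult\<close> produces, zeros included, so that they serve as rewrite
    rules.\<close>
  have e1: "(z - (?a * c * c + ?b * s * s)) * c + - ((?a - ?b) * c * s) * s = c * (z - ?a) + - s * - 0"
    using cs by algebra
  have e2: "(z - (?a * c * c + ?b * s * s)) * - s + - ((?a - ?b) * c * s) * c = c * - 0 + - s * (z - ?b)"
    using cs by algebra
  have e3: "- ((?a - ?b) * c * s) * c + (z - (?a * s * s + ?b * c * c)) * s = s * (z - ?a) + c * - 0"
    using cs by algebra
  have e4: "- ((?a - ?b) * c * s) * - s + (z - (?a * s * s + ?b * c * c)) * c = s * - 0 + c * (z - ?b)"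
    using cs by algebra
  have "(mat z - ?A) ** ?R = ?R ** (mat z - ?D)"
    unfolding A mat_minus_two_block[OF ij] two_block_mult[OF ij] e1 e2 e3 e4 by simp
  then have "det (mat z - ?A) * det ?R = det ?R * det (mat z - ?D)"
    unfolding det_mul[symmetric] by (rule arg_cong)
  then show ?thesis using R by (simp add: D)
qed

lemma rot_matrix_block_part:
  assumes E: "{i, j} \<in> E" "i \<noteq> j" and C: "partition_on UNIV C" "same C i j" and p: "bij p"
  shows "rot_matrix l p i j \<theta> \<in> block_part E l C"
proof -
  have ji: "{j, i} \<in> E" using E(1) by (simp add: insert_commute)
  have "rot_matrix l p i j \<theta> $ a $ b = cnj (rot_matrix l p i j \<theta> $ b $ a)" for a b
    unfolding rot_matrix_def two_block_nth
    by (cases "a = i"; cases "a = j"; cases "b = i"; cases "b = j"; cases "a = b") (use E(2) in simp_all)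
  moreover have "rot_matrix l p i j \<theta> $ a $ b = 0" if "a \<noteq> b" "{a, b} \<notin> E" for a b
  proof -
    have "{a, b} \<noteq> {i, j}" using that(2) E(1) by auto
    then show ?thesis unfolding rot_matrix_def by (rule two_block_other[OF that(1)])
  qed
  ultimately have "rot_matrix l p i j \<theta> \<in> graph_matrices E"
    unfolding graph_matrices_def by blast
  then have "rot_matrix l p i j \<theta> \<in> isospectral E l"
    by (simp add: isospectral_def det_rot_matrix[OF E(2)] det_diagm[OF p])
  moreover have "same C a b" if nz: "rot_matrix l p i j \<theta> $ a $ b \<noteq> 0" for a b
  proof -
    have "a = b \<or> {a, b} = {i, j}" using nz two_block_other unfolding rot_matrix_def by metis
    then show ?thesis using same_refl[OF C(1)] C(2) same_sym[OF C(2)] by (auto simp: doubleton_eq_iff)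
  qed
  ultimately show ?thesis by (simp add: block_part_def)
qed

lemma rotation_in_face:
  assumes E: "{i, j} \<in> E" "i \<noteq> j" and C: "partition_on UNIV C" "same C i j" and p: "bij p"
  shows "rot_matrix l p i j \<theta> \<in> face E l C p"
proof -
  have "continuous_on UNIV (rot_matrix l p i j)"
    unfolding rot_matrix_def by (intro continuous_on_two_block continuous_intros)
  then have "connected (range (rot_matrix l p i j))" by (rule connected_continuous_image) simp
  moreover have "rot_matrix l p i j 0 = diagm l p"
    unfolding diagm_two_block[OF E(2)] rot_matrix_def by simp
  then have "diagm l p \<in> range (rot_matrix l p i j)" by (metis rangeI)
  moreover have "range (rot_matrix l p i j) \<subseteq> block_part E l C"
    using rot_matrix_block_part[OF assms] by blast
  ultimately have "range (rot_matrix l p i j) \<subseteq> face E l C p"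
    unfolding face_def by (intro connected_component_maximal)
  then show ?thesis by blast
qed

lemma face_swap_edge:
  assumes E: "{i, j} \<in> E" "i \<noteq> j" and C: "partition_on UNIV C" "same C i j" and p: "bij p"
  shows "diagm l (p \<circ> Transposition.transpose i j) \<in> face E l C p"
proof -
  have "rot_matrix l p i j (pi / 2) = diagm l (p \<circ> Transposition.transpose i j)"
    unfolding diagm_swap_two_block[OF E(2)] rot_matrix_def by simp
  then show ?thesis using rotation_in_face[OF assms, of l "pi / 2"] by simp
qed

lemma face_eq: "diagm l q \<in> face E l C p \<Longrightarrow> face E l C q = face E l C p"
  unfolding face_def by (metis connected_component_eq)

text \<open>A transposition of two points of a block is built from edge transpositions along a path,
  through (i z) = (z y)(i y)(z y), and each edge swap stays in the component.\<close>

lemma face_swap: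
  assumes E: "simple_graph E" and C: "clustering E C" and ij: "same C i j" and p: "bij p" "bij q"
    and q: "diagm l q \<in> face E l C p"
  shows "diagm l (q \<circ> Transposition.transpose i j) \<in> face E l C p"
proof -
  note part = clustering_partition[OF C]
  have edge: "diagm l (r \<circ> Transposition.transpose a b) \<in> face E l C p"
    if "{a, b} \<in> flat_of E C" "bij r" "diagm l r \<in> face E l C p" for a b r
  proof -
    have ab: "{a, b} \<in> E" "same C a b" using that(1) by (simp_all add: pair_in_flat_of)
    have "card {a, b} = 2" using E ab(1) unfolding simple_graph_def by (rule bspec)
    then have "a \<noteq> b" by auto
    then have "diagm l (r \<circ> Transposition.transpose a b) \<in> face E l C r"
      by (rule face_swap_edge[OF ab(1) _ part ab(2) that(2)])
    then show ?thesis unfolding face_eq[OF that(3)] .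
  qed
  have bijt: "bij (r \<circ> Transposition.transpose a b)" if "bij r" for r :: "'a \<Rightarrow> 'a" and a b
    using that by (intro bij_comp bij_transpose)
  have "(i, j) \<in> (adj_on (flat_of E C) UNIV)\<^sup>*" by (rule clustering_same_connected[OF C ij])
  \<comment> \<open>Quantified over \<open>r\<close>, because the induction hypothesis is applied to
    a bijection already altered by an edge swap.\<close>
  then have "\<forall>r. bij r \<longrightarrow> diagm l r \<in> face E l C p \<longrightarrow>
      diagm l (r \<circ> Transposition.transpose i j) \<in> face E l C p"
  proof (induction rule: rtrancl_induct)
    case base
    then show ?case by simp
  next
    case (step y z)
    have yz: "{y, z} \<in> flat_of E C" "{z, y} \<in> flat_of E C"
      using step(2) by (simp_all add: adj_on_def insert_commute)
    show ?case
    proof (intro allI impI)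
      fix r assume r: "bij r" "diagm l r \<in> face E l C p"
      consider "i = z" | "y = i" | "i \<noteq> z" "y \<noteq> i" by blast
      then show "diagm l (r \<circ> Transposition.transpose i z) \<in> face E l C p"
      proof cases
        case 1
        then show ?thesis using r by simp
      next
        case 2
        then show ?thesis using edge[OF yz(1) r] by simp
      next
        case 3
        let ?t = "Transposition.transpose z y" and ?u = "Transposition.transpose i y"
        have "diagm l (r \<circ> ?t) \<in> face E l C p" by (rule edge[OF yz(2) r])
        then have "diagm l (r \<circ> ?t \<circ> ?u) \<in> face E l C p" using step.IH bijt[OF r(1)] by blast
        then have "diagm l (r \<circ> ?t \<circ> ?u \<circ> ?t) \<in> face E l C p"
          by (intro edge[OF yz(2)] bijt r(1))
        moreover have "r \<circ> ?t \<circ> ?u \<circ> ?t = r \<circ> Transposition.transpose i z"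
        proof -
          have "?t \<circ> Transposition.transpose y i \<circ> ?t = Transposition.transpose z i"
            by (rule transpose_comp_triple) (use 3 in auto)
          then have "?t \<circ> (?u \<circ> ?t) = Transposition.transpose i z"
            by (simp only: comp_assoc Transposition.transpose_commute[of y i] Transposition.transpose_commute[of z i])
          then show ?thesis by (simp only: comp_assoc)
        qed
        ultimately show ?thesis by simp
      qed
    qed
  qed
  then show ?thesis using p(2) q by blast
qed

text \<open>Swapping within blocks removes one disagreement between two bijections at a time.\<close>

lemma face_connects:
  fixes C :: "'n::finite set set"
  assumes E: "simple_graph E" and C: "clustering E C" and p: "bij p" and q: "q \<in> acls C p"
  shows "diagm l q \<in> face E l C p"
proof -
  note part = clustering_partition[OF C]
  have "diagm l q \<in> face E l C p" if "bij r" "diagm l r \<in> face E l C p" "q \<in> acls C r" for r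
    using that
  proof (induction "card {x. r x \<noteq> q x}" arbitrary: r rule: less_induct)
    case less
    show ?case
    proof (cases "r = q")
      case True
      then show ?thesis using less.prems by simp
    next
      case False
      then obtain x where x: "r x \<noteq> q x" by auto
      obtain V where V: "V \<in> C" "x \<in> V" using partition_on_block_ex[OF part] by auto
      have "q ` V = r ` V" using less.prems(3) V(1) by (simp add: acls_iff)
      then have "q x \<in> r ` V" using V(2) by auto
      then obtain y where y: "y \<in> V" "r y = q x" by auto
      have xy: "same C x y" using V y by (auto simp: same_def)
      have qb: "bij q" using less.prems(3) by (simp add: acls_iff)
      have yx: "y \<noteq> x" using x y by auto
      \<comment> \<open>So \<open>y\<close> was a disagreement already, and the swap repairs
        \<open>x\<close> without creating a new one.\<close>
      then have "r y \<noteq> q y" using y(2) qb by (auto simp: bij_def dest: injD)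
      let ?r = "r \<circ> Transposition.transpose x y"
      have "{z. ?r z \<noteq> q z} \<subseteq> {z. r z \<noteq> q z} - {x}"
        using y(2) \<open>r y \<noteq> q y\<close> by (auto simp: Transposition.transpose_def split: if_splits)
      then have "{z. ?r z \<noteq> q z} \<subset> {z. r z \<noteq> q z}" using x by blast
      then have "card {z. ?r z \<noteq> q z} < card {z. r z \<noteq> q z}" by (intro psubset_card_mono) simp_all
      moreover have "bij ?r" using less.prems(1) by (intro bij_comp bij_transpose)
      moreover have "diagm l ?r \<in> face E l C p"
        by (rule face_swap[OF E C xy p less.prems(1,2)])
      moreover have "q \<in> acls C ?r"
        using acls_eq[OF swap_in_acls[OF part less.prems(1) xy]] less.prems(3) by simp
      ultimately show ?thesis by (rule less.hyps)
    qed
  qed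
  then show ?thesis using diagm_in_face[OF part p] p q by blast
qed

text \<open>From faces to classes only the diagonal matrices matter: the face of \<open>C\<close>
  and \<open>p\<close> contains \<open>diagm l r\<close>, for a bijection \<open>r\<close>, exactly
  when \<open>r\<close> is in the class of \<open>p\<close>. Conversely, a coarser clustering has a
  larger block part, hence larger components.\<close>

lemma face_subset_iff:
  fixes l :: "'n::finite \<Rightarrow> real"
  assumes E: "simple_graph E" and l: "inj l" and C: "clustering E C" "clustering E D" and p: "bij p" "bij q"
  shows "face E l C p \<subseteq> face E l D q \<longleftrightarrow> acls C p \<subseteq> acls D q"
proof
  note part = clustering_partition[OF C(1)] clustering_partition[OF C(2)]
  assume sub: "face E l C p \<subseteq> face E l D q"
  show "acls C p \<subseteq> acls D q"
  proof
    fix r assume r: "r \<in> acls C p"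
    then have "bij r" by (simp add: acls_iff)
    moreover have "diagm l r \<in> face E l D q" using face_connects[OF E C(1) p(1) r] sub by blast
    ultimately show "r \<in> acls D q" using face_separation[OF part(2) l p(2)] by blast
  qed
next
  note part = clustering_partition[OF C(1)] clustering_partition[OF C(2)]
  assume "acls C p \<subseteq> acls D q"
  then have CD: "refines UNIV C D" "p \<in> acls D q" using acls_subset_iff[OF part p(2,1)] by simp_all
  have "block_part E l C \<subseteq> block_part E l D"
    using CD(1) by (auto simp: block_part_def refines_iff_same part)
  then have "face E l C p \<subseteq> face E l D p" unfolding face_def by (rule connected_component_mono)
  also have "face E l D p = face E l D q" by (rule face_eq[OF face_connects[OF E C(2) p(2) CD(2)]])
  finally show "face E l C p \<subseteq> face E l D q" .
qed


subsection \<open>Ranks of faces\<close>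

lemma noneffective_kernel_face:
  fixes l :: "'n::finite \<Rightarrow> real"
  assumes E: "simple_graph E" and l: "inj l" and C: "clustering E C" and p: "bij p"
  shows "noneffective_kernel conj_action (face E l C p) = torus_of C"
proof (intro subset_antisym subsetI)
  note part = clustering_partition[OF C]
  fix t assume "t \<in> noneffective_kernel conj_action (face E l C p)"
  then have t: "t \<in> torus" "\<And>A. A \<in> face E l C p \<Longrightarrow> conj_action t A = A"
    by (auto simp: noneffective_kernel_def)
  have edge: "t $ i = t $ j" if "{i, j} \<in> flat_of E C" for i j
  proof -
    have ij: "{i, j} \<in> E" "same C i j" using that by (simp_all add: pair_in_flat_of)
    have "card {i, j} = 2" using E ij(1) unfolding simple_graph_def by (rule bspec)
    then have ne: "i \<noteq> j" by auto
    have "l (p i) \<noteq> l (p j)" using l p ne by (auto simp: bij_def dest: injD)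
    then have "rot_matrix l p i j (pi / 4) $ i $ j \<noteq> 0"
      using ne by (simp add: rot_matrix_def two_block_nth cos_45 sin_45)
    moreover have "conj_action t (rot_matrix l p i j (pi / 4)) = rot_matrix l p i j (pi / 4)"
      by (rule t(2)[OF rotation_in_face[OF ij(1) ne part ij(2) p]])
    ultimately show ?thesis unfolding conj_fixed_iff[OF t(1)] by blast
  qed
  have "t $ i = t $ j" if "same C i j" for i j
    using clustering_same_connected[OF C that]
  proof (induction rule: rtrancl_induct)
    case (step y z)
    then show ?case using edge[of y z] by (simp add: adj_on_def)
  qed simp
  then show "t \<in> torus_of C" using t(1) by (simp add: torus_of_def)
next
  fix t assume t: "t \<in> torus_of C"
  then have tt: "t \<in> torus" by (simp add: torus_of_def)
  have "conj_action t A = A" if "A \<in> face E l C p" for A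
  proof -
    have "A \<in> block_part E l C" using that connected_component_subset unfolding face_def by blast
    then show ?thesis using t by (simp add: conj_fixed_iff[OF tt] block_part_def torus_of_def)
  qed
  then show "t \<in> noneffective_kernel conj_action (face E l C p)"
    using tt by (simp add: noneffective_kernel_def)
qed

text \<open>Two different frequencies give opposite values at \<open>s = pi / (x - y)\<close>.
  Recovers exponents from one-parameter subgroups, for Lie algebras here and for weights
  later.\<close>

lemma cis_mult_eq_imp_eq:
  assumes "\<And>s. cis (s * x) = cis (s * y)"
  shows "x = y"
proof (rule ccontr)
  assume "x \<noteq> y"
  let ?s = "pi / (x - y)"
  have "?s * x = pi + ?s * y" using \<open>x \<noteq> y\<close> by (simp add: field_simps)
  then have "cis (?s * x) = - cis (?s * y)" by (metis cis_mult cis_pi mult_minus1)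
  then have "cis (?s * y) = 0" using assms[of ?s] by simp
  then show False by simp
qed

lemma lie_algebra_torus_of: "lie_algebra (torus_of C) = {x. \<forall>i j. same C i j \<longrightarrow> x $ i = x $ j}"
proof (intro subset_antisym subsetI)
  fix x assume x: "x \<in> lie_algebra (torus_of C)"
  have "x $ i = x $ j" if "same C i j" for i j
  proof (rule cis_mult_eq_imp_eq)
    fix s
    have "(\<chi> i. cis (s * x $ i)) \<in> torus_of C" using x by (simp add: lie_algebra_def)
    then show "cis (s * x $ i) = cis (s * x $ j)" using that by (auto simp: torus_of_def)
  qed
  then show "x \<in> {x. \<forall>i j. same C i j \<longrightarrow> x $ i = x $ j}" by simp
next
  fix x :: "real ^ 'a" assume "x \<in> {x. \<forall>i j. same C i j \<longrightarrow> x $ i = x $ j}"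
  then have "\<And>i j. same C i j \<Longrightarrow> x $ i = x $ j" by simp
  then show "x \<in> lie_algebra (torus_of C)" by (simp add: lie_algebra_def torus_of_def torus_def)
qed

text \<open>The indicator vectors of the blocks form an orthogonal basis of the vectors constant on
  blocks.\<close>

lemma dim_lie_algebra_torus_of:
  fixes C :: "'n::finite set set"
  assumes C: "partition_on UNIV C"
  shows "dim (lie_algebra (torus_of C)) = card C"
proof (rule dim_unique)
  define ind :: "'n set \<Rightarrow> real ^ 'n" where "ind V = (\<chi> i. if i \<in> V then 1 else 0)" for V
  let ?B = "ind ` C" and ?S = "{x :: real ^ 'n. \<forall>i j. same C i j \<longrightarrow> x $ i = x $ j}"
  have nonempty: "V \<noteq> {}" if "V \<in> C" for V using C that by (auto simp: partition_on_def)
  have "inj_on ind C"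
  proof (rule inj_onI)
    fix V V' assume V: "V \<in> C" "V' \<in> C" "ind V = ind V'"
    then obtain x where x: "x \<in> V" using nonempty by auto
    have "ind V $ x = ind V' $ x" using V(3) by simp
    then have "x \<in> V'" using x by (simp add: ind_def split: if_splits)
    then show "V = V'" using partition_on_block_unique[OF C V(1,2) x] by simp
  qed
  then show "card ?B = card C" by (rule card_image)
  show "?B \<subseteq> lie_algebra (torus_of C)"
    unfolding lie_algebra_torus_of
  proof (rule image_subsetI)
    fix V assume V: "V \<in> C"
    have "i \<in> V \<longleftrightarrow> j \<in> V" if "same C i j" for i j
      using same_mem[OF C V, of i j] same_mem[OF C V, of j i] same_sym[OF that] that by auto
    then show "ind V \<in> ?S" by (simp add: ind_def)
  qed
  show "lie_algebra (torus_of C) \<subseteq> span ?B"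
    unfolding lie_algebra_torus_of
  proof
    fix x assume x: "x \<in> ?S"
    define c where "c V = x $ (SOME i. i \<in> V)" for V
    have "x = (\<Sum>V\<in>C. c V *\<^sub>R ind V)"
      unfolding vec_eq_iff
    proof
      fix i
      obtain V where V: "V \<in> C" "i \<in> V" using partition_on_block_ex[OF C] by auto
      have "(\<Sum>U\<in>C. c U *\<^sub>R ind U) $ i = (\<Sum>U\<in>C. if U = V then c V else 0)"
        unfolding sum_component
      proof (rule sum.cong)
        fix U assume U: "U \<in> C"
        have "i \<in> U \<longleftrightarrow> U = V" using partition_on_block_unique[OF C U V(1) _ V(2)] V(2) by auto
        then show "(c U *\<^sub>R ind U) $ i = (if U = V then c V else 0)" by (simp add: ind_def)
      qed simp
      also have "\<dots> = c V" using V(1) by simp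
      also have "\<dots> = x $ i"
      proof -
        have "(SOME i. i \<in> V) \<in> V" using V(2) by (rule someI)
        then have "same C (SOME i. i \<in> V) i" using V by (auto simp: same_def)
        then show ?thesis using x by (simp add: c_def)
      qed
      finally show "x $ i = (\<Sum>V\<in>C. c V *\<^sub>R ind V) $ i" by simp
    qed
    also have "\<dots> \<in> span ?B" by (intro span_sum span_scale span_base imageI)
    finally show "x \<in> span ?B" .
  qed
  show "independent ?B"
  proof (rule pairwise_orthogonal_independent)
    show "pairwise orthogonal ?B"
    proof (rule pairwiseI)
      fix x y assume xy: "x \<in> ?B" "y \<in> ?B" "x \<noteq> y"
      then obtain V V' where V: "V \<in> C" "V' \<in> C" "x = ind V" "y = ind V'" by auto
      then have "V \<noteq> V'" using xy(3) by auto
      then have "ind V $ i * ind V' $ i = 0" for i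
        using partition_on_block_unique[OF C V(1,2), of i] by (auto simp: ind_def)
      then have "(\<Sum>i\<in>UNIV. ind V $ i * ind V' $ i) = 0" by (intro sum.neutral) blast
      then show "orthogonal x y" by (simp only: V(3,4) orthogonal_def inner_vec_def inner_real_def)
    qed
    show "0 \<notin> ?B"
    proof
      assume "0 \<in> ?B"
      then obtain V where V: "V \<in> C" "ind V = 0" by auto
      then obtain i where "i \<in> V" using nonempty by auto
      then have "ind V $ i = 1" by (simp add: ind_def)
      then show False using V(2) by simp
    qed
  qed
qed

lemma face_rank_face:
  fixes l :: "'n::finite \<Rightarrow> real"
  assumes "simple_graph E" "inj l" "clustering E C" "bij p"
  shows "face_rank conj_action (face E l C p) = cl_rank (C, A)"
  unfolding face_rank_def noneffective_kernel_face[OF assms] cl_rank_pair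
  by (simp add: dim_lie_algebra_torus_of[OF clustering_partition[OF assms(3)]])

text \<open>Built from pairs to faces and inverted at the end, since a face is defined from a
  clustering and a bijection. The bijection is chosen from the class, and the inner fact
  \<open>g\<close> shows that the choice is immaterial.\<close>

lemma face_poset_iso:
  fixes E :: "'n::finite set set"
  assumes E: "simple_graph E" and l: "inj l"
  shows "\<exists>f. poset_iso (face_poset conj_action (isospectral E l)) (cluster_perm E) f \<and>
    (\<forall>F\<in>carrier (face_poset conj_action (isospectral E l)). cl_rank (f F) = face_rank conj_action F)"
proof -
  let ?F = "{F. face_submanifold conj_action (isospectral E l) F}"
  define g where "g s = face E l (fst s) (SOME p. p \<in> snd s)" for s :: "'n set set \<times> ('n \<Rightarrow> 'n) set"
  have g: "g (C, acls C p) = face E l C p" if C: "clustering E C" "bij p" for C p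
  proof -
    let ?q = "SOME q. q \<in> acls C p"
    have q: "?q \<in> acls C p" by (rule someI[where x = p], rule acls_self[OF C(2)])
    then have "bij ?q" by (simp add: acls_iff)
    then show ?thesis
      using face_subset_iff[OF E l C(1) C(1), of ?q p] face_subset_iff[OF E l C(1) C(1), of p ?q]
        C(2) acls_eq[OF q] by (simp add: g_def subset_antisym)
  qed
  have ord: "g s \<subseteq> g t \<longleftrightarrow> cl_le s t" if st: "s \<in> cl_elems E" "t \<in> cl_elems E" for s t
  proof -
    obtain C p where s: "s = (C, acls C p)" "clustering E C" "bij p" using st(1) by (rule cl_elemsE)
    obtain D q where t: "t = (D, acls D q)" "clustering E D" "bij q" using st(2) by (rule cl_elemsE)
    show ?thesis
      unfolding cl_le_iff[OF st] unfolding s(1) t(1) g[OF s(2,3)] g[OF t(2,3)] snd_conv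
      by (rule face_subset_iff[OF E l s(2) t(2) s(3) t(3)])
  qed
  have "inj_on g (cl_elems E)"
  proof (rule inj_onI)
    fix s t assume st: "s \<in> cl_elems E" "t \<in> cl_elems E" "g s = g t"
    then have "cl_le s t" "cl_le t s" using ord by (metis order_refl)+
    then have "snd s = snd t" using cl_le_iff[OF st(1,2)] cl_le_iff[OF st(2,1)] by simp
    then show "s = t" by (rule snd_eq_imp_eq[OF st(1,2)])
  qed
  moreover have "g ` cl_elems E = ?F"
  proof (intro subset_antisym subsetI)
    fix F assume "F \<in> g ` cl_elems E"
    then obtain s where s: "s \<in> cl_elems E" "F = g s" by blast
    obtain C p where C: "s = (C, acls C p)" "clustering E C" "bij p" using s(1) by (rule cl_elemsE)
    have "F = face E l C p" using g[OF C(2,3)] s(2) C(1) by simp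
    then show "F \<in> ?F" using C(2,3) by (auto simp: face_submanifold_iff[OF E l])
  next
    fix F assume "F \<in> ?F"
    then obtain C p where C: "clustering E C" "bij p" "F = face E l C p"
      by (auto simp: face_submanifold_iff[OF E l])
    then have "F = g (C, acls C p)" "(C, acls C p) \<in> cl_elems E"
      using g[OF C(1,2)] by (auto simp: cl_elems_def)
    then show "F \<in> g ` cl_elems E" by blast
  qed
  ultimately have bij: "bij_betw g (cl_elems E) ?F" by (simp add: bij_betw_def)
  have iso: "poset_iso (poset (cl_elems E) cl_le) (poset ?F (\<subseteq>)) g"
    unfolding poset_iso_poset[OF partial_order_cl[OF order_refl] partial_order_subset]
    using bij ord by simp
  let ?f = "inv_into (cl_elems E) g"
  have "cl_rank (?f F) = face_rank conj_action F" if F: "F \<in> ?F" for F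
  proof -
    have f: "?f F \<in> cl_elems E" "g (?f F) = F"
      using bij F by (auto simp: bij_betw_def inv_into_into f_inv_into_f)
    obtain C p where C: "?f F = (C, acls C p)" "clustering E C" "bij p" using f(1) by (rule cl_elemsE)
    have "F = face E l C p" using f(2) g[OF C(2,3)] by (simp add: C(1))
    then show ?thesis using face_rank_face[OF E l C(2,3)] C(1) by simp
  qed
  then show ?thesis
    unfolding face_poset_def cluster_perm_poset using poset_iso_inv[OF iso] by auto
qed


section \<open>Tangent spaces of submanifolds\<close>

text \<open>\<open>Ck_on\<close> iterates \<open>frechet_derivative\<close> as a function, while
  formulas for the derivative hold on \<open>U\<close> only. Agreement on an open set passes to the
  derivatives and so through the recursion.\<close>

lemma Ck_on_cong:
  assumes U: "open U"
  shows "Ck_on k f U \<Longrightarrow> (\<And>x. x \<in> U \<Longrightarrow> f x = g x) \<Longrightarrow> Ck_on k g U"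
proof (induction k arbitrary: f g)
  case 0
  then show ?case using continuous_on_cong[of U U f g] by simp
next
  case (Suc k)
  have D: "(g has_derivative frechet_derivative f (at x)) (at x)" if x: "x \<in> U" for x
  proof (rule has_derivative_transform_within_open[OF _ U x Suc.prems(2)])
    show "(f has_derivative frechet_derivative f (at x)) (at x)"
      using Suc.prems(1) x by (simp add: frechet_derivative_works)
  qed
  have "g differentiable (at x)" if "x \<in> U" for x using D[OF that] by (rule differentiableI)
  moreover have "Ck_on k (\<lambda>x. frechet_derivative g (at x) v) U" for v
  proof (rule Suc.IH)
    show "Ck_on k (\<lambda>x. frechet_derivative f (at x) v) U" using Suc.prems(1) by simp
    fix x assume "x \<in> U"
    then show "frechet_derivative f (at x) v = frechet_derivative g (at x) v"
      using fun_cong[OF frechet_derivative_at[OF D], of x v] by simp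
  qed
  ultimately show ?case by simp
qed

text \<open>Along a line the derivative is again a function restricted to that line, namely the
  derivative of \<open>g\<close> in a fixed direction, so the chain rule fits the recursion.\<close>

lemma Ck_on_line:
  fixes g :: "'a::real_normed_vector \<Rightarrow> 'b::real_normed_vector"
  assumes I: "open I"
  shows "Ck_on k g U \<Longrightarrow> (\<And>s. s \<in> I \<Longrightarrow> y + s *\<^sub>R v \<in> U) \<Longrightarrow> Ck_on k (\<lambda>s::real. g (y + s *\<^sub>R v)) I"
proof (induction k arbitrary: g)
  case 0
  have "continuous_on I (\<lambda>s. y + s *\<^sub>R v)" by (intro continuous_intros)
  moreover have "continuous_on U g" using 0(1) by simp
  moreover have "(\<lambda>s. y + s *\<^sub>R v) ` I \<subseteq> U" using 0(2) by auto
  ultimately show ?case using continuous_on_compose2[of U g I "\<lambda>s. y + s *\<^sub>R v"] by simp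
next
  case (Suc k)
  have D: "((\<lambda>s. g (y + s *\<^sub>R v)) has_derivative (\<lambda>h. frechet_derivative g (at (y + s *\<^sub>R v)) (h *\<^sub>R v))) (at s)"
    if s: "s \<in> I" for s
  proof -
    have 1: "((\<lambda>s. y + s *\<^sub>R v) has_derivative (\<lambda>h. h *\<^sub>R v)) (at s)"
      by (auto intro!: derivative_eq_intros)
    have 2: "(g has_derivative frechet_derivative g (at (y + s *\<^sub>R v))) (at (y + s *\<^sub>R v))"
      using Suc.prems(1) Suc.prems(2)[OF s] by (simp add: frechet_derivative_works)
    show ?thesis using diff_chain_at[OF 1 2] by (simp add: o_def)
  qed
  have "(\<lambda>s. g (y + s *\<^sub>R v)) differentiable (at s)" if "s \<in> I" for s
    using D[OF that] by (rule differentiableI)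
  moreover have "Ck_on k (\<lambda>s. frechet_derivative (\<lambda>s. g (y + s *\<^sub>R v)) (at s) h) I" for h
  proof (rule Ck_on_cong[OF I])
    show "Ck_on k (\<lambda>s. frechet_derivative g (at (y + s *\<^sub>R v)) (h *\<^sub>R v)) I"
      by (rule Suc.IH[of "\<lambda>z. frechet_derivative g (at z) (h *\<^sub>R v)"]) (use Suc.prems in auto)
    fix s assume "s \<in> I"
    then show "frechet_derivative g (at (y + s *\<^sub>R v)) (h *\<^sub>R v) =
        frechet_derivative (\<lambda>s. g (y + s *\<^sub>R v)) (at s) h"
      using fun_cong[OF frechet_derivative_at[OF D], of s h] by simp
  qed
  ultimately show ?case by simp
qed

text \<open>Lines through \<open>f x\<close> in the slice are mapped by the inverse chart to smooth
  curves in \<open>X\<close>, so the image of \<open>L\<close> under the derivative of that chart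
  consists of velocities. The dimension is kept because the derivative of \<open>f\<close> undoes
  that map.\<close>

lemma tangent_space_contains_subspace:
  fixes X :: "'m::euclidean_space set"
  assumes X: "smooth_submanifold d X" and x: "x \<in> X"
  shows "\<exists>S. subspace S \<and> dim S = d \<and> S \<subseteq> tangent_space X x"
proof -
  have "\<exists>U U' f g. \<exists>L :: 'm set. open U \<and> x \<in> U \<and> open U' \<and>
        smooth_on f U \<and> smooth_on g U' \<and> homeomorphism U U' f g \<and>
        subspace L \<and> dim L = d \<and> f ` (X \<inter> U) = L \<inter> U'"
    using X x unfolding smooth_submanifold_def by (rule bspec)
  then obtain U U' f g and L :: "'m set" where U: "open U" "x \<in> U" and U': "open U'"
    and f: "smooth_on f U" and g: "smooth_on g U'" and hom: "homeomorphism U U' f g"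
    and L: "subspace L" "dim L = d" and fX: "f ` (X \<inter> U) = L \<inter> U'"
    by (elim exE conjE) (rule that; assumption)
  let ?y = "f x"
  have y: "?y \<in> U'" "?y \<in> L" using fX x U(2) by auto
  have gy: "g ?y = x" using homeomorphism_apply1[OF hom U(2)] .
  have "Ck_on (Suc 0) g U'" "Ck_on (Suc 0) f U" using f g by (simp_all only: smooth_on_def)
  then have gd: "g differentiable (at ?y)" and fd: "f differentiable (at x)" using y(1) U(2) by auto
  let ?D = "frechet_derivative g (at ?y)" and ?D' = "frechet_derivative f (at x)"
  have gD: "(g has_derivative ?D) (at ?y)" using gd by (simp add: frechet_derivative_works)
  have fD: "(f has_derivative ?D') (at (g ?y))" using fd by (simp add: gy frechet_derivative_works)
  have "((f \<circ> g) has_derivative (\<lambda>h. h)) (at ?y)"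
    by (rule has_derivative_transform_within_open[OF has_derivative_ident U' y(1)])
      (simp add: homeomorphism_apply2[OF hom])
  then have "?D' \<circ> ?D = (\<lambda>h. h)" using has_derivative_unique diff_chain_at[OF gD fD] by blast
  then have inv: "?D' (?D h) = h" for h by (metis comp_apply)
  have lin: "linear ?D" using gD by (rule has_derivative_linear)
  have "inj_on ?D (span L)" by (rule inj_on_inverseI[of _ ?D']) (rule inv)
  then have "dim (?D ` L) = d" using dim_image_eq[OF lin] L(2) by simp
  moreover have "subspace (?D ` L)" by (rule linear_subspace_image[OF lin L(1)])
  moreover have "?D v \<in> tangent_space X x" if v: "v \<in> L" for v
  proof -
    have o: "open ((\<lambda>s::real. ?y + s *\<^sub>R v) -` U')"
      by (rule open_vimage[OF U']) (intro continuous_intros)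
    have z: "0 \<in> (\<lambda>s::real. ?y + s *\<^sub>R v) -` U'" using y(1) by simp
    obtain e where e: "e > 0" "ball 0 e \<subseteq> (\<lambda>s::real. ?y + s *\<^sub>R v) -` U'"
      by (rule openE[OF o z])
    let ?I = "{-e<..<e}" and ?c = "\<lambda>s. g (?y + s *\<^sub>R v)"
    have I: "?y + s *\<^sub>R v \<in> U'" if s: "s \<in> ?I" for s
    proof -
      have "s \<in> ball 0 e" using s by (auto simp: dist_real_def)
      then have "s \<in> (\<lambda>s::real. ?y + s *\<^sub>R v) -` U'" by (rule subsetD[OF e(2)])
      then show ?thesis by simp
    qed
    have "smooth_on ?c ?I"
      unfolding smooth_on_def using g I Ck_on_line[OF open_greaterThanLessThan, of _ g U' "- e" e ?y v]
      by (simp add: smooth_on_def)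
    moreover have "?c ` ?I \<subseteq> X"
    proof (rule image_subsetI)
      fix s assume s: "s \<in> ?I"
      have "?y + s *\<^sub>R v \<in> L" using L(1) y(2) v by (intro subspace_add subspace_scale)
      then have "?y + s *\<^sub>R v \<in> f ` (X \<inter> U)" using I[OF s] fX by simp
      then obtain a where "a \<in> X" "a \<in> U" "?y + s *\<^sub>R v = f a" by auto
      then show "?c s \<in> X" using homeomorphism_apply1[OF hom] by simp
    qed
    moreover have "?c 0 = x" using gy by simp
    moreover have "(?c has_vector_derivative ?D v) (at 0)"
    proof -
      have 1: "((\<lambda>s::real. ?y + s *\<^sub>R v) has_derivative (\<lambda>h. h *\<^sub>R v)) (at 0)"
        by (auto intro!: derivative_eq_intros)
      have 2: "(g has_derivative ?D) (at (?y + 0 *\<^sub>R v))" using gD by simp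
      show ?thesis
        using diff_chain_at[OF 1 2] by (simp add: has_vector_derivative_def o_def linear_scale[OF lin])
    qed
    ultimately show ?thesis unfolding tangent_space_def using e(1) by blast
  qed
  ultimately show ?thesis by blast
qed


section \<open>The tangent representation at a diagonal matrix\<close>

definition zero_diag :: "'n::finite set set \<Rightarrow> (complex ^ 'n ^ 'n) set" where
  "zero_diag E = {A \<in> graph_matrices E. \<forall>i. A $ i $ i = 0}"

text \<open>At a diagonal matrix with one zero entry \<open>i\<close>, only the identity permutation and the factor \<open>i\<close>
  contribute to the derivative of the Leibniz expansion.\<close>

lemma tangent_zero_diagonal:
  fixes l :: "'n::finite \<Rightarrow> real"
  assumes l: "inj l" and p: "bij p" and I: "open I" "0 \<in> I" and c0: "c 0 = diagm l p"
    and c: "\<And>t. t \<in> I \<Longrightarrow> c t \<in> isospectral E l"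
    and comp: "\<And>a b. ((\<lambda>t::real. c t $ a $ b) has_vector_derivative v $ a $ b) (at 0)"
  shows "v $ i $ i = 0"
proof -
  \<comment> \<open>At this value the determinant vanishes along the whole curve, so its derivative
    at 0 is zero too.\<close>
  define z where "z = complex_of_real (l (p i))"
  let ?M = "\<lambda>t. mat z - c t"
  have M: "((\<lambda>t. ?M t $ a $ b) has_derivative (\<lambda>h. 0 - h *\<^sub>R v $ a $ b)) (at 0)" for a b
    using has_derivative_diff[OF has_derivative_const[of "mat z $ a $ b"] comp[of a b, unfolded has_vector_derivative_def]]
    by simp
  have "((\<lambda>t. det (?M t)) has_derivative (\<lambda>h. \<Sum>\<sigma>\<in>{\<sigma>. \<sigma> permutes UNIV}. of_int (sign \<sigma>) *
      (\<Sum>a\<in>UNIV. (0 - h *\<^sub>R v $ a $ \<sigma> a) * (\<Prod>b\<in>UNIV - {a}. ?M 0 $ b $ \<sigma> b)))) (at 0)"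
    unfolding det_def by (intro has_derivative_sum has_derivative_mult_right has_derivative_prod M)
  moreover have "((\<lambda>t. det (?M t)) has_derivative (\<lambda>h. 0)) (at 0)"
  proof (rule has_derivative_transform_within_open[OF has_derivative_const I])
    fix t assume "t \<in> I"
    then show "0 = det (?M t)" unfolding z_def using det_isospectral_eigenvalue[OF c] by simp
  qed
  ultimately have "(\<lambda>h::real. \<Sum>\<sigma>\<in>{\<sigma>. \<sigma> permutes UNIV}. of_int (sign \<sigma>) *
      (\<Sum>a\<in>UNIV. (0 - h *\<^sub>R v $ a $ \<sigma> a) * (\<Prod>b\<in>UNIV - {a}. ?M 0 $ b $ \<sigma> b))) = (\<lambda>h. 0)"
    by (rule has_derivative_unique)
  from fun_cong[OF this, of 1]
  have sum0: "(\<Sum>\<sigma>\<in>{\<sigma>. \<sigma> permutes UNIV}. of_int (sign \<sigma>) *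
      (\<Sum>a\<in>UNIV. (0 - 1 *\<^sub>R v $ a $ \<sigma> a) * (\<Prod>b\<in>UNIV - {a}. ?M 0 $ b $ \<sigma> b))) = 0" .
  define K where "K = (\<Prod>b\<in>UNIV - {i}. z - complex_of_real (l (p b)))"
  have M0: "?M 0 $ a $ b = (if a = b then z - complex_of_real (l (p a)) else 0)" for a b
    by (simp add: c0 mat_nth diagm_nth)
  have summand: "(0 - 1 *\<^sub>R v $ a $ \<sigma> a) * (\<Prod>b\<in>UNIV - {a}. ?M 0 $ b $ \<sigma> b) =
      (if a = i then (if \<sigma> = id then - v $ i $ i * K else 0) else 0)" if s: "\<sigma> permutes UNIV" for \<sigma> a
  proof (cases "\<sigma> = id \<and> a = i")
    case True
    then show ?thesis unfolding M0 by (simp add: K_def)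
  next
    case False
    have "\<exists>b. b \<noteq> a \<and> ?M 0 $ b $ \<sigma> b = 0"
    proof (cases "\<sigma> = id")
      case True
      then have "i \<noteq> a" using False by auto
      then show ?thesis using True by (intro exI[of _ i]) (simp only: M0, simp add: z_def)
    next
      case False
      have "\<exists>b. b \<noteq> a \<and> \<sigma> b \<noteq> b"
      proof (rule ccontr)
        assume "\<not> ?thesis"
        then have fixb: "\<And>b. b \<noteq> a \<Longrightarrow> \<sigma> b = b" by auto
        have "\<sigma> a = a"
        proof (rule ccontr)
          assume na: "\<sigma> a \<noteq> a"
          then have "\<sigma> (\<sigma> a) = \<sigma> a" by (rule fixb)
          then show False using na permutes_inj[OF s] by (auto dest: injD)
        qed
        then have "\<sigma> = id" using fixb by (intro ext) (metis id_apply)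
        then show False using \<open>\<sigma> \<noteq> id\<close> by simp
      qed
      then obtain b where "b \<noteq> a" "\<sigma> b \<noteq> b" by auto
      then show ?thesis by (intro exI[of _ b]) (simp only: M0, simp)
    qed
    then obtain b where b: "b \<noteq> a" "?M 0 $ b $ \<sigma> b = 0" by auto
    have "(\<Prod>b\<in>UNIV - {a}. ?M 0 $ b $ \<sigma> b) = 0"
      by (rule prod_zero) (use b in auto)
    then show ?thesis using False by auto
  qed
  let ?P = "{\<sigma>. \<sigma> permutes (UNIV :: 'n set)}" and ?w = "- v $ i $ i * K"
  have "0 = (\<Sum>\<sigma>\<in>?P. of_int (sign \<sigma>) *
      (\<Sum>a\<in>UNIV. (0 - 1 *\<^sub>R v $ a $ \<sigma> a) * (\<Prod>b\<in>UNIV - {a}. ?M 0 $ b $ \<sigma> b)))"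
    by (rule sum0[symmetric])
  also have "\<dots> = (\<Sum>\<sigma>\<in>?P. of_int (sign \<sigma>) * (\<Sum>a\<in>UNIV. if a = i then (if \<sigma> = id then ?w else 0) else 0))"
    by (rule sum.cong[OF refl], rule arg_cong2[where f = "(*)", OF refl], rule sum.cong[OF refl], rule summand, simp)
  also have "\<dots> = (\<Sum>\<sigma>\<in>?P. if \<sigma> = id then ?w else 0)"
  proof (rule sum.cong[OF refl])
    fix \<sigma> :: "'n \<Rightarrow> 'n"
    have "(\<Sum>a\<in>(UNIV :: 'n set). if a = i then (if \<sigma> = id then ?w else 0) else 0) = (if \<sigma> = id then ?w else 0)"
      by (subst sum.delta) simp_all
    then show "of_int (sign \<sigma>) * (\<Sum>a\<in>(UNIV :: 'n set). if a = i then (if \<sigma> = id then ?w else 0) else 0) =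
        (if \<sigma> = id then ?w else 0)"
      by (cases "\<sigma> = id") (simp_all only: if_True if_False simp_thms sign_id of_int_1 mult_1 mult_zero_right)
  qed
  also have "\<dots> = ?w"
    by (subst sum.delta) (simp_all add: finite_permutations permutes_id)
  finally have "?w = 0" by (rule sym)
  \<comment> \<open>The product of the differences to the other eigenvalues, nonzero by simplicity
    of the spectrum.\<close>
  moreover have "K \<noteq> 0"
  proof
    assume "K = 0"
    then obtain b where "b \<noteq> i" "l (p i) = l (p b)" by (auto simp: K_def z_def)
    then show False using l p by (auto simp: bij_def dest: injD)
  qed
  ultimately show ?thesis by simp
qed

lemma tangent_space_isospectral_subset:
  fixes l :: "'n::finite \<Rightarrow> real"
  assumes l: "inj l" and p: "bij p"
  shows "tangent_space (isospectral E l) (diagm l p) \<subseteq> zero_diag E"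
proof
  fix v assume "v \<in> tangent_space (isospectral E l) (diagm l p)"
  then obtain c e where e: "e > (0::real)" and c: "c ` {-e<..<e} \<subseteq> isospectral E l" "c 0 = diagm l p"
    and der: "(c has_vector_derivative v) (at 0)"
    unfolding tangent_space_def by blast
  let ?I = "{-e<..<e}"
  have I: "open ?I" "0 \<in> ?I" using e by auto
  have cI: "c t \<in> isospectral E l" if "t \<in> ?I" for t using c(1) that by blast
  have cG: "c t \<in> graph_matrices E" if "t \<in> ?I" for t using cI[OF that] by (simp add: isospectral_def)
  have bl: "bounded_linear (\<lambda>A :: complex ^ 'n ^ 'n. A $ a $ b)" for a b
    by (rule bounded_linear_compose[OF bounded_linear_vec_nth bounded_linear_vec_nth])
  have comp: "((\<lambda>t. c t $ a $ b) has_vector_derivative v $ a $ b) (at 0)" for a b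
    using bounded_linear.has_vector_derivative[OF bl der] .
  \<comment> \<open>Turns an identity valid along the curve near 0 into the same identity for the
    velocity; both defining conditions of \<open>graph_matrices\<close> are carried over in this
    way.\<close>
  have uniq: "x = y" if "(f has_vector_derivative x) (at 0)" "(g has_vector_derivative y) (at 0)"
    "\<And>t. t \<in> ?I \<Longrightarrow> f t = g t" for f g :: "real \<Rightarrow> complex" and x y
    using vector_derivative_unique_at[OF has_vector_derivative_transform_within_open[OF that(1) I that(3)] that(2)]
    by simp
  have "v $ a $ b = cnj (v $ b $ a)" for a b
  proof (rule uniq[OF comp])
    show "((\<lambda>t. cnj (c t $ b $ a)) has_vector_derivative cnj (v $ b $ a)) (at 0)"
      using bounded_linear.has_vector_derivative[OF bounded_linear_cnj comp] .
    fix t assume "t \<in> ?I"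
    then show "c t $ a $ b = cnj (c t $ b $ a)" using cG unfolding graph_matrices_def by blast
  qed
  moreover have "v $ a $ b = 0" if ab: "a \<noteq> b" "{a, b} \<notin> E" for a b
  proof (rule uniq[OF comp has_vector_derivative_const])
    fix t assume "t \<in> ?I"
    then show "c t $ a $ b = 0" using cG ab unfolding graph_matrices_def by blast
  qed
  moreover have "v $ i $ i = 0" for i by (rule tangent_zero_diagonal[OF l p I c(2) cI comp])
  ultimately show "v \<in> zero_diag E" unfolding zero_diag_def graph_matrices_def by blast
qed

lemma mat_eqI: "(\<And>a b. A $ a $ b = B $ a $ b) \<Longrightarrow> A = B"
  by (simp add: vec_eq_iff)

lemma zero_diagI:
  assumes 1: "\<And>a b. x $ a $ b = cnj (x $ b $ a)" and 2: "\<And>a b. {a, b} \<notin> E \<Longrightarrow> x $ a $ b = 0"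
    and 3: "\<And>a. x $ a $ a = 0"
  shows "x \<in> zero_diag E"
  unfolding zero_diag_def graph_matrices_def mem_Collect_eq
  by (intro conjI allI impI 1 3, elim conjE, rule 2)

lemma zero_diag_herm:
  assumes "x \<in> zero_diag E"
  shows "x $ a $ b = cnj (x $ b $ a)"
proof -
  have "\<forall>i j. x $ i $ j = cnj (x $ j $ i)"
    using assms unfolding zero_diag_def graph_matrices_def mem_Collect_eq by (elim conjE)
  then show ?thesis by (elim allE)
qed

lemma zero_diag_zero:
  assumes x: "x \<in> zero_diag E" and ab: "a = b \<or> {a, b} \<notin> E"
  shows "x $ a $ b = 0"
proof -
  note * = x[unfolded zero_diag_def graph_matrices_def mem_Collect_eq]
  note 1 = conjunct2[OF conjunct1[OF *]] and 2 = conjunct2[OF *]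
  show ?thesis
  proof (cases "a = b")
    case True
    then show ?thesis using 2 by simp
  next
    case False
    then show ?thesis using 1 ab by simp
  qed
qed

lemma zero_diag_nonzero: "x \<in> zero_diag E \<Longrightarrow> x $ a $ b \<noteq> 0 \<Longrightarrow> a \<noteq> b \<and> {a, b} \<in> E"
  using zero_diag_zero by metis

text \<open>For \<open>i \<noteq> j\<close> the two values of \<open>s\<close> give a real basis of
  the Hermitian matrices supported at the pair \<open>i\<close>, \<open>j\<close>. Reading off the
  \<open>(i, j)\<close> entry identifies this plane with the complex numbers and sends the basis to
  1 and \<open>\<i>\<close>.\<close>

definition edge_frame :: "'n::finite \<Rightarrow> 'n \<Rightarrow> bool \<Rightarrow> complex ^ 'n ^ 'n" where
  "edge_frame i j s = (\<chi> a b. if a = i \<and> b = j then (if s then 1 else \<i>)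
     else if a = j \<and> b = i then (if s then 1 else - \<i>) else 0)"

lemma edge_frame_nth: "edge_frame i j s $ a $ b = (if a = i \<and> b = j then (if s then 1 else \<i>)
     else if a = j \<and> b = i then (if s then 1 else - \<i>) else 0)"
  by (simp add: edge_frame_def)

lemma edge_frame_vals:
  "edge_frame i j s $ i $ j = (if s then 1 else \<i>)"
  "i \<noteq> j \<Longrightarrow> edge_frame i j s $ j $ i = (if s then 1 else - \<i>)"
  by (simp_all add: edge_frame_nth)

lemma pair_cases: "(a = i \<and> b = j) \<or> (a = j \<and> b = i) \<or> {a, b} \<noteq> {i, j}"
  by (metis doubleton_eq_iff)

lemma edge_frame_other:
  assumes "{a, b} \<noteq> {i, j}"
  shows "edge_frame i j s $ a $ b = 0"
proof -
  have "\<not> (a = i \<and> b = j)" "\<not> (a = j \<and> b = i)" using assms by auto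
  then show ?thesis by (simp add: edge_frame_nth)
qed

lemma edge_frame_expansion:
  assumes "i \<noteq> j" "x $ j $ i = cnj (x $ i $ j)"
  shows "(Re (x $ i $ j) *\<^sub>R edge_frame i j True + Im (x $ i $ j) *\<^sub>R edge_frame i j False) $ a $ b =
    (if {a, b} = {i, j} then x $ a $ b else 0)"
proof (cases "{a, b} = {i, j}")
  case True
  then consider "a = i" "b = j" | "a = j" "b = i" by (auto simp: doubleton_eq_iff)
  then show ?thesis using assms by cases (simp_all add: edge_frame_nth complex_eq_iff insert_commute)
next
  case False
  then show ?thesis by (simp add: edge_frame_other)
qed

lemma zero_diag_scale:
  assumes x: "x \<in> zero_diag E"
  shows "c *\<^sub>R x \<in> zero_diag E"
proof (rule zero_diagI)
  fix a b
  show "(c *\<^sub>R x) $ a $ b = cnj ((c *\<^sub>R x) $ b $ a)"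
    by (simp only: vector_scaleR_component complex_cnj_scaleR zero_diag_herm[OF x, of a b, symmetric])
next
  fix a b assume "{a, b} \<notin> E"
  then have "x $ a $ b = 0" by (intro zero_diag_zero[OF x] disjI2)
  then show "(c *\<^sub>R x) $ a $ b = 0" by simp
next
  fix a
  show "(c *\<^sub>R x) $ a $ a = 0" using zero_diag_zero[OF x, of a a] by simp
qed

lemma zero_diag_add:
  assumes x: "x \<in> zero_diag E" and y: "y \<in> zero_diag E"
  shows "x + y \<in> zero_diag E"
proof (rule zero_diagI)
  fix a b
  show "(x + y) $ a $ b = cnj ((x + y) $ b $ a)"
    by (simp only: vector_add_component complex_cnj_add zero_diag_herm[OF x, of a b, symmetric]
        zero_diag_herm[OF y, of a b, symmetric])
next
  fix a b assume nE: "{a, b} \<notin> E"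
  show "(x + y) $ a $ b = 0" using zero_diag_zero[OF x disjI2[OF nE]] zero_diag_zero[OF y disjI2[OF nE]] by simp
next
  fix a
  show "(x + y) $ a $ a = 0" using zero_diag_zero[OF x, of a a] zero_diag_zero[OF y, of a a] by simp
qed

lemma subspace_zero_diag: "subspace (zero_diag E)"
proof -
  have "0 \<in> zero_diag E" by (rule zero_diagI) simp_all
  then show ?thesis by (simp add: subspace_def zero_diag_scale zero_diag_add)
qed

lemma edge_frame_zero_diag:
  assumes "{i, j} \<in> E" "i \<noteq> j"
  shows "edge_frame i j s \<in> zero_diag E"
proof -
  have "edge_frame i j s $ a $ b = cnj (edge_frame i j s $ b $ a)" for a b
    unfolding edge_frame_nth using assms(2) by auto
  moreover have "edge_frame i j s $ a $ b = 0" if "{a, b} \<notin> E" for a b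
    using assms(1) that by (intro edge_frame_other) auto
  moreover have "edge_frame i j s $ a $ a = 0" for a
    using assms(2) by (intro edge_frame_other) auto
  ultimately show ?thesis by (intro zero_diagI)
qed

lemma edge_frame_inner:
  assumes "i \<noteq> j"
  shows "edge_frame i j True $ a $ b \<bullet> edge_frame i j False $ a $ b = 0"
  using pair_cases[of a i b j]
proof (elim disjE conjE)
  assume "a = i" "b = j"
  then show ?thesis by (simp add: edge_frame_vals inner_complex_def)
next
  assume "a = j" "b = i"
  then show ?thesis using assms by (simp add: edge_frame_vals inner_complex_def)
next
  assume "{a, b} \<noteq> {i, j}"
  then show ?thesis by (simp add: edge_frame_other)
qed

lemma orthogonal_family:
  fixes f :: "'i \<Rightarrow> 'a::euclidean_space"
  assumes nz: "\<And>x. x \<in> K \<Longrightarrow> f x \<noteq> 0"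
    and orth: "\<And>x y. x \<in> K \<Longrightarrow> y \<in> K \<Longrightarrow> x \<noteq> y \<Longrightarrow> orthogonal (f x) (f y)"
  shows "inj_on f K" "independent (f ` K)"
proof -
  show "inj_on f K"
  proof (rule inj_onI, rule ccontr)
    fix x y assume "x \<in> K" "y \<in> K" "f x = f y" "x \<noteq> y"
    then have "orthogonal (f x) (f x)" using orth by metis
    then show False using nz \<open>x \<in> K\<close> by (simp add: orthogonal_self)
  qed
  show "independent (f ` K)"
  proof (rule pairwise_orthogonal_independent)
    show "pairwise orthogonal (f ` K)" using orth by (auto simp: pairwise_def)
    show "0 \<notin> f ` K" using nz by auto
  qed
qed

text \<open>Weights are indexed by an initial segment of the natural numbers, so the edges are
  listed in that way, each with a chosen orientation.\<close>

definition edge_enum :: "'n set set \<Rightarrow> (nat \<Rightarrow> 'n) \<Rightarrow> (nat \<Rightarrow> 'n) \<Rightarrow> bool" where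
  "edge_enum E I J \<longleftrightarrow> (\<forall>k<card E. I k \<noteq> J k \<and> {I k, J k} \<in> E) \<and>
    (\<forall>k<card E. \<forall>k'<card E. {I k, J k} = {I k', J k'} \<longrightarrow> k = k') \<and>
    (\<forall>e\<in>E. \<exists>k<card E. e = {I k, J k})"

lemma edge_enum_edge:
  assumes "edge_enum E I J" "k < card E"
  shows "I k \<noteq> J k" "{I k, J k} \<in> E"
  using assms unfolding edge_enum_def by simp_all

lemma edge_enum_inj:
  assumes "edge_enum E I J" "k < card E" "k' < card E" "{I k, J k} = {I k', J k'}"
  shows "k = k'"
proof -
  have 2: "\<forall>k<card E. \<forall>k'<card E. {I k, J k} = {I k', J k'} \<longrightarrow> k = k'"
    using assms(1) unfolding edge_enum_def by (elim conjE)
  show ?thesis by (rule 2[rule_format, OF assms(2-4)])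
qed

lemma edge_enum_surj:
  assumes "edge_enum E I J" "e \<in> E"
  shows "\<exists>k<card E. e = {I k, J k}"
proof -
  have 3: "\<forall>e\<in>E. \<exists>k<card E. e = {I k, J k}"
    using assms(1) unfolding edge_enum_def by (elim conjE)
  show ?thesis by (rule 3[rule_format, OF assms(2)])
qed

lemma edge_enum_exists:
  fixes E :: "'n::finite set set"
  assumes "simple_graph E"
  shows "\<exists>I J. edge_enum E I J"
proof -
  obtain h where h: "bij_betw h {0..<card E} E" using ex_bij_betw_nat_finite[of E] by auto
  have hE: "h k \<in> E" if "k < card E" for k using h that by (auto simp: bij_betw_def)
  have "\<exists>ij. k < card E \<longrightarrow> h k = {fst ij, snd ij} \<and> fst ij \<noteq> snd ij" for k
  proof (cases "k < card E")
    case True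
    obtain x y where "h k = {x, y}" "x \<noteq> y" by (rule simple_graph_edgeE[OF assms hE[OF True]])
    then show ?thesis by (intro exI[of _ "(x, y)"]) simp
  qed simp
  then have "\<forall>k. \<exists>ij. k < card E \<longrightarrow> h k = {fst ij, snd ij} \<and> fst ij \<noteq> snd ij" by simp
  from choice[OF this] obtain ij
    where ij: "\<forall>k. k < card E \<longrightarrow> h k = {fst (ij k), snd (ij k)} \<and> fst (ij k) \<noteq> snd (ij k)" by (rule exE)
  have "edge_enum E (\<lambda>k. fst (ij k)) (\<lambda>k. snd (ij k))"
    unfolding edge_enum_def
  proof (intro conjI allI impI ballI)
    fix k assume k: "k < card E"
    show "fst (ij k) \<noteq> snd (ij k)" using ij k by simp
    have "h k = {fst (ij k), snd (ij k)}" using ij k by simp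
    then show "{fst (ij k), snd (ij k)} \<in> E" using hE[OF k] by simp
  next
    fix k k' assume k: "k < card E" "k' < card E" "{fst (ij k), snd (ij k)} = {fst (ij k'), snd (ij k')}"
    have "h k = {fst (ij k), snd (ij k)}" "h k' = {fst (ij k'), snd (ij k')}" using ij k(1,2) by simp_all
    then have "h k = h k'" using k(3) by simp
    then show "k = k'" using h k(1,2) by (auto simp: bij_betw_def inj_on_def)
  next
    fix e assume "e \<in> E"
    then have "e \<in> h ` {0..<card E}" using h by (simp add: bij_betw_def)
    then obtain k where k: "k < card E" "e = h k" by auto
    then have "h k = {fst (ij k), snd (ij k)}" using ij by simp
    then show "\<exists>k<card E. e = {fst (ij k), snd (ij k)}" using k by blast
  qed
  then show ?thesis by blast
qed

text \<open>Frames of different edges have disjoint supports, and at one edge the entries 1 and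
  \<plusminus>\<i> are orthogonal as real vectors; so orthogonality holds entry by entry.\<close>

lemma edge_frame_basis:
  fixes E :: "'n::finite set set"
  assumes IJ: "edge_enum E I J"
  defines "B \<equiv> (\<lambda>k. edge_frame (I k) (J k) True) ` {..<card E} \<union> (\<lambda>k. edge_frame (I k) (J k) False) ` {..<card E}"
  shows "card B = 2 * card E" "independent B" "span B = zero_diag E"
proof -
  let ?K = "{..<card E} \<times> (UNIV :: bool set)"
  let ?f = "\<lambda>(k, s). edge_frame (I k) (J k) s"
  note ne = edge_enum_edge[OF IJ]
  note inj = edge_enum_inj[OF IJ]
  have B: "B = ?f ` ?K"
  proof (intro subset_antisym)
    show "B \<subseteq> ?f ` ?K"
      unfolding B_def
    proof (intro Un_least image_subsetI)
      fix k assume k: "k \<in> {..<card E}"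
      show "edge_frame (I k) (J k) True \<in> ?f ` ?K" by (rule image_eqI[of _ ?f "(k, True)"]) (use k in auto)
      show "edge_frame (I k) (J k) False \<in> ?f ` ?K" by (rule image_eqI[of _ ?f "(k, False)"]) (use k in auto)
    qed
    show "?f ` ?K \<subseteq> B"
    proof (rule image_subsetI)
      fix x assume "x \<in> ?K"
      then obtain k s where "x = (k, s)" "k \<in> {..<card E}" by auto
      then show "?f x \<in> B" by (cases s) (simp_all add: B_def)
    qed
  qed
  have nz: "?f x \<noteq> 0" if "x \<in> ?K" for x
  proof
    assume "?f x = 0"
    then have "edge_frame (I (fst x)) (J (fst x)) (snd x) $ I (fst x) $ J (fst x) = 0"
      by (simp add: case_prod_beta)
    then show False by (simp add: edge_frame_nth split: if_splits)
  qed
  have inner0: "edge_frame (I k) (J k) s $ a $ b \<bullet> edge_frame (I k') (J k') s' $ a $ b = 0"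
    if k: "k < card E" "k' < card E" "(k, s) \<noteq> (k', s')" for k k' s s' a b
  proof (cases "k = k'")
    case True
    then have "s = True \<and> s' = False \<or> s = False \<and> s' = True" using k(3) by (cases s; cases s') simp_all
    then show ?thesis
      unfolding True using edge_frame_inner[OF ne(1)[OF k(2)], of a b] by (elim disjE conjE) (simp_all add: inner_commute)
  next
    case False
    have "{I k, J k} \<noteq> {I k', J k'}"
    proof
      assume "{I k, J k} = {I k', J k'}"
      then have "k = k'" by (rule inj[OF k(1,2)])
      then show False using False by simp
    qed
    then have "{a, b} \<noteq> {I k, J k} \<or> {a, b} \<noteq> {I k', J k'}" by metis
    then show ?thesis
    proof
      assume "{a, b} \<noteq> {I k, J k}"
      then have "edge_frame (I k) (J k) s $ a $ b = 0" by (rule edge_frame_other)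
      then show ?thesis by simp
    next
      assume "{a, b} \<noteq> {I k', J k'}"
      then have "edge_frame (I k') (J k') s' $ a $ b = 0" by (rule edge_frame_other)
      then show ?thesis by simp
    qed
  qed
  have orth: "orthogonal (?f x) (?f y)" if xy: "x \<in> ?K" "y \<in> ?K" "x \<noteq> y" for x y
  proof -
    have "edge_frame (I (fst x)) (J (fst x)) (snd x) $ a $ b \<bullet> edge_frame (I (fst y)) (J (fst y)) (snd y) $ a $ b = 0"
      for a b by (rule inner0) (use xy in auto)
    then show ?thesis by (simp add: orthogonal_def inner_vec_def case_prod_beta)
  qed
  note fam = orthogonal_family[of ?K ?f, OF nz orth]
  show "independent B" using fam(2) by (simp add: B)
  have "card B = card ?K" unfolding B by (rule card_image[OF fam(1)])
  then show "card B = 2 * card E" by (simp add: card_cartesian_product)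
  show "span B = zero_diag E"
  proof (intro subset_antisym span_minimal subspace_zero_diag)
    show "B \<subseteq> zero_diag E"
      unfolding B_def by (intro Un_least image_subsetI) (simp_all add: edge_frame_zero_diag ne)
    show "zero_diag E \<subseteq> span B"
    proof
      fix x assume x: "x \<in> zero_diag E"
      note herm = zero_diag_herm[OF x]
      \<comment> \<open>The entry at \<open>(I k, J k)\<close> alone gives both coefficients; the
        opposite entry then comes out right by Hermitian symmetry.\<close>
      let ?t = "\<lambda>k. Re (x $ I k $ J k) *\<^sub>R edge_frame (I k) (J k) True + Im (x $ I k $ J k) *\<^sub>R edge_frame (I k) (J k) False"
      have "(\<Sum>k<card E. ?t k) $ a $ b = x $ a $ b" for a b
      proof -
        have "(\<Sum>k<card E. ?t k) $ a $ b = (\<Sum>k<card E. ?t k $ a $ b)" by (simp only: sum_component)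
        also have "\<dots> = (\<Sum>k<card E. if {a, b} = {I k, J k} then x $ a $ b else 0)"
          by (rule sum.cong[OF refl]) (rule edge_frame_expansion[OF ne(1) herm], simp)
        also have "\<dots> = x $ a $ b"
        proof (cases "{a, b} \<in> E")
          case True
          then obtain k0 where k0: "k0 < card E" "{a, b} = {I k0, J k0}"
            using edge_enum_surj[OF IJ True] by (elim exE conjE) (rule that; assumption)
          have "(\<Sum>k<card E. if {a, b} = {I k, J k} then x $ a $ b else 0) =
              (\<Sum>k<card E. if k = k0 then x $ a $ b else 0)"
          proof (rule sum.cong[OF refl])
            fix k assume "k \<in> {..<card E}"
            then have "k < card E" by simp
            then have "{a, b} = {I k, J k} \<longleftrightarrow> k = k0"
              unfolding k0(2) using inj[OF k0(1), of k] by metis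
            then show "(if {a, b} = {I k, J k} then x $ a $ b else 0) = (if k = k0 then x $ a $ b else 0)" by simp
          qed
          then show ?thesis using k0(1) by simp
        next
          case False
          then have z: "x $ a $ b = 0" by (intro zero_diag_zero[OF x] disjI2)
          show ?thesis unfolding z by simp
        qed
        finally show ?thesis .
      qed
      then have "x = (\<Sum>k<card E. ?t k)" by (intro mat_eqI) (rule sym)
      also have "\<dots> \<in> span B"
        by (intro span_sum span_add span_scale span_base) (auto simp: B_def)
      finally show "x \<in> span B" .
    qed
  qed
qed

lemma tangent_space_isospectral:
  fixes l :: "'n::finite \<Rightarrow> real"
  assumes E: "simple_graph E" and gen: "generic E l" and p: "bij p"
  shows "tangent_space (isospectral E l) (diagm l p) = zero_diag E"
proof -
  have l: "inj l" and X: "smooth_submanifold (2 * card E) (isospectral E l)"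
    using gen by (simp_all add: generic_def)
  obtain S where S: "subspace S" "dim S = 2 * card E" "S \<subseteq> tangent_space (isospectral E l) (diagm l p)"
    using tangent_space_contains_subspace[OF X diagm_isospectral[OF p]]
    by (elim exE conjE) (rule that; assumption)
  note T = tangent_space_isospectral_subset[OF l p, of E]
  obtain I J where "edge_enum E I J" using edge_enum_exists[OF E] by blast
  note B = edge_frame_basis[OF this]
  have "dim (zero_diag E) = 2 * card E"
    using dim_span_eq_card_independent[OF B(2)] B(1,3) by simp
  then have "S = zero_diag E"
    using S T by (intro subspace_dim_equal subspace_zero_diag) auto
  then show ?thesis using S(3) T by (intro subset_antisym) simp_all
qed


section \<open>Weights\<close>

definition edge_weight :: "'n \<Rightarrow> 'n \<Rightarrow> 'n \<Rightarrow> int" where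
  "edge_weight i j = (\<lambda>a. if a = i then 1 else if a = j then - 1 else 0)"

lemma character_edge_weight:
  assumes "i \<noteq> j"
  shows "character (edge_weight i j) t = t $ i * inverse (t $ j)"
proof -
  have "character (edge_weight i j) t = (\<Prod>a\<in>{i, j}. (t $ a) powi (edge_weight i j a))"
    unfolding character_def by (rule prod.mono_neutral_right) (auto simp: edge_weight_def)
  then show ?thesis using assms by (simp add: edge_weight_def power_int_minus)
qed

lemma inverse_cnj: "norm w = 1 \<Longrightarrow> inverse w = cnj w" for w :: complex
  by (rule inverse_unique) (simp add: complex_norm_square[symmetric])

lemma linear_conj_action: "linear (conj_action t)"
  by (rule linearI) (simp_all add: vec_eq_iff conj_action_nth algebra_simps)

lemma frechet_conj_action: "frechet_derivative (conj_action t) (at x) = conj_action t"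
proof -
  have "(conj_action t has_derivative conj_action t) (at x)"
    by (rule bounded_linear_imp_has_derivative, rule linear_conv_bounded_linear[THEN iffD1], rule linear_conj_action)
  then show ?thesis by (rule frechet_derivative_at[symmetric])
qed

text \<open>Conjugation multiplies the \<open>(i, j)\<close> entry by \<open>z\<close> and the
  \<open>(j, i)\<close> entry by its conjugate, as torus coordinates have norm 1. In terms of the
  \<open>(i, j)\<close> entry this is multiplication by \<open>z\<close> on the complex numbers with
  basis 1, \<open>\<i>\<close>.\<close>

lemma conj_action_edge_frame:
  assumes t: "t \<in> torus" and ij: "i \<noteq> j"
  defines "z \<equiv> t $ i * inverse (t $ j)"
  shows "conj_action t (edge_frame i j True) = Re z *\<^sub>R edge_frame i j True + Im z *\<^sub>R edge_frame i j False"
    "conj_action t (edge_frame i j False) = - Im z *\<^sub>R edge_frame i j True + Re z *\<^sub>R edge_frame i j False"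
proof -
  have n: "norm (t $ a) = 1" for a using t by (simp add: torus_def)
  have zc: "t $ j * inverse (t $ i) = cnj z" using n by (simp add: z_def inverse_cnj)
  have z: "t $ i * inverse (t $ j) = z" by (simp add: z_def)
  have entries: "conj_action t A $ i $ j = z * A $ i $ j" "conj_action t A $ j $ i = cnj z * A $ j $ i" for A
    by (simp_all only: conj_action_nth z zc)
  note vals = edge_frame_vals(1)[of i j] edge_frame_vals(2)[OF ij]
  show "conj_action t (edge_frame i j True) = Re z *\<^sub>R edge_frame i j True + Im z *\<^sub>R edge_frame i j False"
  proof (rule mat_eqI)
    fix a b
    show "conj_action t (edge_frame i j True) $ a $ b =
        (Re z *\<^sub>R edge_frame i j True + Im z *\<^sub>R edge_frame i j False) $ a $ b"
      using pair_cases[of a i b j]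
    proof (elim disjE conjE)
      assume ab: "a = i" "b = j"
      show ?thesis unfolding ab entries vector_add_component vector_scaleR_component vals
        by (simp add: complex_eq_iff)
    next
      assume ab: "a = j" "b = i"
      show ?thesis unfolding ab entries vector_add_component vector_scaleR_component vals
        by (simp add: complex_eq_iff)
    next
      assume "{a, b} \<noteq> {i, j}"
      then show ?thesis by (simp add: conj_action_nth edge_frame_other)
    qed
  qed
  show "conj_action t (edge_frame i j False) = - Im z *\<^sub>R edge_frame i j True + Re z *\<^sub>R edge_frame i j False"
  proof (rule mat_eqI)
    fix a b
    show "conj_action t (edge_frame i j False) $ a $ b =
        (- Im z *\<^sub>R edge_frame i j True + Re z *\<^sub>R edge_frame i j False) $ a $ b"
      using pair_cases[of a i b j]
    proof (elim disjE conjE)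
      assume ab: "a = i" "b = j"
      show ?thesis unfolding ab entries vector_add_component vector_scaleR_component vals
        by (simp add: complex_eq_iff)
    next
      assume ab: "a = j" "b = i"
      show ?thesis unfolding ab entries vector_add_component vector_scaleR_component vals
        by (simp add: complex_eq_iff)
    next
      assume "{a, b} \<noteq> {i, j}"
      then show ?thesis by (simp add: conj_action_nth edge_frame_other)
    qed
  qed
qed

lemma tangent_weights_exist:
  fixes l :: "'n::finite \<Rightarrow> real"
  assumes E: "simple_graph E" and gen: "generic E l" and p: "bij p"
  shows "\<exists>\<alpha>. tangent_weights conj_action (isospectral E l) (card E) (diagm l p) \<alpha>"
proof -
  obtain I J where IJ: "edge_enum E I J" using edge_enum_exists[OF E] by blast
  note B = edge_frame_basis[OF IJ]
  have ne: "I k \<noteq> J k" if "k < card E" for k using edge_enum_edge(1)[OF IJ that] .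
  have "tangent_weights conj_action (isospectral E l) (card E) (diagm l p) (\<lambda>k. edge_weight (I k) (J k))"
    unfolding tangent_weights_def Let_def frechet_conj_action tangent_space_isospectral[OF E gen p]
  proof (rule exI[of _ "\<lambda>k. edge_frame (I k) (J k) True"], rule exI[of _ "\<lambda>k. edge_frame (I k) (J k) False"],
      intro conjI ballI allI impI B)
    fix t :: "complex ^ 'n" and k assume t: "t \<in> torus" and k: "k < card E"
    note * = conj_action_edge_frame[OF t ne[OF k], folded character_edge_weight[OF ne[OF k]]]
    show "conj_action t (edge_frame (I k) (J k) True) =
        Re (character (edge_weight (I k) (J k)) t) *\<^sub>R edge_frame (I k) (J k) True +
        Im (character (edge_weight (I k) (J k)) t) *\<^sub>R edge_frame (I k) (J k) False" by (rule *(1))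
    show "conj_action t (edge_frame (I k) (J k) False) =
        - Im (character (edge_weight (I k) (J k)) t) *\<^sub>R edge_frame (I k) (J k) True +
        Re (character (edge_weight (I k) (J k)) t) *\<^sub>R edge_frame (I k) (J k) False" by (rule *(2))
  qed
  then show ?thesis by blast
qed

text \<open>Rotating a single coordinate isolates one exponent of a character.\<close>

lemma character_single:
  "character \<alpha> (\<chi> a. if a = c then cis s else 1) = cis (of_int (\<alpha> c) * s)"
proof -
  have "character \<alpha> (\<chi> a. if a = c then cis s else 1) = (\<Prod>a\<in>{c}. (cis s) powi (\<alpha> a))"
    unfolding character_def by (rule prod.mono_neutral_cong_right) auto
  then show ?thesis by (simp add: cis_power_int)
qed

text \<open>If the \<open>(a, b)\<close> entry of one of the two vectors is nonzero, a combination of the two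
  entries with coefficients \<open>1, \<plusminus>\<i>\<close> is an eigenvector for both characters.\<close>

lemma weight_of_entry:
  fixes u w :: "complex ^ 'n::finite ^ 'n"
  assumes eqs: "\<And>t. t \<in> torus \<Longrightarrow> conj_action t u = Re (character \<alpha> t) *\<^sub>R u + Im (character \<alpha> t) *\<^sub>R w"
    "\<And>t. t \<in> torus \<Longrightarrow> conj_action t w = - Im (character \<alpha> t) *\<^sub>R u + Re (character \<alpha> t) *\<^sub>R w"
    and ab: "a \<noteq> b" and nz: "u $ a $ b \<noteq> 0 \<or> w $ a $ b \<noteq> 0"
  shows "\<alpha> = edge_weight a b \<or> \<alpha> = (\<lambda>c. - edge_weight a b c)"
proof -
  let ?P = "u $ a $ b" and ?Q = "w $ a $ b"
  let ?x = "\<lambda>t. complex_of_real (Re (character \<alpha> t))" and ?y = "\<lambda>t. complex_of_real (Im (character \<alpha> t))"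
  have e: "(t $ a * inverse (t $ b)) * ?P = ?x t * ?P + ?y t * ?Q"
    "(t $ a * inverse (t $ b)) * ?Q = ?x t * ?Q - ?y t * ?P" if t: "t \<in> torus" for t
  proof -
    have "conj_action t u $ a $ b = (Re (character \<alpha> t) *\<^sub>R u + Im (character \<alpha> t) *\<^sub>R w) $ a $ b"
      "conj_action t w $ a $ b = (- Im (character \<alpha> t) *\<^sub>R u + Re (character \<alpha> t) *\<^sub>R w) $ a $ b"
      using eqs[OF t] by simp_all
    then have "(t $ a * inverse (t $ b)) * ?P = Re (character \<alpha> t) *\<^sub>R ?P + Im (character \<alpha> t) *\<^sub>R ?Q"
      "(t $ a * inverse (t $ b)) * ?Q = - Im (character \<alpha> t) *\<^sub>R ?P + Re (character \<alpha> t) *\<^sub>R ?Q"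
      by (simp_all only: conj_action_nth vector_add_component vector_scaleR_component)
    then show "(t $ a * inverse (t $ b)) * ?P = ?x t * ?P + ?y t * ?Q"
      "(t $ a * inverse (t $ b)) * ?Q = ?x t * ?Q - ?y t * ?P"
      by (simp_all add: scaleR_conv_of_real)
  qed
  have torus_t: "(\<chi> a. if a = c then cis s else 1) \<in> torus" for c :: 'n and s
    by (simp add: torus_def)
  have chi: "(\<chi> a. if a = c then cis s else 1) $ a * inverse ((\<chi> a. if a = c then cis s else 1) $ b) =
      cis (of_int (edge_weight a b c) * s)" for c :: 'n and s
    unfolding character_edge_weight[OF ab, symmetric] by (rule character_single)
  have "?P - \<i> * ?Q \<noteq> 0 \<or> ?P + \<i> * ?Q \<noteq> 0"
  proof (rule ccontr)
    assume "\<not> ?thesis"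
    then have "?P - \<i> * ?Q = 0" "?P + \<i> * ?Q = 0" by auto
    then have "2 * ?P = 0" "2 * \<i> * ?Q = 0" by algebra+
    then show False using nz by simp
  qed
  then show ?thesis
  proof
    assume nz1: "?P - \<i> * ?Q \<noteq> 0"
    have eq: "t $ a * inverse (t $ b) = character \<alpha> t" if t: "t \<in> torus" for t
    proof -
      have "(t $ a * inverse (t $ b)) * (?P - \<i> * ?Q) =
          (t $ a * inverse (t $ b)) * ?P - \<i> * ((t $ a * inverse (t $ b)) * ?Q)"
        by (simp only: right_diff_distrib mult.left_commute)
      also have "\<dots> = (?x t + \<i> * ?y t) * (?P - \<i> * ?Q)"
        unfolding e[OF t] by (simp add: algebra_simps)
      finally have "t $ a * inverse (t $ b) = ?x t + \<i> * ?y t"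
        by (rule mult_right_cancel[OF nz1, THEN iffD1])
      also have "\<dots> = character \<alpha> t" by (rule complex_eq[symmetric])
      finally show ?thesis .
    qed
    \<comment> \<open>Equality on the torus is tested on rotations of the single coordinate
      \<open>c\<close>, one exponent at a time.\<close>
    have "cis (s * real_of_int (\<alpha> c)) = cis (s * real_of_int (edge_weight a b c))" for s c
      using eq[OF torus_t, of c s] unfolding chi character_single by (simp add: mult.commute)
    then have "real_of_int (\<alpha> c) = real_of_int (edge_weight a b c)" for c by (rule cis_mult_eq_imp_eq)
    then show ?thesis by (intro disjI1 ext) simp
  next
    assume nz2: "?P + \<i> * ?Q \<noteq> 0"
    have eq: "t $ a * inverse (t $ b) = cnj (character \<alpha> t)" if t: "t \<in> torus" for t
    proof -
      have "(t $ a * inverse (t $ b)) * (?P + \<i> * ?Q) =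
          (t $ a * inverse (t $ b)) * ?P + \<i> * ((t $ a * inverse (t $ b)) * ?Q)"
        by (simp only: distrib_left mult.left_commute)
      also have "\<dots> = (?x t - \<i> * ?y t) * (?P + \<i> * ?Q)"
        unfolding e[OF t] by (simp add: algebra_simps)
      finally have "t $ a * inverse (t $ b) = ?x t - \<i> * ?y t"
        by (rule mult_right_cancel[OF nz2, THEN iffD1])
      also have "\<dots> = cnj (?x t + \<i> * ?y t)" by simp
      also have "?x t + \<i> * ?y t = character \<alpha> t" by (rule complex_eq[symmetric])
      finally show ?thesis .
    qed
    have "cis (s * real_of_int (\<alpha> c)) = cis (s * real_of_int (- edge_weight a b c))" for s c
    proof -
      have "cis (of_int (edge_weight a b c) * s) = cnj (cis (of_int (\<alpha> c) * s))"
        using eq[OF torus_t, of c s] unfolding chi character_single .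
      then have "cnj (cis (of_int (edge_weight a b c) * s)) = cis (of_int (\<alpha> c) * s)" by simp
      then show ?thesis by (simp add: cis_cnj mult.commute)
    qed
    then have "real_of_int (\<alpha> c) = real_of_int (- edge_weight a b c)" for c by (rule cis_mult_eq_imp_eq)
    then show ?thesis by (intro disjI2 ext) (simp only: of_int_eq_iff)
  qed
qed

text \<open>The support of the exponent vector is the edge, whatever the sign.\<close>

lemma edge_weight_eq_imp:
  assumes "a \<noteq> b" "c \<noteq> d"
    and "edge_weight a b = edge_weight c d \<or> edge_weight a b = (\<lambda>x. - edge_weight c d x)"
  shows "{a, b} = {c, d}"
proof -
  have supp: "{x. edge_weight i j x \<noteq> 0} = {i, j}" for i j :: 'a by (auto simp: edge_weight_def)
  have "{x. edge_weight a b x \<noteq> 0} = {x. edge_weight c d x \<noteq> 0}" using assms(3) by (elim disjE) simp_all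
  then show ?thesis by (simp only: supp)
qed

lemma tangent_weightsE:
  assumes "tangent_weights act X m x \<alpha>"
  obtains u w where "card (u ` {..<m} \<union> w ` {..<m}) = 2 * m" "independent (u ` {..<m} \<union> w ` {..<m})"
    "span (u ` {..<m} \<union> w ` {..<m}) = tangent_space X x"
    "\<forall>t\<in>torus. \<forall>k<m.
      frechet_derivative (act t) (at x) (u k) = Re (character (\<alpha> k) t) *\<^sub>R u k + Im (character (\<alpha> k) t) *\<^sub>R w k \<and>
      frechet_derivative (act t) (at x) (w k) = - Im (character (\<alpha> k) t) *\<^sub>R u k + Re (character (\<alpha> k) t) *\<^sub>R w k"
  using assms unfolding tangent_weights_def Let_def by (elim exE conjE) (rule that)

text \<open>Two different indices cannot belong to the same edge, since the space of Hermitian matrices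
  supported at one edge has real dimension 2.\<close>

lemma weights_are_edges:
  fixes l :: "'n::finite \<Rightarrow> real"
  assumes E: "simple_graph E" and gen: "generic E l" and p: "bij p"
    and \<alpha>: "tangent_weights conj_action (isospectral E l) (card E) (diagm l p) \<alpha>"
  shows "\<exists>I J. (\<forall>k<card E. {I k, J k} \<in> E \<and> I k \<noteq> J k \<and>
      (\<alpha> k = edge_weight (I k) (J k) \<or> \<alpha> k = (\<lambda>c. - edge_weight (I k) (J k) c))) \<and>
    (\<forall>k<card E. \<forall>k'<card E. {I k, J k} = {I k', J k'} \<longrightarrow> k = k')"
proof -
  let ?m = "card E"
  obtain u w where B: "card (u ` {..<?m} \<union> w ` {..<?m}) = 2 * ?m" "independent (u ` {..<?m} \<union> w ` {..<?m})"
    "span (u ` {..<?m} \<union> w ` {..<?m}) = tangent_space (isospectral E l) (diagm l p)"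
    and uw0: "\<forall>t\<in>torus. \<forall>k<?m.
      frechet_derivative (conj_action t) (at (diagm l p)) (u k) =
        Re (character (\<alpha> k) t) *\<^sub>R u k + Im (character (\<alpha> k) t) *\<^sub>R w k \<and>
      frechet_derivative (conj_action t) (at (diagm l p)) (w k) =
        - Im (character (\<alpha> k) t) *\<^sub>R u k + Re (character (\<alpha> k) t) *\<^sub>R w k"
    by (rule tangent_weightsE[OF \<alpha>])
  note B = B[unfolded tangent_space_isospectral[OF E gen p]]
    and uw0 = uw0[unfolded frechet_conj_action]
  note uw0 = mp[OF spec[OF bspec[OF uw0]]]
  have uw1: "conj_action t (u k) = Re (character (\<alpha> k) t) *\<^sub>R u k + Im (character (\<alpha> k) t) *\<^sub>R w k"
    if "t \<in> torus" "k < ?m" for t k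
    by (rule conjunct1[OF uw0[OF that]])
  have uw2: "conj_action t (w k) = - Im (character (\<alpha> k) t) *\<^sub>R u k + Re (character (\<alpha> k) t) *\<^sub>R w k"
    if "t \<in> torus" "k < ?m" for t k
    by (rule conjunct2[OF uw0[OF that]])
  let ?B = "u ` {..<?m} \<union> w ` {..<?m}"
  have uZ: "u k \<in> zero_diag E" and wZ: "w k \<in> zero_diag E" if "k < ?m" for k
    using that span_superset[of ?B] unfolding B(3) by auto
  have ne_entry: "a \<noteq> b \<and> {a, b} \<in> E" if k: "k < ?m" and nz: "u k $ a $ b \<noteq> 0 \<or> w k $ a $ b \<noteq> 0" for k a b
    using nz zero_diag_nonzero[OF uZ[OF k]] zero_diag_nonzero[OF wZ[OF k]] by (elim disjE) simp_all
  have entry: "\<alpha> k = edge_weight a b \<or> \<alpha> k = (\<lambda>c. - edge_weight a b c)"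
    if k: "k < ?m" and nz: "u k $ a $ b \<noteq> 0 \<or> w k $ a $ b \<noteq> 0" for k a b
    by (rule weight_of_entry[of "u k" "\<alpha> k" "w k", OF uw1[OF _ k] uw2[OF _ k] _ nz])
      (use ne_entry[OF k nz] in auto)
  \<comment> \<open>Members of an independent set are nonzero, so some entry of \<open>u k\<close>
    is; its position is the edge assigned to \<open>k\<close>.\<close>
  have "\<exists>ab. k < ?m \<longrightarrow> u k $ fst ab $ snd ab \<noteq> 0" for k
  proof (cases "k < ?m")
    case True
    have "u k \<noteq> 0"
    proof
      assume "u k = 0"
      then have "0 \<in> ?B" using True by (metis UnI1 imageI lessThan_iff)
      then show False using dependent_zero[of ?B] B(2) by simp
    qed
    then obtain a b where "u k $ a $ b \<noteq> 0" by (auto simp: vec_eq_iff)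
    then show ?thesis by (intro exI[of _ "(a, b)"]) simp
  qed simp
  then have "\<forall>k. \<exists>ab. k < ?m \<longrightarrow> u k $ fst ab $ snd ab \<noteq> 0" by simp
  from choice[OF this] obtain ab where ab: "\<forall>k. k < ?m \<longrightarrow> u k $ fst (ab k) $ snd (ab k) \<noteq> 0" by (rule exE)
  let ?I = "\<lambda>k. fst (ab k)" and ?J = "\<lambda>k. snd (ab k)"
  have edge: "?I k \<noteq> ?J k" "{?I k, ?J k} \<in> E" if "k < ?m" for k
    using ne_entry[OF that, of "?I k" "?J k"] ab that by simp_all
  have weight: "\<alpha> k = edge_weight (?I k) (?J k) \<or> \<alpha> k = (\<lambda>c. - edge_weight (?I k) (?J k) c)" if "k < ?m" for k
    using entry[OF that] ab that by simp
  \<comment> \<open>Each nonzero entry of \<open>u k\<close> or \<open>w k\<close> determines the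
    weight up to sign, and the weight determines the edge; so both vectors live on a single
    edge.\<close>
  have support: "{a, b} = {?I k, ?J k}" if k: "k < ?m" and nz: "u k $ a $ b \<noteq> 0 \<or> w k $ a $ b \<noteq> 0" for k a b
  proof (rule edge_weight_eq_imp)
    show "a \<noteq> b" using ne_entry[OF k nz] by simp
    show "?I k \<noteq> ?J k" by (rule edge(1)[OF k])
    show "edge_weight a b = edge_weight (?I k) (?J k) \<or> edge_weight a b = (\<lambda>x. - edge_weight (?I k) (?J k) x)"
      using entry[OF k nz] weight[OF k] by (auto simp: fun_eq_iff)
  qed
  have in_plane: "x \<in> span {edge_frame i j True, edge_frame i j False}"
    if x: "x \<in> zero_diag E" and ij: "i \<noteq> j" and supp: "\<And>a b. x $ a $ b \<noteq> 0 \<Longrightarrow> {a, b} = {i, j}"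
    for x :: "complex ^ 'n ^ 'n" and i j
  proof -
    note herm = zero_diag_herm[OF x, of j i]
    have "(Re (x $ i $ j) *\<^sub>R edge_frame i j True + Im (x $ i $ j) *\<^sub>R edge_frame i j False) $ a $ b = x $ a $ b" for a b
    proof -
      have "(if {a, b} = {i, j} then x $ a $ b else 0) = x $ a $ b"
      proof (cases "x $ a $ b = 0")
        case False
        show ?thesis by (rule if_P, rule supp, rule False)
      qed simp
      then show ?thesis by (rule trans[OF edge_frame_expansion[OF ij herm, of a b]])
    qed
    then have "x = Re (x $ i $ j) *\<^sub>R edge_frame i j True + Im (x $ i $ j) *\<^sub>R edge_frame i j False"
      by (intro mat_eqI) (rule sym)
    also have "\<dots> \<in> span {edge_frame i j True, edge_frame i j False}"
      by (intro span_add span_scale span_base) auto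
    finally show ?thesis .
  qed
  \<comment> \<open>The union of two images of an m-element set has 2m members, so nothing can
    coincide.\<close>
  have distinct: "inj_on u {..<?m}" "u ` {..<?m} \<inter> w ` {..<?m} = {}"
  proof -
    have le: "card (u ` {..<?m}) \<le> ?m" "card (w ` {..<?m}) \<le> ?m"
      using card_image_le[of "{..<?m}" u] card_image_le[of "{..<?m}" w] by simp_all
    have sum: "card (u ` {..<?m}) + card (w ` {..<?m}) = 2 * ?m + card (u ` {..<?m} \<inter> w ` {..<?m})"
      using card_Un_Int[of "u ` {..<?m}" "w ` {..<?m}"] B(1) by simp
    then have "card (u ` {..<?m}) = card {..<?m}" using le by simp
    then show "inj_on u {..<?m}" by (intro eq_card_imp_inj_on) simp_all
    have "card (u ` {..<?m} \<inter> w ` {..<?m}) = 0" using le sum by linarith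
    then show "u ` {..<?m} \<inter> w ` {..<?m} = {}" by simp
  qed
  have "k = k'" if k: "k < ?m" "k' < ?m" "{?I k, ?J k} = {?I k', ?J k'}" for k k'
  proof (rule ccontr)
    assume ne: "k \<noteq> k'"
    let ?i = "?I k" and ?j = "?J k"
    let ?S = "{u k, w k, u k'}"
    have "u k \<in> span {edge_frame ?i ?j True, edge_frame ?i ?j False}"
      by (rule in_plane[OF uZ[OF k(1)] edge(1)[OF k(1)]]) (use support[OF k(1)] in blast)
    moreover have "w k \<in> span {edge_frame ?i ?j True, edge_frame ?i ?j False}"
      by (rule in_plane[OF wZ[OF k(1)] edge(1)[OF k(1)]]) (use support[OF k(1)] in blast)
    moreover have "u k' \<in> span {edge_frame ?i ?j True, edge_frame ?i ?j False}"
      by (rule in_plane[OF uZ[OF k(2)] edge(1)[OF k(1)]]) (use support[OF k(2)] k(3) in blast)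
    ultimately have "?S \<subseteq> span {edge_frame ?i ?j True, edge_frame ?i ?j False}" by simp
    moreover have "?S \<subseteq> ?B" using k by auto
    then have "independent ?S" by (rule independent_mono[OF B(2)])
    ultimately have "card ?S \<le> card {edge_frame ?i ?j True, edge_frame ?i ?j False}"
      using independent_span_bound[of "{edge_frame ?i ?j True, edge_frame ?i ?j False}" ?S] by simp
    also have "\<dots> \<le> 2" by (simp add: card_insert_if)
    finally have "card ?S \<le> 2" .
    moreover have "u k \<noteq> u k'" using distinct(1) k ne by (auto simp: inj_on_def)
    moreover have "u k \<noteq> w k" "u k' \<noteq> w k" using distinct(2) k by auto
    ultimately show False by (auto simp: card_insert_if)
  qed
  then show ?thesis using edge weight
    by (intro exI[of _ ?I] exI[of _ ?J] conjI allI impI) simp_all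
qed

text \<open>In a dependency with \<open>c k0 \<noteq> 0\<close> the vector of \<open>k0\<close> lies
  in the span of the others, which means that their edges connect its ends. Closing the path by the
  edge of \<open>k0\<close> gives a cycle of at least g vertices, while the path uses at most
  \<open>card K - 1\<close> edges.\<close>

lemma edges_rat_independent:
  fixes E :: "'n::finite set set"
  assumes E: "simple_graph E" and J: "finite K" "enat (card K) \<le> girth E - 1"
    and edge: "\<And>k. k \<in> K \<Longrightarrow> {I k, J k} \<in> E \<and> I k \<noteq> J k"
    and weight: "\<And>k. k \<in> K \<Longrightarrow> \<alpha> k = edge_weight (I k) (J k) \<or> \<alpha> k = (\<lambda>c. - edge_weight (I k) (J k) c)"
    and inj: "\<And>k k'. k \<in> K \<Longrightarrow> k' \<in> K \<Longrightarrow> {I k, J k} = {I k', J k'} \<Longrightarrow> k = k'"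
  shows "rat_independent \<alpha> K"
  unfolding rat_independent_def
proof (intro allI impI ballI, rule ccontr)
  fix c :: "nat \<Rightarrow> rat" and k0
  assume c: "\<forall>i. (\<Sum>k\<in>K. c k * of_int (\<alpha> k i)) = 0" and k0: "k0 \<in> K" "c k0 \<noteq> 0"
  define W where "W = (\<lambda>k. {I k, J k}) ` (K - {k0})"
  define a :: "nat \<Rightarrow> real ^ 'n" where "a k = (\<chi> i. of_int (\<alpha> k i))" for k
  define d :: "nat \<Rightarrow> real ^ 'n" where "d k = axis (I k) 1 - axis (J k) 1" for k
  have ad: "a k = d k \<or> a k = - d k" if k: "k \<in> K" for k
  proof -
    have "(\<chi> i. real_of_int (edge_weight (I k) (J k) i)) = d k"
      using edge[OF k] by (auto simp: vec_eq_iff d_def axis_def edge_weight_def)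
    then show ?thesis using weight[OF k] by (auto simp: a_def vec_eq_iff)
  qed
  \<comment> \<open>The coefficients are rational but the spans are real; the dependency is
    transported by \<open>of_rat\<close>.\<close>
  have component: "(\<Sum>k\<in>K. of_rat (c k) *\<^sub>R a k) $ i = 0" for i
  proof -
    have "(\<Sum>k\<in>K. of_rat (c k) *\<^sub>R a k) $ i = of_rat (\<Sum>k\<in>K. c k * of_int (\<alpha> k i))"
      by (simp add: a_def of_rat_sum of_rat_mult)
    then show ?thesis using c by simp
  qed
  have "(\<Sum>k\<in>K. of_rat (c k) *\<^sub>R a k) = 0"
    by (rule vec_eq_iff[THEN iffD2], rule allI) (simp only: component zero_index)
  then have "of_rat (c k0) *\<^sub>R a k0 + (\<Sum>k\<in>K - {k0}. of_rat (c k) *\<^sub>R a k) = 0"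
    by (rule trans[OF sum.remove[OF J(1) k0(1), of "\<lambda>k. of_rat (c k) *\<^sub>R a k", symmetric]])
  then have k0_eq: "of_rat (c k0) *\<^sub>R a k0 = - (\<Sum>k\<in>K - {k0}. of_rat (c k) *\<^sub>R a k)"
    by (rule eq_neg_iff_add_eq_0[THEN iffD2])
  have d_span: "d k \<in> span (edge_vectors W)" if kK: "k \<in> K - {k0}" for k
  proof -
    have "{I k, J k} \<in> W" unfolding W_def using kK by (rule imageI)
    then have "d k \<in> edge_vectors W" unfolding d_def edge_vectors_def by blast
    then show ?thesis by (rule span_base)
  qed
  have a_span: "a k \<in> span (edge_vectors W)" if kK: "k \<in> K - {k0}" for k
    using ad[of k] kK d_span[OF kK] span_neg[OF d_span[OF kK]] by auto
  have "of_rat (c k0) *\<^sub>R a k0 \<in> span (edge_vectors W)"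
    unfolding k0_eq by (intro span_neg span_sum span_scale a_span)
  then have "inverse (of_rat (c k0)) *\<^sub>R of_rat (c k0) *\<^sub>R a k0 \<in> span (edge_vectors W)" by (rule span_scale)
  then have a0: "a k0 \<in> span (edge_vectors W)" using k0(2) by simp
  have "d k0 \<in> span (edge_vectors W)"
    using ad[OF k0(1)] a0 span_neg[OF a0] by (elim disjE) simp_all
  then have path: "(I k0, J k0) \<in> (adj_on W UNIV)\<^sup>*" unfolding d_def span_edge_vectors_iff .
  have WE: "W \<subseteq> E" using edge by (auto simp: W_def)
  \<comment> \<open>Distinct indices carry distinct edges, so the edge of \<open>k0\<close> is a
    genuine chord of \<open>W\<close>.\<close>
  have "{I k0, J k0} \<notin> W" unfolding W_def using inj[OF k0(1)] by blast
  then obtain vs where vs: "distinct vs" "girth E \<le> enat (length vs)"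
    "\<forall>i. Suc i < length vs \<longrightarrow> {vs ! i, vs ! Suc i} \<in> W"
    using chord_path[OF E WE, of "I k0" "J k0"] edge[OF k0(1)] path by auto
  have "card W \<le> card (K - {k0})" unfolding W_def using J(1) by (intro card_image_le) simp
  then have len: "length vs \<le> card K"
    using card_path_edges[of W vs] vs card_Suc_Diff1[OF J(1) k0(1)] by simp
  obtain g where g: "girth E = enat g" using vs(2) by (cases "girth E") auto
  have "3 \<le> g" using girth_ge_3[of E] by (simp add: g numeral_eq_enat)
  moreover have "g \<le> length vs" using vs(2) by (simp add: g)
  moreover have "card K \<le> g - 1" using J(2) by (simp add: g one_enat_def)
  ultimately show False using len by linarith
qed

lemma isospectral_independent:
  fixes E :: "'n::finite set set"
  assumes E: "simple_graph E" and gen: "generic E l"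
  shows "j_independent conj_action (isospectral E l) (card E) (girth E - 1)"
  unfolding j_independent_def
proof (intro ballI conjI allI impI)
  fix x assume "x \<in> fixed_points conj_action torus (isospectral E l)"
  then obtain p where p: "bij p" "x = diagm l p"
    using torus_fixed_points[of l E] gen by (auto simp: generic_def)
  show "\<exists>\<alpha>. tangent_weights conj_action (isospectral E l) (card E) x \<alpha>"
    unfolding p(2) by (rule tangent_weights_exist[OF E gen p(1)])
  fix \<alpha> K assume \<alpha>: "tangent_weights conj_action (isospectral E l) (card E) x \<alpha>"
    and K: "K \<subseteq> {..<card E}" "enat (card K) \<le> girth E - 1"
  obtain I J where IJ: "\<forall>k<card E. {I k, J k} \<in> E \<and> I k \<noteq> J k \<and>
      (\<alpha> k = edge_weight (I k) (J k) \<or> \<alpha> k = (\<lambda>c. - edge_weight (I k) (J k) c))"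
    "\<forall>k<card E. \<forall>k'<card E. {I k, J k} = {I k', J k'} \<longrightarrow> k = k'"
    using weights_are_edges[OF E gen p(1) \<alpha>[unfolded p(2)]] by (elim exE conjE) (rule that; assumption)
  have lt: "k < card E" if "k \<in> K" for k using K(1) that by auto
  show "rat_independent \<alpha> K"
  proof (rule edges_rat_independent[OF E _ K(2), of I J])
    show "finite K" using K(1) by (rule finite_subset) simp
    fix k assume k: "k \<in> K"
    note * = IJ(1)[rule_format, OF lt[OF k]]
    show "{I k, J k} \<in> E \<and> I k \<noteq> J k" using * by (intro conjI) (elim conjE; assumption)+
    show "\<alpha> k = edge_weight (I k) (J k) \<or> \<alpha> k = (\<lambda>c. - edge_weight (I k) (J k) c)"
      using * by (elim conjE)
    fix k' assume "k' \<in> K" "{I k, J k} = {I k', J k'}"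
    then show "k = k'" by (intro IJ(2)[rule_format] lt k)
  qed
qed

theorem theorem1:
  fixes E :: "'n::finite set set"
  assumes "simple_graph E" and "connected_on E UNIV"
  shows
    "(\<forall>l. generic E l \<longrightarrow>
        (\<exists>f. poset_iso (face_poset conj_action (isospectral E l)) (cluster_perm E) f \<and>
          (\<forall>F\<in>carrier (face_poset conj_action (isospectral E l)).
             cl_rank (f F) = face_rank conj_action F)))
     \<and>
     (locally_geometric (cluster_perm E) \<and>
      isomorphic_posets (skeleton (cluster_perm E) cl_rank 1) (cayley E) \<and>
      geometric_lattice (flats E) \<and>
      (\<forall>x\<in>carrier (cluster_perm E). cl_rank x = 0 \<longrightarrow>
         isomorphic_posets (upper_ideal (cluster_perm E) x) (flats E)))
     \<and>
     ((\<exists>\<iota> \<pi>. isotone (cluster_perm E) (graphicahedron E) \<iota> \<and>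
         isotone (graphicahedron E) (cluster_perm E) \<pi> \<and>
         galois_connection \<lparr>orderA = graphicahedron E, orderB = cluster_perm E,
                            lower = \<pi>, upper = \<iota>\<rparr> \<and>
         (\<forall>j. \<iota> ` carrier (skeleton (cluster_perm E) cl_rank j)
                \<subseteq> carrier (skeleton (graphicahedron E) gr_conn j) \<and>
              \<pi> ` carrier (skeleton (graphicahedron E) gr_conn j)
                \<subseteq> carrier (skeleton (cluster_perm E) cl_rank j))) \<and>
      (\<forall>j::nat. j < poset_rank (cluster_perm E) cl_rank \<longrightarrow>
         is_core_of (skeleton (cluster_perm E) cl_rank j) (skeleton (graphicahedron E) gr_conn j)))
     \<and>
     (isomorphic_posets (skeleton (cluster_perm E) cl_rank (girth E - 2))
                        (skeleton (graphicahedron E) gr_conn (girth E - 2)) \<and>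
      (is_tree E \<longrightarrow> poset_iso (graphicahedron E) (cluster_perm E) gr_to_cl))
     \<and>
     (\<forall>l. generic E l \<longrightarrow>
        j_independent conj_action (isospectral E l) (card E) (girth E - 1))"
proof (intro conjI)
  show "\<forall>l. generic E l \<longrightarrow>
      (\<exists>f. poset_iso (face_poset conj_action (isospectral E l)) (cluster_perm E) f \<and>
        (\<forall>F\<in>carrier (face_poset conj_action (isospectral E l)).
           cl_rank (f F) = face_rank conj_action F))"
  proof (intro allI impI)
    fix l assume "generic E l"
    then have "inj l" by (simp add: generic_def)
    then show "\<exists>f. poset_iso (face_poset conj_action (isospectral E l)) (cluster_perm E) f \<and>
        (\<forall>F\<in>carrier (face_poset conj_action (isospectral E l)). cl_rank (f F) = face_rank conj_action F)"
      by (rule face_poset_iso[OF assms(1)])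
  qed
  show "locally_geometric (cluster_perm E)" by (rule locally_geometric_cl[OF assms])
  show "isomorphic_posets (skeleton (cluster_perm E) cl_rank 1) (cayley E)"
    by (rule skeleton_1_cayley[OF assms(1)])
  show "geometric_lattice (flats E)" by (rule geometric_lattice_flats[OF assms(1)])
  show "\<forall>x\<in>carrier (cluster_perm E). cl_rank x = 0 \<longrightarrow>
      isomorphic_posets (upper_ideal (cluster_perm E) x) (flats E)"
    by (intro ballI impI) (rule rank_0_upper_ideal[OF assms(1)])
  show "\<exists>\<iota> \<pi>. isotone (cluster_perm E) (graphicahedron E) \<iota> \<and>
      isotone (graphicahedron E) (cluster_perm E) \<pi> \<and>
      galois_connection \<lparr>orderA = graphicahedron E, orderB = cluster_perm E,
                         lower = \<pi>, upper = \<iota>\<rparr> \<and>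
      (\<forall>j. \<iota> ` carrier (skeleton (cluster_perm E) cl_rank j)
             \<subseteq> carrier (skeleton (graphicahedron E) gr_conn j) \<and>
           \<pi> ` carrier (skeleton (graphicahedron E) gr_conn j)
             \<subseteq> carrier (skeleton (cluster_perm E) cl_rank j))"
    by (rule galois_cl_gr[OF assms(1)])
  show "\<forall>j::nat. j < poset_rank (cluster_perm E) cl_rank \<longrightarrow>
      is_core_of (skeleton (cluster_perm E) cl_rank j) (skeleton (graphicahedron E) gr_conn j)"
    by (intro allI impI) (rule cl_core_of_gr[OF assms])
  show "isomorphic_posets (skeleton (cluster_perm E) cl_rank (girth E - 2))
      (skeleton (graphicahedron E) gr_conn (girth E - 2))"
    by (rule skeleton_iso_girth[OF assms(1)])
  show "is_tree E \<longrightarrow> poset_iso (graphicahedron E) (cluster_perm E) gr_to_cl"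
    by (intro impI) (rule tree_iso)
  show "\<forall>l. generic E l \<longrightarrow> j_independent conj_action (isospectral E l) (card E) (girth E - 1)"
    by (intro allI impI) (rule isospectral_independent[OF assms(1)])
qed

end
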